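(* Let $k\geq 0$ be an integer. Then the graph classes $\mathcal{C}_k$ and $\mathcal{H}_k$ coincide.
   Context: Graphs are finite, undirected, without loops or multiple edges; $\chi$ is the chromatic number. A graph $G$ is critical if every proper subgraph $H$ of $G$ satisfies $\chi(H)<\chi(G)$. For distinct vertices $v,w$, $\lambda_G(v,w)$ is the maximum number of pairwise edge-disjoint $v$-$w$ paths in $G$; $\lambda(G)=\max\{\lambda_G(v,w): v\neq w\}$ if $|V(G)|\geq 2$, and $\lambda(G)=0$ if $|V(G)|=1$. $\mathcal{C}_k$ is the class of critical graphs $H$ with $\chi(H)=k+1$ and $\lambda(H)\leq k$. Hajós join: for vertex-disjoint graphs $G_1,G_2$ and edges $e_i=v_iw_i\in E(G_i)$, the Hajós join $G_1\triangle G_2$ is obtained by deleting $e_1,e_2$, identifying $v_1$ with $v_2$, and adding the edge $w_1w_2$. $\mathcal{H}_k$: for $k\in\{0,1\}$, the complete graphs of order $k+1$; $\mathcal{H}_2$ the odd cycles; $\mathcal{H}_3$ the smallest class containing all odd wheels (an odd cycle plus a new vertex adjacent to all cycle vertices) and closed under Hajós joins; for $k\geq 4$, the smallest class containing all complete graphs of order $k+1$ and closed under Hajós joins. *)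

theory Defs
  imports Main "HOL-Library.Infinite_Typeclass"
begin

record 'a ugraph =
  verts :: "'a set"
  edges :: "'a set set"

definition simple_graph :: "'a ugraph \<Rightarrow> bool" where
  "simple_graph G \<longleftrightarrow>
     finite (verts G) \<and> (\<forall>e\<in>edges G. e \<subseteq> verts G \<and> card e = 2)"

definition subgraph :: "'a ugraph \<Rightarrow> 'a ugraph \<Rightarrow> bool" where
  "subgraph H G \<longleftrightarrow>
     simple_graph H \<and> simple_graph G \<and> verts H \<subseteq> verts G \<and> edges H \<subseteq> edges G"

definition proper_coloring :: "'a ugraph \<Rightarrow> nat \<Rightarrow> ('a \<Rightarrow> nat) \<Rightarrow> bool" where
  "proper_coloring G n c \<longleftrightarrow>
     (\<forall>v\<in>verts G. c v < n) \<and> (\<forall>u v. {u, v} \<in> edges G \<longrightarrow> c u \<noteq> c v)"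

definition chromatic_number :: "'a ugraph \<Rightarrow> nat" where
  "chromatic_number G = (LEAST n. \<exists>c. proper_coloring G n c)"

definition critical :: "'a ugraph \<Rightarrow> bool" where
  "critical G \<longleftrightarrow>
     simple_graph G \<and>
     (\<forall>H. subgraph H G \<and> H \<noteq> G \<longrightarrow> chromatic_number H < chromatic_number G)"

definition path_edges :: "'a list \<Rightarrow> 'a set set" where
  "path_edges p = {{p ! i, p ! Suc i} | i. Suc i < length p}"

definition is_path :: "'a ugraph \<Rightarrow> 'a \<Rightarrow> 'a list \<Rightarrow> 'a \<Rightarrow> bool" where
  "is_path G v p w \<longleftrightarrow>
     p \<noteq> [] \<and> hd p = v \<and> last p = w \<and> distinct p \<and>
     set p \<subseteq> verts G \<and> path_edges p \<subseteq> edges G"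

text \<open>
  Only used for \<open>v \<noteq> w\<close>. Then every path from \<open>v\<close> to \<open>w\<close> has an edge, so an edge-disjoint
  family has no repeated members and may be taken to be a set. A path is a vertex list
  directed from \<open>v\<close> to \<open>w\<close>, but its edges are unordered pairs.
\<close>
definition local_edge_conn :: "'a ugraph \<Rightarrow> 'a \<Rightarrow> 'a \<Rightarrow> nat" where
  "local_edge_conn G v w =
     Max {card P | P. (\<forall>p\<in>P. is_path G v p w) \<and>
                      pairwise (\<lambda>p q. path_edges p \<inter> path_edges q = {}) P}"

definition max_local_edge_conn :: "'a ugraph \<Rightarrow> nat" where
  "max_local_edge_conn G =
     (if card (verts G) \<ge> 2
      then Max {local_edge_conn G v w | v w. v \<in> verts G \<and> w \<in> verts G \<and> v \<noteq> w}
      else 0)"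

definition class_C :: "nat \<Rightarrow> 'a ugraph set" where
  "class_C k =
     {G. critical G \<and> chromatic_number G = k + 1 \<and> max_local_edge_conn G \<le> k}"

definition complete_graph :: "nat \<Rightarrow> 'a ugraph \<Rightarrow> bool" where
  "complete_graph n G \<longleftrightarrow>
     finite (verts G) \<and> card (verts G) = n \<and>
     edges G = {{u, v} | u v. u \<in> verts G \<and> v \<in> verts G \<and> u \<noteq> v}"

definition odd_cycle :: "'a ugraph \<Rightarrow> bool" where
  "odd_cycle G \<longleftrightarrow>
     (\<exists>vs. distinct vs \<and> length vs \<ge> 3 \<and> odd (length vs) \<and> verts G = set vs \<and>
           edges G = {{vs ! i, vs ! (Suc i mod length vs)} | i. i < length vs})"

definition odd_wheel :: "'a ugraph \<Rightarrow> bool" where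
  "odd_wheel G \<longleftrightarrow>
     (\<exists>C h. odd_cycle C \<and> h \<notin> verts C \<and>
            verts G = insert h (verts C) \<and>
            edges G = edges C \<union> {{h, v} | v. v \<in> verts C})"

text \<open>
  The Hajos join along the edges \<open>v1 w1\<close> and \<open>v2 w2\<close>; the vertex obtained by identifying
  \<open>v1\<close> with \<open>v2\<close> keeps the name \<open>v1\<close>. Vertex-disjointness and the membership of the two
  edges are premises of the rule \<open>join\<close> below.
\<close>
definition hajos_join ::
  "'a ugraph \<Rightarrow> 'a \<Rightarrow> 'a \<Rightarrow> 'a ugraph \<Rightarrow> 'a \<Rightarrow> 'a \<Rightarrow> 'a ugraph" where
  "hajos_join G1 v1 w1 G2 v2 w2 =
     \<lparr> verts = verts G1 \<union> (verts G2 - {v2}),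
       edges = (edges G1 - {{v1, w1}})
             \<union> (\<lambda>e. id(v2 := v1) ` e) ` (edges G2 - {{v2, w2}})
             \<union> {{w1, w2}} \<rparr>"

text \<open>
  There is no separate rule for isomorphic copies. Over an infinite vertex type the closure of
  an isomorphism-closed set is itself isomorphism-closed: to realize a renaming of a join,
  rename \<open>G1\<close> and \<open>G2\<close> accordingly, sending \<open>v2\<close> to an unused vertex. Over a finite vertex
  type there may be no room for disjoint copies of \<open>G1\<close> and \<open>G2\<close>.
\<close>
inductive_set hajos_closure :: "'a ugraph set \<Rightarrow> 'a ugraph set" for B where
  base: "G \<in> B \<Longrightarrow> G \<in> hajos_closure B"
| join: "\<lbrakk> G1 \<in> hajos_closure B; G2 \<in> hajos_closure B; verts G1 \<inter> verts G2 = {};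
           {v1, w1} \<in> edges G1; {v2, w2} \<in> edges G2 \<rbrakk>
         \<Longrightarrow> hajos_join G1 v1 w1 G2 v2 w2 \<in> hajos_closure B"

definition class_H :: "nat \<Rightarrow> 'a ugraph set" where
  "class_H k =
     (if k \<le> 1 then {G. complete_graph (k + 1) G}
      else if k = 2 then {G. odd_cycle G}
      else if k = 3 then hajos_closure {G. odd_wheel G}
      else hajos_closure {G. complete_graph (k + 1) G})"

end

theory Submission
  imports Defs "HOL-Combinatorics.Transposition"
begin

text \<open>
  By Menger's theorem, \<open>\<lambda>(G) \<le> k\<close> means that any two vertices are separated by an edge cut of size
  at most \<open>k\<close>, and this property, like \<open>(k+1)\<close>-criticality, passes between a Hajos join and its two
  parts. So it remains to see that for \<open>k \<ge> 3\<close> a graph \<open>G\<close> in \<open>C\<^sub>k\<close> that is no Hajos join is complete or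
  an odd wheel. Every edge cut of \<open>G\<close> has size at least \<open>k\<close>, and if equality holds then in all
  \<open>k\<close>-colourings its ends are monochromatic on one side and rainbow on the other. Replacing the rainbow
  side by a clique on its \<open>k\<close> ends gives a smaller graph in \<open>C\<^sub>k\<close>, which cannot be decomposed either; by
  induction this is only possible if every vertex of the rainbow side is already such an end and hence
  has degree \<open>k\<close>. Two vertices of degree greater than \<open>k\<close> would be separated by a cut of this
  kind, so there is at most one, say \<open>v\<close>. Removing two vertices never disconnects \<open>G\<close>, since otherwise
  \<open>G\<close> would be a Hajos join. Hence Lovasz's greedy argument for Brooks' theorem shows first that \<open>v\<close>
  is adjacent to all other vertices, and then that \<open>G - v\<close> is an odd cycle or complete.
\<close>

section \<open>Colourings, cuts and critical graphs\<close>

text \<open>Families of edge-disjoint paths do not pass to the parts of a join or to a graph with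
  one side of a cut exchanged, while small cuts can be restricted, complemented and uncrossed. So
  the structural argument speaks of cuts only.

  Why tight cuts are rigid: colourings of the two sides combine after permuting the colours of one
  of them, unless the colour pairs on the cut edges meet every permutation. These are at most
  \<open>k\<close> cells of a \<open>k\<close> x \<open>k\<close> board, and only a full row or
  column does that: one colour on one side, all \<open>k\<close> colours on the other.

  The exchanged graph keeps the cut bound by submodularity, since no nontrivial cut has fewer than
  \<open>k\<close> edges. If it is smaller, induction makes it complete or a wheel; both have a
  vertex adjacent to all others, which is impossible once the monochromatic side has two vertices.

  The bound \<open>k >= 3\<close> supplies a third colour, both for splitting a Hajos join and in
  Brooks' argument; for smaller \<open>k\<close> the critical graphs are determined
  directly.\<close>

definition simple_on :: "'a set \<Rightarrow> 'a set set \<Rightarrow> bool" where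
  "simple_on V E \<longleftrightarrow> finite V \<and> (\<forall>e\<in>E. e \<subseteq> V \<and> card e = 2)"

text \<open>Only edges with both ends in \<open>X\<close> count, so one edge set \<open>E\<close>
  serves for all induced subgraphs.\<close>

definition colors :: "'a set set \<Rightarrow> 'a set \<Rightarrow> nat \<Rightarrow> ('a \<Rightarrow> nat) \<Rightarrow> bool" where
  "colors E X k c \<longleftrightarrow> (\<forall>x\<in>X. c x < k) \<and> (\<forall>x\<in>X. \<forall>y\<in>X. {x, y} \<in> E \<longrightarrow> c x \<noteq> c y)"

definition nbrs :: "'a set set \<Rightarrow> 'a \<Rightarrow> 'a set" where
  "nbrs E x = {y. {x, y} \<in> E}"

text \<open>Cut edges are counted as pairs directed out of \<open>X\<close>, which makes the cut function submodular
  pair by pair.\<close>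

definition cut :: "'a set set \<Rightarrow> 'a set \<Rightarrow> ('a \<times> 'a) set" where
  "cut E X = {(x, y). x \<in> X \<and> y \<notin> X \<and> {x, y} \<in> E}"

text \<open>The critical graphs with chromatic number \<open>k + 1\<close>, see \<open>crit_iff\<close> below.\<close>

definition crit :: "nat \<Rightarrow> 'a set \<Rightarrow> 'a set set \<Rightarrow> bool" where
  "crit k V E \<longleftrightarrow> simple_on V E \<and> (\<nexists>c. colors E V k c) \<and>
     (\<forall>e\<in>E. \<exists>c. colors (E - {e}) V k c) \<and> (\<forall>X. X \<subset> V \<longrightarrow> (\<exists>c. colors E X k c))"

definition cut_bounded :: "nat \<Rightarrow> 'a set \<Rightarrow> 'a set set \<Rightarrow> bool" where
  "cut_bounded k V E \<longleftrightarrow>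
     (\<forall>p\<in>V. \<forall>q\<in>V. p \<noteq> q \<longrightarrow> (\<exists>Z\<subseteq>V. p \<in> Z \<and> q \<notin> Z \<and> card (cut E Z) \<le> k))"

lemma simple_onD:
  assumes "simple_on V E" "{x, y} \<in> E"
  shows "x \<in> V" "y \<in> V" "x \<noteq> y"
proof -
  have "{x, y} \<subseteq> V" "card {x, y} = 2" using assms unfolding simple_on_def by blast+
  then show "x \<in> V" "y \<in> V" "x \<noteq> y" by auto
qed

lemma simple_on_edgeE:
  assumes "simple_on V E" "e \<in> E"
  obtains x y where "e = {x, y}" "x \<noteq> y" "x \<in> V" "y \<in> V"
proof -
  from assms have "card e = 2" "e \<subseteq> V" by (auto simp: simple_on_def)
  then show ?thesis using that by (auto simp: card_2_iff)
qed

lemma simple_on_finite: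
  assumes "simple_on V E"
  shows "finite V" "finite E" "finite (cut E X)" "finite (nbrs E x)"
proof -
  show V: "finite V" using assms by (simp add: simple_on_def)
  have "E \<subseteq> Pow V" using assms by (auto simp: simple_on_def)
  then show "finite E" using V finite_subset by blast
  have "cut E X \<subseteq> V \<times> V" by (auto simp: cut_def dest: simple_onD[OF assms])
  then show "finite (cut E X)" using V finite_subset by blast
  have "nbrs E x \<subseteq> V" by (auto simp: nbrs_def dest: simple_onD[OF assms])
  then show "finite (nbrs E x)" using V finite_subset by blast
qed

lemma card_cut_singleton:
  assumes "simple_on V E"
  shows "card (cut E {x}) = card (nbrs E x)"
proof -
  have "cut E {x} = Pair x ` nbrs E x"
    by (auto simp: cut_def nbrs_def dest: simple_onD(3)[OF assms])
  then show ?thesis by (simp add: card_image inj_on_def)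
qed

lemma card_cut_compl:
  assumes "simple_on V E" "X \<subseteq> V"
  shows "card (cut E (V - X)) = card (cut E X)"
proof -
  have "cut E (V - X) = prod.swap ` cut E X"
  proof (intro set_eqI iffI)
    fix p assume "p \<in> cut E (V - X)"
    then obtain x y where "p = (x, y)" "x \<in> V - X" "y \<notin> V - X" "{x, y} \<in> E"
      by (auto simp: cut_def)
    moreover from this have "y \<in> V" using simple_onD[OF assms(1)] by blast
    ultimately show "p \<in> prod.swap ` cut E X"
      by (intro image_eqI[of _ _ "(y, x)"]) (auto simp: cut_def insert_commute)
  next
    fix p assume "p \<in> prod.swap ` cut E X"
    then obtain x y where "p = (x, y)" "y \<in> X" "x \<notin> X" "{x, y} \<in> E"
      by (auto simp: cut_def insert_commute)
    moreover from this have "x \<in> V" using simple_onD[OF assms(1)] by blast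
    ultimately show "p \<in> cut E (V - X)"
      using assms(2) by (auto simp: cut_def)
  qed
  then show ?thesis by (simp add: card_image)
qed

lemma cut_submodular:
  assumes "simple_on V E"
  shows "card (cut E (X \<inter> Z)) + card (cut E (X \<union> Z)) \<le> card (cut E X) + card (cut E Z)"
proof -
  define A where "A = {(x, y). {x, y} \<in> E}"
  have "A \<subseteq> V \<times> V" by (auto simp: A_def dest: simple_onD[OF assms])
  then have A: "finite A" using simple_on_finite(1)[OF assms] finite_subset by blast
  have card: "card (cut E Y) = (\<Sum>(x, y)\<in>A. if x \<in> Y \<and> y \<notin> Y then 1 else 0)" for Y
  proof -
    have "cut E Y = {p \<in> A. fst p \<in> Y \<and> snd p \<notin> Y}" by (auto simp: cut_def A_def)
    then show ?thesis using A by (simp add: case_prod_unfold flip: sum.inter_filter)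
  qed
  show ?thesis unfolding card sum.distrib[symmetric] by (rule sum_mono) auto
qed

section \<open>Permuting, gluing and extending colourings\<close>

lemma colorsD:
  assumes "colors E X k c"
  shows "x \<in> X \<Longrightarrow> c x < k" "x \<in> X \<Longrightarrow> y \<in> X \<Longrightarrow> {x, y} \<in> E \<Longrightarrow> c x \<noteq> c y"
  using assms by (auto simp: colors_def)

lemma colors_cong: "(\<And>x. x \<in> X \<Longrightarrow> c x = d x) \<Longrightarrow> colors E X k c \<longleftrightarrow> colors E X k d"
  by (auto simp: colors_def)

lemma colors_mono:
  assumes "colors E X k c" "F \<inter> Pow Y \<subseteq> E" "Y \<subseteq> X" "k \<le> l"
  shows "colors F Y l c"
proof -
  have "c x \<noteq> c y" if "x \<in> Y" "y \<in> Y" "{x, y} \<in> F" for x y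
    using assms that by (auto simp: colors_def subset_iff)
  moreover have "c x < l" if "x \<in> Y" for x
    using assms that by (auto simp: colors_def intro: less_le_trans)
  ultimately show ?thesis by (simp add: colors_def)
qed

lemma colors_permute:
  assumes "colors E X k c" "inj_on f {..<k}" "f ` {..<k} \<subseteq> {..<k}"
  shows "colors E X k (f \<circ> c)"
  using assms unfolding colors_def inj_on_def by (simp add: image_subset_iff) blast

lemma colors_recolor1:
  assumes "colors E X k c" "x \<in> X" "i < k"
  obtains d where "colors E X k d" "d x = i"
proof
  show "colors E X k (transpose (c x) i \<circ> c)"
    using assms by (intro colors_permute) (auto simp: colors_def transpose_def)
qed simp

lemma colors_recolor2:
  assumes "colors E X k c" "x \<in> X" "y \<in> X" "c x \<noteq> c y" "i < k" "j < k" "i \<noteq> j"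
  obtains d where "colors E X k d" "d x = i" "d y = j"
proof -
  obtain d where d: "colors E X k d" "d = transpose (c x) i \<circ> c"
    using colors_permute[OF assms(1), of "transpose (c x) i"] assms
    by (auto simp: colors_def transpose_def image_subset_iff)
  have "d y \<noteq> i" "d x = i" using assms(4) d(2) by (auto simp: transpose_def)
  moreover have "colors E X k (transpose (d y) j \<circ> d)"
    using d(1) assms by (intro colors_permute) (auto simp: colors_def transpose_def)
  ultimately show ?thesis using that[of "transpose (d y) j \<circ> d"] \<open>i \<noteq> j\<close> by simp
qed

lemma colors_glue:
  assumes "colors E X k c" "colors E Y k d" "\<And>x. x \<in> X \<Longrightarrow> x \<in> Y \<Longrightarrow> c x = d x"
    and "\<And>x y. x \<in> X - Y \<Longrightarrow> y \<in> Y - X \<Longrightarrow> {x, y} \<in> E \<Longrightarrow> c x \<noteq> d y"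
  shows "colors E (X \<union> Y) k (\<lambda>x. if x \<in> X then c x else d x)"
  unfolding colors_def
proof (intro conjI ballI impI)
  fix x assume "x \<in> X \<union> Y" 
  then show "(if x \<in> X then c x else d x) < k" using assms(1,2) by (auto simp: colors_def)
next
  fix x y assume xy: "x \<in> X \<union> Y" "y \<in> X \<union> Y" "{x, y} \<in> E"
  then have yx: "{y, x} \<in> E" by (simp add: insert_commute)
  consider "x \<in> X" "y \<in> X" | "x \<in> Y" "y \<in> Y" | "x \<in> X - Y" "y \<in> Y - X" | "y \<in> X - Y" "x \<in> Y - X"
    using xy by blast
  then show "(if x \<in> X then c x else d x) \<noteq> (if y \<in> X then c y else d y)"
  proof cases
    case 1 then show ?thesis using assms(1) xy by (auto simp: colors_def)
  next
    case 2
    then have "d x \<noteq> d y" using assms(2) xy by (auto simp: colors_def)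
    then show ?thesis using 2 assms(3) by auto
  next
    case 3 then show ?thesis using assms(4) xy by auto
  next
    case 4 then show ?thesis using assms(4)[OF _ _ yx] by force
  qed
qed

lemma colors_new_color:
  assumes simple: "simple_on V E" and c: "colors E (V - {x}) k c"
  shows "colors E V (Suc k) (c(x := k))"
  unfolding colors_def
proof (intro conjI ballI impI)
  fix y assume "y \<in> V"
  then show "(c(x := k)) y < Suc k" using c by (auto simp: colors_def less_SucI)
next
  fix y z assume yz: "y \<in> V" "z \<in> V" "{y, z} \<in> E"
  have "y \<noteq> z" using simple_onD(3)[OF simple yz(3)] .
  moreover have "c t < k" if "t \<in> V" "t \<noteq> x" for t using c that by (auto simp: colors_def)
  moreover have "c y \<noteq> c z" if "y \<noteq> x" "z \<noteq> x" using c yz that by (auto simp: colors_def)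
  ultimately show "(c(x := k)) y \<noteq> (c(x := k)) z" using yz by (auto dest: less_imp_neq)
qed

lemma crit_simple: "crit k V E \<Longrightarrow> simple_on V E"
  by (simp add: crit_def)

lemma crit_not_colors: "crit k V E \<Longrightarrow> \<not> colors E V k c"
  by (auto simp: crit_def)

lemma crit_colors_subset:
  assumes "crit k V E" "X \<subseteq> V" "X \<noteq> V"
  shows "\<exists>c. colors E X k c"
  using assms unfolding crit_def by blast

lemma crit_colors_del:
  assumes "crit k V E" "e \<in> E"
  obtains c where "colors (E - {e}) V k c"
  using assms unfolding crit_def by blast

text \<open>Deleting an edge at a vertex \<open>x\<close> outside \<open>X\<close> leaves a
  colouring that is proper on \<open>X\<close>; so once no vertex is isolated, the condition on
  vertex subsets follows from the one on edges.\<close>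

lemma critI:
  assumes "simple_on V E" "\<And>c. \<not> colors E V k c"
    and "\<And>e. e \<in> E \<Longrightarrow> \<exists>c. colors (E - {e}) V k c" "\<And>x. x \<in> V \<Longrightarrow> \<exists>y. {x, y} \<in> E"
  shows "crit k V E"
  unfolding crit_def
proof (intro conjI allI impI ballI)
  fix X assume "X \<subset> V"
  then obtain x where x: "x \<in> V" "x \<notin> X" by blast
  then obtain y where "{x, y} \<in> E" using assms(4) by blast
  then obtain c where c: "colors (E - {{x, y}}) V k c" using assms(3) by blast
  have "colors E X k c"
    using x \<open>X \<subset> V\<close> by (intro colors_mono[OF c]) auto
  then show "\<exists>c. colors E X k c" by blast
qed (use assms(1-3) in blast)+

text \<open>The bound counts the colours around \<open>x\<close>, not its neighbours: the greedy
  argument profits from two neighbours of the same colour.\<close>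

lemma colors_one_step:
  assumes simple: "simple_on V E" and c: "colors E (W - {x}) k c"
    and small: "card (c ` (nbrs E x \<inter> W)) < k"
  shows "\<exists>i<k. colors E W k (c(x := i))"
proof -
  have "finite (c ` (nbrs E x \<inter> W))" using simple_on_finite(4)[OF simple] by blast
  then have "\<not> {..<k} \<subseteq> c ` (nbrs E x \<inter> W)"
    using small by (metis card_lessThan card_mono leD)
  then obtain i where i: "i < k" "i \<notin> c ` (nbrs E x \<inter> W)" by blast
  have "colors E W k (c(x := i))"
    unfolding colors_def
  proof (intro conjI ballI impI)
    fix y z assume yz: "y \<in> W" "z \<in> W" "{y, z} \<in> E"
    have "y \<noteq> z" using simple_onD(3)[OF simple yz(3)] .
    moreover have "{z, y} \<in> E" using yz(3) by (simp add: insert_commute)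
    ultimately show "(c(x := i)) y \<noteq> (c(x := i)) z"
      using c i yz by (auto simp: colors_def nbrs_def)
  qed (use c i in \<open>auto simp: colors_def\<close>)
  then show ?thesis using i by blast
qed

section \<open>Cuts and separating pairs of critical graphs\<close>

text \<open>The cells of \<open>C\<close> are forbidden places for rooks. Fixing a free cell
  \<open>(a, b)\<close> whose row and column together contain two forbidden cells, or all of them,
  leaves fewer than \<open>n\<close> or none on a board of side \<open>n\<close>, too few for a full
  row or column, so the induction proceeds. Such a cell exists because \<open>C\<close> fills
  neither a row nor a column.\<close>

lemma ex_bij_avoiding:
  assumes "finite A" "finite B" "card A = card B" "C \<subseteq> A \<times> B" "card C \<le> card A"
    and "\<And>a. a \<in> A \<Longrightarrow> C \<noteq> {a} \<times> B" "\<And>b. b \<in> B \<Longrightarrow> C \<noteq> A \<times> {b}"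
  shows "\<exists>f. bij_betw f A B \<and> (\<forall>a\<in>A. (a, f a) \<notin> C)"
  using assms
proof (induction "card A" arbitrary: A B C)
  case 0
  then show ?case by (auto simp: bij_betw_def)
next
  case (Suc n)
  have finC: "finite C"
    using Suc.prems(1,2,4) by (meson finite_SigmaI finite_subset)
  have "\<exists>a\<in>A. \<exists>b\<in>B. (a, b) \<notin> C \<and>
    (C \<inter> (A - {a}) \<times> (B - {b}) = {} \<or> card (C \<inter> (A - {a}) \<times> (B - {b})) < n)"
  proof -
    have twice: "card (C \<inter> (A - {a}) \<times> (B - {b})) < n"
      if "s \<in> C" "t \<in> C" "s \<noteq> t" "fst s = a \<or> snd s = b" "fst t = a \<or> snd t = b" for s t a b
    proof -
      have "C \<inter> (A - {a}) \<times> (B - {b}) \<subseteq> C - {s, t}" using that by auto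
      then have "card (C \<inter> (A - {a}) \<times> (B - {b})) \<le> card (C - {s, t})"
        using finC by (intro card_mono) auto
      also have "\<dots> = card C - 2" using that finC by (simp add: card_Diff_subset)
      also have "\<dots> < n"
      proof -
        have "card {s, t} \<le> card C" using that finC by (intro card_mono) auto
        then have "card C \<ge> 2" using that by simp
        then show ?thesis using Suc.prems(5) Suc.hyps(2) by linarith
      qed
      finally show ?thesis .
    qed
    have cardB: "card B = Suc n" using Suc by simp
    \<comment> \<open>Either two forbidden cells share a row or a column, and a free cell of that
      line is taken; or no two share a line, and the cell in the row of \<open>s\<close> and the
      column of \<open>t\<close> is free; or at most one cell is forbidden.\<close>
    consider (row) s t where "s \<in> C" "t \<in> C" "s \<noteq> t" "fst s = fst t"
      | (col) s t where "s \<in> C" "t \<in> C" "s \<noteq> t" "snd s = snd t"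
      | (diag) s t where "s \<in> C" "t \<in> C" "fst s \<noteq> fst t" "snd s \<noteq> snd t"
          "\<forall>s\<in>C. \<forall>t\<in>C. s \<noteq> t \<longrightarrow> fst s \<noteq> fst t \<and> snd s \<noteq> snd t"
      | (sub) s where "C \<subseteq> {s}"
    proof (cases "\<forall>s\<in>C. \<forall>t\<in>C. s \<noteq> t \<longrightarrow> fst s \<noteq> fst t \<and> snd s \<noteq> snd t")
      case True
      then show ?thesis using diag sub by (metis insertCI subsetI)
    next
      case False
      then show ?thesis using row col by blast
    qed
    then show ?thesis
    proof cases
      case row
      have aA: "fst s \<in> A" using row Suc.prems(4) by auto
      have "\<exists>b\<in>B. (fst s, b) \<notin> C"
      proof (rule ccontr)
        assume "\<not> ?thesis"
        then have sub: "{fst s} \<times> B \<subseteq> C" by auto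
        moreover have "card C \<le> card ({fst s} \<times> B)"
          using Suc.prems(3,5) by (simp add: card_cartesian_product)
        ultimately have "C = {fst s} \<times> B" using card_seteq[OF finC] by metis
        then show False using Suc.prems(6) aA by blast
      qed
      then show ?thesis using twice[OF row(1-3)] row(4) aA by metis
    next
      case col
      have bB: "snd s \<in> B" using col Suc.prems(4) by auto
      have "\<exists>a\<in>A. (a, snd s) \<notin> C"
      proof (rule ccontr)
        assume "\<not> ?thesis"
        then have sub: "A \<times> {snd s} \<subseteq> C" by auto
        moreover have "card C \<le> card (A \<times> {snd s})"
          using Suc.prems(5) by (simp add: card_cartesian_product)
        ultimately have "C = A \<times> {snd s}" using card_seteq[OF finC] by metis
        then show False using Suc.prems(7) bB by blast
      qed
      then show ?thesis using twice[OF col(1-3)] col(4) bB by metis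
    next
      case diag
      have "(fst s, snd t) \<notin> C"
        using diag(5) diag(1,4) by (metis fst_conv snd_conv)
      moreover have "fst s \<in> A" "snd t \<in> B" using diag Suc.prems(4) by auto
      ultimately show ?thesis
        using twice[OF diag(1,2)] diag(3) by metis
    next
      case sub
      have "\<exists>a\<in>A. \<exists>b\<in>B. (a, b) \<notin> C \<and> (C \<noteq> {} \<longrightarrow> a = fst s)"
      proof (cases "C = {}")
        case True
        have "A \<noteq> {}" "B \<noteq> {}" using Suc.hyps(2) cardB by auto
        then show ?thesis using True by blast
      next
        case False
        then have C: "C = {s}" using sub by blast
        then have s: "fst s \<in> A" "snd s \<in> B" using Suc.prems(4) by auto
        have "B \<noteq> {snd s}"
        proof
          assume "B = {snd s}"
          then have "C = {fst s} \<times> B" using C by simp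
          then show False using Suc.prems(6) s by blast
        qed
        then obtain b where "b \<in> B" "b \<noteq> snd s" using s by blast
        then have "(fst s, b) \<notin> C" using C by (metis singletonD snd_conv)
        then show ?thesis using s \<open>b \<in> B\<close> by blast
      qed
      then show ?thesis using sub by fastforce
    qed
  qed
  then obtain a b where ab: "a \<in> A" "b \<in> B" "(a, b) \<notin> C"
    "C \<inter> (A - {a}) \<times> (B - {b}) = {} \<or> card (C \<inter> (A - {a}) \<times> (B - {b})) < n" by blast
  define A' B' C' where "A' = A - {a}" and "B' = B - {b}" and "C' = C \<inter> A' \<times> B'"
  have n: "card A' = n" "card B' = n"
    using Suc ab by (simp_all add: A'_def B'_def)
  have fin: "finite A'" "finite B'" using Suc.prems by (auto simp: A'_def B'_def)
  \<comment> \<open>The alternative \<open>C' = {}\<close> covers \<open>n = 0\<close>, where the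
    strict bound fails.\<close>
  have small: "C' = {} \<or> card C' < n" using ab by (simp add: C'_def A'_def B'_def)
  have "\<exists>f. bij_betw f A' B' \<and> (\<forall>x\<in>A'. (x, f x) \<notin> C')"
  proof (rule Suc.hyps(1))
    show "C' \<noteq> {x} \<times> B'" if "x \<in> A'" for x
    proof -
      have "card ({x} \<times> B') = n" using n by (simp add: card_cartesian_product)
      moreover have "n \<noteq> 0" using n that fin by (metis card_eq_0_iff empty_iff)
      ultimately show ?thesis using small by auto
    qed
    show "C' \<noteq> A' \<times> {y}" if "y \<in> B'" for y
    proof -
      have "card (A' \<times> {y}) = n" using n by (simp add: card_cartesian_product)
      moreover have "n \<noteq> 0" using n that fin by (metis card_eq_0_iff empty_iff)
      ultimately show ?thesis using small by auto
    qed
    show "card C' \<le> card A'" using small n by auto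
  qed (use n fin in \<open>auto simp: C'_def\<close>)
  then obtain f where f: "bij_betw f A' B'" "\<forall>x\<in>A'. (x, f x) \<notin> C'" by blast
  have "bij_betw (f(a := b)) A' B'"
    using f(1) by (subst bij_betw_cong[of A' _ f]) (auto simp: A'_def)
  then have "bij_betw (f(a := b)) (A' \<union> {a}) (B' \<union> {(f(a := b)) a})"
    by (subst notIn_Un_bij_betw3[symmetric]) (auto simp: A'_def B'_def)
  then have "bij_betw (f(a := b)) (insert a A') (insert b B')" by simp
  then have "bij_betw (f(a := b)) A B" using ab by (simp add: A'_def B'_def insert_absorb)
  moreover have "(x, (f(a := b)) x) \<notin> C" if "x \<in> A" for x
  proof (cases "x = a")
    case False
    then have "x \<in> A'" using that by (simp add: A'_def)
    then have "f x \<in> B'" using f(1) by (auto simp: bij_betw_def)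
    then show ?thesis using f(2) \<open>x \<in> A'\<close> False by (auto simp: C'_def)
  qed (use ab in simp)
  ultimately show ?case by blast
qed

text \<open>Conflicts between the colour classes of the two sides of a cut: if some bijection of the
  colours avoided them, the two colourings would combine.\<close>

lemma crit_cut_conflicts:
  assumes crit: "crit k V E" and X: "X \<subseteq> V" and c: "colors E X k c" and d: "colors E (V - X) k d"
    and small: "card (cut E X) \<le> k"
  defines "g \<equiv> \<lambda>(x, y). (c x, d y)"
  shows "card (cut E X) = k \<and> inj_on g (cut E X) \<and>
    ((\<exists>a<k. g ` cut E X = {a} \<times> {..<k}) \<or> (\<exists>b<k. g ` cut E X = {..<k} \<times> {b}))"
proof -
  note simple = crit_simple[OF crit]
  define C where "C = g ` cut E X"
  have fin: "finite (cut E X)" using simple simple_on_finite by blast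
  have yV: "y \<in> V - X" if "(x, y) \<in> cut E X" for x y
    using that simple_onD[OF simple] by (auto simp: cut_def)
  have "card C \<le> card (cut E X)" unfolding C_def by (rule card_image_le[OF fin])
  have CA: "C \<subseteq> {..<k} \<times> {..<k}"
    using c d yV by (fastforce simp: C_def g_def colors_def cut_def)
  have rc: "(\<exists>a<k. C = {a} \<times> {..<k}) \<or> (\<exists>b<k. C = {..<k} \<times> {b})"
  proof (rule ccontr)
    assume "\<not> ?thesis"
    then obtain f where f: "bij_betw f {..<k} {..<k}" "\<forall>a<k. (a, f a) \<notin> C"
      using ex_bij_avoiding[of "{..<k}" "{..<k}" C] CA \<open>card C \<le> _\<close> small
      by (metis (no_types, lifting) card_lessThan finite_lessThan lessThan_iff order.trans)
    have fc: "colors E X k (f \<circ> c)"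
      using f(1) by (intro colors_permute[OF c]) (auto simp: bij_betw_def)
    have "colors E (X \<union> (V - X)) k (\<lambda>x. if x \<in> X then (f \<circ> c) x else d x)"
    proof (rule colors_glue[OF fc d])
      fix x y assume "x \<in> X - (V - X)" "y \<in> V - X - X" "{x, y} \<in> E"
      then have "(x, y) \<in> cut E X" "x \<in> X" by (auto simp: cut_def)
      then have "(c x, d y) \<in> C" "c x < k" using c by (force simp: C_def g_def colors_def)+
      then show "(f \<circ> c) x \<noteq> d y" using f(2) by auto
    qed auto
    then show False using crit_not_colors[OF crit] X by (simp add: Un_absorb1)
  qed
  \<comment> \<open>A full row or column has \<open>k\<close> cells. As there are at most
    \<open>k\<close> cut edges, no two of them show the same pair of colours.\<close>
  then have "card C = k" by (auto simp: card_cartesian_product)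
  then have "card (cut E X) = card C" using \<open>card C \<le> _\<close> small by simp
  then show ?thesis using rc \<open>card C = k\<close> fin
    by (auto simp: C_def intro: eq_card_imp_inj_on)
qed

text \<open>Fewer than \<open>k\<close> cut edges cannot produce the \<open>k\<close> conflicting
  colour pairs of a full row or column.\<close>

lemma crit_cut_ge:
  assumes "crit k V E" "X \<subseteq> V" "X \<noteq> {}" "X \<noteq> V"
  shows "k \<le> card (cut E X)"
proof -
  obtain c where "colors E X k c" using crit_colors_subset[OF assms(1,2,4)] by blast
  moreover obtain d where "colors E (V - X) k d"
    using crit_colors_subset[OF assms(1), of "V - X"] assms by blast
  ultimately show ?thesis
    using crit_cut_conflicts[OF assms(1,2)] by (metis nle_le)
qed

lemma crit_min_degree:
  assumes "crit k V E" "x \<in> V"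
  shows "k \<le> card (nbrs E x)"
proof (cases "V = {x}")
  case True
  have "k = 0"
  proof (rule ccontr)
    assume "k \<noteq> 0"
    moreover have "{x, x} \<notin> E"
      using simple_onD(3)[OF crit_simple[OF assms(1)]] by blast
    ultimately have "colors E V k (\<lambda>_. 0)"
      using True by (simp add: colors_def)
    then show False using crit_not_colors[OF assms(1)] by blast
  qed
  then show ?thesis by simp
next
  case False
  then show ?thesis
    using crit_cut_ge[OF assms(1), of "{x}"] assms(2) card_cut_singleton[OF crit_simple[OF assms(1)]]
    by auto
qed

text \<open>Injectivity is required on the cut edges, not on their ends in \<open>V - X\<close>;
  once \<open>V - X\<close> has a colouring, it also says that no two cut edges share such an
  end.\<close>

definition mono_cut :: "nat \<Rightarrow> 'a set \<Rightarrow> 'a set set \<Rightarrow> 'a set \<Rightarrow> bool" where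
  "mono_cut k V E X \<longleftrightarrow>
     (\<forall>c. colors E X k c \<longrightarrow> (\<exists>a. \<forall>x y. (x, y) \<in> cut E X \<longrightarrow> c x = a)) \<and>
     (\<forall>d. colors E (V - X) k d \<longrightarrow> inj_on (\<lambda>(x, y). d y) (cut E X))"

text \<open>Each pair of colourings shows a row (\<open>c\<close> constant on the ends,
  \<open>d\<close> not) or a column (\<open>d\<close> constant, \<open>c\<close> not). With
  \<open>k >= 2\<close> these exclude each other, so either colouring alone decides the type, and
  the type is the same for all pairs.\<close>

lemma crit_cut_eq:
  assumes crit: "crit k V E" and X: "X \<subseteq> V" "X \<noteq> {}" "X \<noteq> V" and k: "2 \<le> k"
    and card: "card (cut E X) \<le> k"
  shows "mono_cut k V E X \<or> mono_cut k V E (V - X)"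
proof -
  note simple = crit_simple[OF crit]
  obtain c0 where c0: "colors E X k c0" using crit_colors_subset[OF crit X(1,3)] by blast
  obtain d0 where d0: "colors E (V - X) k d0"
    using crit_colors_subset[OF crit, of "V - X"] X by blast
  let ?S = "cut E X"
  define row where "row c d \<longleftrightarrow> (\<exists>a<k. (\<lambda>(x, y). (c x, d y)) ` ?S = {a} \<times> {..<k})" for c d :: "'a \<Rightarrow> nat"
  define col where "col c d \<longleftrightarrow> (\<exists>b<k. (\<lambda>(x, y). (c x, d y)) ` ?S = {..<k} \<times> {b})" for c d :: "'a \<Rightarrow> nat"
  have alt: "row c d \<or> col c d" and inj: "inj_on (\<lambda>(x, y). (c x, d y)) ?S"
    if "colors E X k c" "colors E (V - X) k d" for c d
    using crit_cut_conflicts[OF crit X(1) that card] unfolding row_def col_def by blast+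
  have im: "(c x, d y) \<in> (\<lambda>(x, y). (c x, d y)) ` ?S" if "(x, y) \<in> ?S"
    for c d :: "'a \<Rightarrow> nat" and x y
    using that by (intro image_eqI[of _ _ "(x, y)"]) auto
  have rowD: "\<exists>a. \<forall>x y. (x, y) \<in> ?S \<longrightarrow> c x = a" if "row c d" for c d
    using that im[of _ _ c d] unfolding row_def by (metis mem_Sigma_iff singletonD)
  have colD: "\<exists>a. \<forall>x y. (x, y) \<in> ?S \<longrightarrow> d y = a" if "col c d" for c d
    using that im[of _ _ c d] unfolding col_def by (metis mem_Sigma_iff singletonD)
  have 01: "(0::nat) < k" "(1::nat) < k" using k by auto
  have row_ex: "\<exists>x y x' y'. (x, y) \<in> ?S \<and> (x', y') \<in> ?S \<and> d y \<noteq> d y'" if row: "row c d" for c d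
  proof -
    obtain a where a: "(\<lambda>(x, y). (c x, d y)) ` ?S = {a} \<times> {..<k}"
      using row unfolding row_def by blast
    have "(a, 0) \<in> (\<lambda>(x, y). (c x, d y)) ` ?S" "(a, 1) \<in> (\<lambda>(x, y). (c x, d y)) ` ?S"
      unfolding a using 01 by auto
    then show ?thesis by fastforce
  qed
  have col_ex: "\<exists>x y x' y'. (x, y) \<in> ?S \<and> (x', y') \<in> ?S \<and> c x \<noteq> c x'" if col: "col c d" for c d
  proof -
    obtain a where a: "(\<lambda>(x, y). (c x, d y)) ` ?S = {..<k} \<times> {a}"
      using col unfolding col_def by blast
    have "(0, a) \<in> (\<lambda>(x, y). (c x, d y)) ` ?S" "(1, a) \<in> (\<lambda>(x, y). (c x, d y)) ` ?S"
      unfolding a using 01 by auto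
    then show ?thesis by fastforce
  qed
  have row_inj: "inj_on (\<lambda>(x, y). d y) ?S"
    if rc: "row c d" "colors E X k c" "colors E (V - X) k d" for c d
  proof -
    obtain a where a: "\<forall>x y. (x, y) \<in> ?S \<longrightarrow> c x = a" using rowD[OF rc(1)] by blast
    show ?thesis
    proof (rule inj_onI)
      fix s t assume st: "s \<in> ?S" "t \<in> ?S" "(\<lambda>(x, y). d y) s = (\<lambda>(x, y). d y) t"
      then have "(\<lambda>(x, y). (c x, d y)) s = (\<lambda>(x, y). (c x, d y)) t"
        using a by (cases s, cases t) auto
      then show "s = t" using inj_onD[OF inj[OF rc(2,3)]] st by blast
    qed
  qed
  have col_inj: "inj_on (\<lambda>(x, y). c x) ?S"
    if rc: "col c d" "colors E X k c" "colors E (V - X) k d" for c d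
  proof -
    obtain a where a: "\<forall>x y. (x, y) \<in> ?S \<longrightarrow> d y = a" using colD[OF rc(1)] by blast
    show ?thesis
    proof (rule inj_onI)
      fix s t assume st: "s \<in> ?S" "t \<in> ?S" "(\<lambda>(x, y). c x) s = (\<lambda>(x, y). c x) t"
      then have "(\<lambda>(x, y). (c x, d y)) s = (\<lambda>(x, y). (c x, d y)) t"
        using a by (cases s, cases t) auto
      then show "s = t" using inj_onD[OF inj[OF rc(2,3)]] st by blast
    qed
  qed
  have cut': "(y, x) \<in> cut E (V - X) \<longleftrightarrow> (x, y) \<in> ?S" for x y
    using X(1) simple_onD[OF simple, of x y]
    by (auto simp: cut_def insert_commute)
  show ?thesis
  proof (cases "row c0 d0")
    case True
    have r1: "row c0 d" if "colors E (V - X) k d" for d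
      using alt[OF c0 that] rowD[OF True] col_ex[of c0 d] by metis
    have r2: "row c d0" if "colors E X k c" for c
      using alt[OF that d0] row_ex[OF True] colD[of c d0] by metis
    have "mono_cut k V E X" unfolding mono_cut_def
      using r1 r2 rowD row_inj c0 by blast
    then show ?thesis ..
  next
    case False
    then have T: "col c0 d0" using alt[OF c0 d0] by blast
    have r1: "col c0 d" if "colors E (V - X) k d" for d
      using alt[OF c0 that] rowD[of c0 d] col_ex[OF T] by metis
    have r2: "col c d0" if "colors E X k c" for c
      using alt[OF that d0] row_ex[of c d0] colD[OF T] by metis
    have VX: "V - (V - X) = X" using X by blast
    have "inj_on (\<lambda>(x, y). c y) (cut E (V - X))" if "colors E X k c" for c
    proof (rule inj_onI, clarify)
      fix y x y' x' assume "(y, x) \<in> cut E (V - X)" "(y', x') \<in> cut E (V - X)" "c x = c x'"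
      then show "y = y' \<and> x = x'"
        using inj_onD[OF col_inj[OF r2[OF that] that d0], of "(x, y)" "(x', y')"] cut' by auto
    qed
    moreover have "\<exists>a. \<forall>x y. (x, y) \<in> cut E (V - X) \<longrightarrow> d x = a" if "colors E (V - X) k d" for d
      using colD[OF r1[OF that]] by (auto simp: cut')
    ultimately have "mono_cut k V E (V - X)" unfolding mono_cut_def VX by blast
    then show ?thesis ..
  qed
qed

text \<open>Permuting the colours of one side makes the colourings of both sides agree at
  \<open>v\<close>; without an edge between \<open>A\<close> and \<open>B\<close> they would
  combine.\<close>

lemma crit_no_cut_vertex:
  assumes crit: "crit k V E" and k: "1 \<le> k" and V: "V = insert v (A \<union> B)" "v \<notin> A" "v \<notin> B" "A \<inter> B = {}"
    "A \<noteq> {}" "B \<noteq> {}"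
  shows "\<exists>a\<in>A. \<exists>b\<in>B. {a, b} \<in> E"
proof (rule ccontr)
  assume no: "\<not> ?thesis"
  have "\<exists>c. colors E (insert v A) k c"
  proof (rule crit_colors_subset[OF crit])
    obtain b where "b \<in> B" using V by blast
    then have "b \<in> V" "b \<notin> insert v A" using V by auto
    then show "insert v A \<noteq> V" by blast
  qed (use V(1) in blast)
  then obtain c where c: "colors E (insert v A) k c" by blast
  have "\<exists>d. colors E (insert v B) k d"
  proof (rule crit_colors_subset[OF crit])
    obtain b where "b \<in> A" using V by blast
    then have "b \<in> V" "b \<notin> insert v B" using V by auto
    then show "insert v B \<noteq> V" by blast
  qed (use V(1) in blast)
  then obtain d where d: "colors E (insert v B) k d" by blast
  have "c v < k" using c by (auto simp: colors_def)
  then obtain d' where d': "colors E (insert v B) k d'" "d' v = c v"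
    using colors_recolor1[OF d, of v "c v"] by auto
  have "colors E (insert v A \<union> insert v B) k (\<lambda>x. if x \<in> insert v A then c x else d' x)"
    by (rule colors_glue[OF c d'(1)]) (use no V d'(2) in auto)
  moreover have "insert v A \<union> insert v B = V" using V by auto
  ultimately show False using crit_not_colors[OF crit] by auto
qed

text \<open>Colourings of the two sides can be permuted to agree on \<open>p\<close> and
  \<open>q\<close> unless exactly one of them gives \<open>p\<close> and \<open>q\<close> the same
  colour. Hence one side always makes them equal and the other always different; the equation
  \<open>{A', B'} = {A, B}\<close> leaves open which side does what.\<close>

lemma crit_separating_pair:
  assumes crit: "crit k V E" and k: "2 \<le> k"
    and V: "V = {p, q} \<union> A \<union> B" "p \<noteq> q" "p \<notin> A \<union> B" "q \<notin> A \<union> B" "A \<inter> B = {}" "A \<noteq> {}" "B \<noteq> {}"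
    and no: "\<And>a b. a \<in> A \<Longrightarrow> b \<in> B \<Longrightarrow> {a, b} \<notin> E"
  obtains A' B' where "{A', B'} = {A, B}" "\<forall>c. colors E ({p, q} \<union> A') k c \<longrightarrow> c p = c q"
    "\<forall>c. colors E ({p, q} \<union> B') k c \<longrightarrow> c p \<noteq> c q"
proof -
  have glue: False if c: "colors E ({p, q} \<union> A) k c" and d: "colors E ({p, q} \<union> B) k d"
    and pq: "c p = c q \<longleftrightarrow> d p = d q" for c d
  proof -
    have lt: "c p < k" "c q < k" using c by (auto simp: colors_def)
    obtain d' where d': "colors E ({p, q} \<union> B) k d'" "d' p = c p" "d' q = c q"
    proof (cases "c p = c q")
      case True
      show ?thesis
      proof (rule colors_permute[OF d, of "transpose (d p) (c p)", THEN that])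
        show "transpose (d p) (c p) ` {..<k} \<subseteq> {..<k}"
          using d lt by (auto simp: colors_def transpose_def)
      qed (use pq True in auto)
    next
      case False
      then have "d p \<noteq> d q" using pq by blast
      from colors_recolor2[OF d _ _ this lt False] that show ?thesis by auto
    qed
    have "colors E (({p, q} \<union> A) \<union> ({p, q} \<union> B)) k (\<lambda>x. if x \<in> {p, q} \<union> A then c x else d' x)"
      by (rule colors_glue[OF c d'(1)]) (use no V d'(2,3) in auto)
    moreover have "({p, q} \<union> A) \<union> ({p, q} \<union> B) = V" using V by auto
    ultimately show False using crit_not_colors[OF crit] by auto
  qed
  have "\<exists>c. colors E ({p, q} \<union> A) k c"
  proof (rule crit_colors_subset[OF crit])
    obtain b where "b \<in> B" using V by blast
    then have "b \<in> V" "b \<notin> {p, q} \<union> A" using V by auto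
    then show "{p, q} \<union> A \<noteq> V" by blast
  qed (use V(1) in blast)
  then obtain c where c: "colors E ({p, q} \<union> A) k c" by blast
  have "\<exists>d. colors E ({p, q} \<union> B) k d"
  proof (rule crit_colors_subset[OF crit])
    obtain b where "b \<in> A" using V by blast
    then have "b \<in> V" "b \<notin> {p, q} \<union> B" using V by auto
    then show "{p, q} \<union> B \<noteq> V" by blast
  qed (use V(1) in blast)
  then obtain d where d: "colors E ({p, q} \<union> B) k d" by blast
  show ?thesis
  proof (cases "c p = c q")
    case True
    have 1: "\<forall>d. colors E ({p, q} \<union> B) k d \<longrightarrow> d p \<noteq> d q" using glue[OF c] True by blast
    then have "d p \<noteq> d q" using d by blast
    then have "\<forall>c. colors E ({p, q} \<union> A) k c \<longrightarrow> c p = c q" using glue[OF _ d] by blast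
    with 1 show ?thesis using that[of A B] by blast
  next
    case False
    have 1: "\<forall>d. colors E ({p, q} \<union> B) k d \<longrightarrow> d p = d q" using glue[OF c] False by blast
    then have "d p = d q" using d by blast
    then have "\<forall>c. colors E ({p, q} \<union> A) k c \<longrightarrow> c p \<noteq> c q" using glue[OF _ d] by blast
    moreover have "{B, A} = {A, B}" by blast
    ultimately show ?thesis using 1 that[of B A] by blast
  qed
qed

section \<open>Greedy colouring and vertices of low degree\<close>

text \<open>Greedy colouring of \<open>S\<close> towards its vertex \<open>x\<close>: every other vertex of \<open>S\<close> still has an
  uncoloured neighbour when its turn comes, and \<open>x\<close> sees the colour of \<open>y\<close> and \<open>z\<close> twice.\<close>

lemma greedy_extension:
  assumes simple: "simple_on V E" and S: "S \<subseteq> V" "x \<in> S" "y \<in> V - S" "z \<in> V - S" "y \<noteq> z"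
    and xyz: "{x, y} \<in> E" "{x, z} \<in> E"
    and c: "colors E (V - S) k c" "c y = c z"
    and deg: "\<And>s. s \<in> S \<Longrightarrow> card (nbrs E s) \<le> k"
    and conn: "\<And>D. x \<in> D \<Longrightarrow> D \<subset> S \<Longrightarrow> \<exists>a\<in>D. \<exists>b\<in>S - D. {a, b} \<in> E"
  shows "\<exists>d. colors E V k d"
proof -
  note fin = simple_on_finite[OF simple]
  \<comment> \<open>\<open>D\<close> is the part still to be coloured, and the induction runs
    backwards in time, from \<open>{x}\<close> to \<open>S\<close>: a vertex \<open>b\<close>
    adjacent to \<open>D\<close> is coloured just before \<open>D\<close>, while its neighbour in
    \<open>D\<close> has no colour yet.\<close>
  define P where "P D \<longleftrightarrow> (\<forall>d. colors E (V - D) k d \<and> d y = d z \<longrightarrow> (\<exists>d. colors E V k d))" for D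
  have image_small: "card (d ` (nbrs E s \<inter> W)) < k"
    if "s \<in> S" "a \<in> nbrs E s" "d ` (nbrs E s \<inter> W) \<subseteq> d ` (nbrs E s - {a})" for d :: "'a \<Rightarrow> nat" and s a W
  proof -
    have "card (d ` (nbrs E s \<inter> W)) \<le> card (d ` (nbrs E s - {a}))"
      using that fin by (intro card_mono) auto
    also have "\<dots> \<le> card (nbrs E s - {a})" using fin by (intro card_image_le) auto
    also have "\<dots> < card (nbrs E s)" using that fin by (intro card_Diff1_less) auto
    finally show ?thesis using deg[OF that(1)] by simp
  qed
  have base: "P {x}"
    unfolding P_def
  proof (intro allI impI, elim conjE)
    fix d assume d: "colors E (V - {x}) k d" "d y = d z"
    have "d ` (nbrs E x \<inter> V) \<subseteq> d ` (nbrs E x - {z})"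
    proof
      fix i assume "i \<in> d ` (nbrs E x \<inter> V)"
      then obtain t where t: "t \<in> nbrs E x" "i = d t" by blast
      have "y \<in> nbrs E x - {z}" using xyz S by (simp add: nbrs_def)
      then show "i \<in> d ` (nbrs E x - {z})"
        using t d(2) by (metis DiffI imageI singletonD)
    qed
    then have "card (d ` (nbrs E x \<inter> V)) < k"
      using S xyz by (intro image_small) (auto simp: nbrs_def)
    then show "\<exists>d. colors E V k d" using colors_one_step[OF simple d(1)] by blast
  qed
  have "P S" if "x \<in> D" "D \<subseteq> S" "P D" for D
    using that
  proof (induction "card (S - D)" arbitrary: D rule: less_induct)
    case less
    show ?case
    proof (cases "D = S")
      case False
      then obtain a b where ab: "a \<in> D" "b \<in> S - D" "{a, b} \<in> E"
        using conn[of D] less.prems by blast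
      have "P (insert b D)"
        unfolding P_def
      proof (intro allI impI, elim conjE)
        fix d assume d: "colors E (V - insert b D) k d" "d y = d z"
        have "V - insert b D = (V - D) - {b}" by blast
        then have d': "colors E ((V - D) - {b}) k d" using d by simp
        have "card (d ` (nbrs E b \<inter> (V - D))) < k"
          using ab by (intro image_small[of b a]) (auto simp: nbrs_def insert_commute)
        then obtain i where "colors E (V - D) k (d(b := i))"
          using colors_one_step[OF simple d'] by blast
        moreover have "(d(b := i)) y = (d(b := i)) z" using d(2) ab S by auto
        ultimately show "\<exists>d. colors E V k d" using less.prems(3) unfolding P_def by blast
      qed
      moreover have "S - insert b D \<subset> S - D" using ab by auto
      then have "card (S - insert b D) < card (S - D)"
        using fin(1) S(1) by (meson finite_Diff finite_subset psubset_card_mono)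
      ultimately show ?thesis using less.hyps[of "insert b D"] ab less.prems by simp
    qed (use less in simp)
  qed
  from this[of "{x}"] base S have "P S" by simp
  then show ?thesis using c unfolding P_def by blast
qed

text \<open>\<open>y\<close> and \<open>z\<close> get the same colour and the rest is coloured
  greedily towards their common neighbour \<open>x\<close>. As no \<open>k\<close>-colouring exists,
  \<open>V - {y, z}\<close> must be disconnected. The degree bound spares \<open>y\<close> and
  \<open>z\<close>, so one of them may be the vertex of high degree.\<close>

lemma crit_no_greedy:
  assumes crit: "crit k V E" and k: "1 \<le> k" and yz: "y \<in> V" "z \<in> V" "y \<noteq> z" "{y, z} \<notin> E"
    and x: "{x, y} \<in> E" "{x, z} \<in> E"
    and deg: "\<And>s. s \<in> V - {y, z} \<Longrightarrow> card (nbrs E s) \<le> k"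
  shows "\<exists>A B. V = {y, z} \<union> A \<union> B \<and> y \<notin> A \<union> B \<and> z \<notin> A \<union> B \<and> A \<inter> B = {} \<and> A \<noteq> {} \<and> B \<noteq> {} \<and>
    (\<forall>a\<in>A. \<forall>b\<in>B. {a, b} \<notin> E)"
proof (rule ccontr)
  assume no: "\<not> ?thesis"
  note simple = crit_simple[OF crit]
  have xS: "x \<in> V - {y, z}" using simple_onD[OF simple x(1)] simple_onD[OF simple x(2)] by blast
  have "V - (V - {y, z}) = {y, z}" using yz by blast
  moreover have "{z, y} \<notin> E" using yz by (simp add: insert_commute)
  moreover have "{y} \<notin> E" "{z} \<notin> E" using simple_onD(3)[OF simple, of y y]
    simple_onD(3)[OF simple, of z z] by auto
  ultimately have c: "colors E (V - (V - {y, z})) k (\<lambda>_. 0)"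
    using k yz by (auto simp: colors_def)
  have "\<exists>d. colors E V k d"
  proof (rule greedy_extension[OF simple _ xS _ _ yz(3) x c])
    fix D assume D: "x \<in> D" "D \<subset> V - {y, z}"
    show "\<exists>a\<in>D. \<exists>b\<in>V - {y, z} - D. {a, b} \<in> E"
    proof (rule ccontr)
      assume "\<not> ?thesis"
      then have "\<forall>a\<in>D. \<forall>b\<in>V - {y, z} - D. {a, b} \<notin> E" by blast
      moreover have "V = {y, z} \<union> D \<union> (V - {y, z} - D)" "V - {y, z} - D \<noteq> {}" "D \<noteq> {}"
        "y \<notin> D \<union> (V - {y, z} - D)" "z \<notin> D \<union> (V - {y, z} - D)" "D \<inter> (V - {y, z} - D) = {}"
        using D yz by auto
      ultimately show False using no by blast
    qed
  qed (use deg yz in auto)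
  then show False using crit_not_colors[OF crit] by blast
qed

text \<open>Otherwise no edge would lead from the neighbours of \<open>y\<close> to its
  non-neighbours, and \<open>y\<close> would be a cut vertex.\<close>

lemma crit_nonneighbour_at_distance_two:
  assumes crit: "crit k V E" and k: "1 \<le> k" and yz: "y \<in> V" "z \<in> V" "y \<noteq> z" "{y, z} \<notin> E"
  obtains x z' where "{x, y} \<in> E" "{x, z'} \<in> E" "z' \<in> V" "y \<noteq> z'" "{y, z'} \<notin> E"
proof -
  note simple = crit_simple[OF crit]
  define N where "N = nbrs E y"
  define B where "B = V - {y} - N"
  have "{y, y} \<notin> E" using simple_onD(3)[OF simple] by blast
  moreover have "N \<subseteq> V" by (auto simp: N_def nbrs_def dest: simple_onD[OF simple])
  ultimately have N: "y \<notin> N" "V = insert y (N \<union> B)" using yz by (auto simp: N_def B_def nbrs_def)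
  have "\<exists>x\<in>N. \<exists>z'\<in>B. {x, z'} \<in> E"
  proof (rule crit_no_cut_vertex[OF crit k N(2,1)])
    show "N \<noteq> {}" using crit_min_degree[OF crit yz(1)] k by (auto simp: N_def)
    show "B \<noteq> {}" using yz by (auto simp: N_def B_def nbrs_def)
  qed (auto simp: B_def)
  then obtain x z' where "x \<in> N" "z' \<in> B" "{x, z'} \<in> E" by blast
  then show ?thesis using that[of x z'] by (auto simp: N_def B_def nbrs_def insert_commute)
qed

text \<open>The traces of a Hajos join: \<open>v\<close> is the identified vertex and \<open>{u, w}\<close> the added edge.\<close>

definition hajos_sep ::
  "'a set \<Rightarrow> 'a set set \<Rightarrow> 'a \<Rightarrow> 'a set \<Rightarrow> 'a set \<Rightarrow> 'a \<Rightarrow> 'a \<Rightarrow> bool" where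
  "hajos_sep V E v A B u w \<longleftrightarrow>
     V = insert v (A \<union> B) \<and> v \<notin> A \<union> B \<and> A \<inter> B = {} \<and> u \<in> A \<and> w \<in> B \<and> {u, w} \<in> E \<and>
     (\<forall>a\<in>A. \<forall>b\<in>B. {a, b} \<in> E \<longrightarrow> a = u \<and> b = w)"

lemma hajos_sep_sym: "hajos_sep V E v A B u w \<Longrightarrow> hajos_sep V E v B A w u"
  by (auto simp: hajos_sep_def insert_commute)

text \<open>The edge \<open>{p, q}\<close> is added as a further constraint: with fewer than
  \<open>k - 1\<close> neighbours in \<open>A\<close>, the vertex \<open>p\<close> could be
  recoloured so as to differ from \<open>q\<close> as well.\<close>

lemma forced_equal_degree:
  assumes crit: "crit k V E" and W: "{p, q} \<union> A \<subseteq> V" "{p, q} \<union> A \<noteq> V" "p \<noteq> q" "p \<notin> A" "q \<notin> A"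
    and eq: "\<forall>c. colors E ({p, q} \<union> A) k c \<longrightarrow> c p = c q"
  shows "k \<le> Suc (card (nbrs E p \<inter> A))"
proof (rule ccontr)
  assume "\<not> ?thesis"
  then have lt: "Suc (card (nbrs E p \<inter> A)) < k" by simp
  note simple = crit_simple[OF crit]
  let ?W = "{p, q} \<union> A" and ?F = "insert {p, q} E"
  obtain c where c: "colors E ?W k c" using crit_colors_subset[OF crit W(1,2)] by blast
  have sF: "simple_on V ?F" using simple W by (auto simp: simple_on_def)
  have fin: "finite (nbrs E p \<inter> A)" using simple_on_finite[OF simple] by blast
  have "nbrs ?F p \<inter> ?W \<subseteq> insert q (nbrs E p \<inter> A)"
    using W(3-5) simple_onD(3)[OF simple, of p p] by (auto simp: nbrs_def doubleton_eq_iff)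
  then have "card (c ` (nbrs ?F p \<inter> ?W)) \<le> card (c ` insert q (nbrs E p \<inter> A))"
    using fin by (intro card_mono) auto
  also have "\<dots> \<le> card (insert q (nbrs E p \<inter> A))" using fin by (intro card_image_le) auto
  also have "\<dots> \<le> Suc (card (nbrs E p \<inter> A))" by (rule card_insert_le_m1) auto
  finally have small: "card (c ` (nbrs ?F p \<inter> ?W)) < k" using lt by simp
  have "colors ?F (?W - {p}) k c"
    by (rule colors_mono[OF c]) auto
  then obtain i where "colors ?F ?W k (c(p := i))"
    using colors_one_step[OF sF _ small] by blast
  then have "colors E ?W k (c(p := i))" "(c(p := i)) p \<noteq> (c(p := i)) q"
    using W(3) unfolding colors_def by auto
  then show False using eq by blast
qed

text \<open>On the side \<open>A'\<close> that forces equal colours \<open>p\<close> has at least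
  \<open>k - 1\<close> neighbours, so its degree leaves at most one in \<open>B'\<close>; there is
  one because \<open>q\<close> is no cut vertex. Moving \<open>p\<close> over to \<open>A'\<close>
  makes this the only edge between the sides, and \<open>q\<close> the identified vertex.\<close>

lemma separating_pair_hajos_sep:
  assumes crit: "crit k V E" and k: "2 \<le> k" and p: "card (nbrs E p) \<le> k"
    and V: "V = {p, q} \<union> A \<union> B" "p \<noteq> q" "p \<notin> A \<union> B" "q \<notin> A \<union> B" "A \<inter> B = {}" "A \<noteq> {}" "B \<noteq> {}"
    and no: "\<And>a b. a \<in> A \<Longrightarrow> b \<in> B \<Longrightarrow> {a, b} \<notin> E"
  shows "\<exists>A B u w. hajos_sep V E q A B u w"
proof -
  note simple = crit_simple[OF crit]
  obtain A' B' where AB: "{A', B'} = {A, B}" and eq: "\<forall>c. colors E ({p, q} \<union> A') k c \<longrightarrow> c p = c q"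
    and "\<forall>c. colors E ({p, q} \<union> B') k c \<longrightarrow> c p \<noteq> c q"
    by (rule crit_separating_pair[OF crit k V]) (use no in blast)
  have no': "{a, b} \<notin> E" if "a \<in> A'" "b \<in> B'" for a b
  proof -
    have "A' = A \<and> B' = B \<or> A' = B \<and> B' = A" using AB by (auto simp: doubleton_eq_iff)
    then show ?thesis using no[of a b] no[of b a] that by (auto simp: insert_commute)
  qed
  have V': "V = {p, q} \<union> A' \<union> B'" "p \<notin> A'" "p \<notin> B'" "q \<notin> A'" "q \<notin> B'" "A' \<inter> B' = {}"
    "A' \<noteq> {}" "B' \<noteq> {}"
    using AB V by (auto simp: doubleton_eq_iff)
  have "{p, q} \<union> A' \<noteq> V"
  proof -
    obtain b where "b \<in> B'" using V' by blast
    then have "b \<in> V" "b \<notin> {p, q} \<union> A'" using V' by auto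
    then show ?thesis by blast
  qed
  moreover have "{p, q} \<union> A' \<subseteq> V" using V'(1) by blast
  ultimately have dA: "k \<le> Suc (card (nbrs E p \<inter> A'))"
    using forced_equal_degree[OF crit _ _ V(2) V'(2,4) eq] by blast
  have "V = insert q (insert p A' \<union> B')" "q \<notin> insert p A'" "insert p A' \<inter> B' = {}"
    "insert p A' \<noteq> {}" using V' V(2) by auto
  then obtain a b where "a \<in> insert p A'" "b \<in> B'" "{a, b} \<in> E"
    using crit_no_cut_vertex[OF crit _ _ _ V'(5) _ _ V'(8), of "insert p A'"] k by auto
  with no' have b: "b \<in> B'" "{p, b} \<in> E" by auto
  have fin: "finite (nbrs E p)" using simple_on_finite[OF simple] by blast
  have "b' = b" if "b' \<in> B'" "{p, b'} \<in> E" for b'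
  proof (rule ccontr)
    assume "b' \<noteq> b"
    have "card ((nbrs E p \<inter> A') \<union> {b, b'}) \<le> card (nbrs E p)"
      using fin b that by (intro card_mono) (auto simp: nbrs_def)
    moreover have "card ((nbrs E p \<inter> A') \<union> {b, b'}) = card (nbrs E p \<inter> A') + card {b, b'}"
      using fin b that V' by (intro card_Un_disjoint) auto
    ultimately show False using \<open>b' \<noteq> b\<close> dA p by simp
  qed
  then have "hajos_sep V E q (insert p A') B' p b"
    unfolding hajos_sep_def using V' V(2) b no' by (intro conjI) blast+
  then show ?thesis by blast
qed

text \<open>Brooks' theorem for critical graphs. It is applied after deleting a universal vertex,
  where Hajos separations are not excluded, so the separating pair is contradicted directly:
  \<open>y\<close> and \<open>z'\<close> each have at most one neighbour in \<open>B'\<close>, and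
  with \<open>k >= 3\<close> one colour suits both, against the side that forces them to
  differ.\<close>

lemma regular_crit_complete:
  assumes crit: "crit k V E" and k: "3 \<le> k" and deg: "\<And>x. x \<in> V \<Longrightarrow> card (nbrs E x) \<le> k"
    and yz: "y \<in> V" "z \<in> V" "y \<noteq> z"
  shows "{y, z} \<in> E"
proof (rule ccontr)
  assume nyz: "{y, z} \<notin> E"
  note simple = crit_simple[OF crit]
  obtain x z' where xz: "{x, y} \<in> E" "{x, z'} \<in> E" and z': "z' \<in> V" "y \<noteq> z'" "{y, z'} \<notin> E"
    by (rule crit_nonneighbour_at_distance_two[OF crit _ yz nyz]) (use k in auto)
  obtain A B where AB: "V = {y, z'} \<union> A \<union> B" "y \<notin> A \<union> B" "z' \<notin> A \<union> B" "A \<inter> B = {}"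
    "A \<noteq> {}" "B \<noteq> {}" "\<forall>a\<in>A. \<forall>b\<in>B. {a, b} \<notin> E"
    using crit_no_greedy[OF crit _ yz(1) z' xz] deg k by auto
  obtain A' B' where AB': "{A', B'} = {A, B}"
    and eq: "\<forall>c. colors E ({y, z'} \<union> A') k c \<longrightarrow> c y = c z'"
    and neq: "\<forall>c. colors E ({y, z'} \<union> B') k c \<longrightarrow> c y \<noteq> c z'"
    by (rule crit_separating_pair[OF crit _ AB(1) z'(2) AB(2-6)]) (use AB(7) k in auto)
  have V': "V = {y, z'} \<union> A' \<union> B'" "y \<notin> A'" "y \<notin> B'" "z' \<notin> A'" "z' \<notin> B'" "A' \<inter> B' = {}"
    "A' \<noteq> {}" "B' \<noteq> {}"
    using AB AB' by (auto simp: doubleton_eq_iff)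
  obtain a b where ab: "a \<in> A'" "b \<in> B'" using V' by blast
  then have ab': "a \<in> V" "b \<in> V" "b \<notin> {y, z'} \<union> A'" "a \<notin> {y, z'} \<union> B'" using V' by auto
  then have W: "{y, z'} \<union> A' \<noteq> V" "{y, z'} \<union> B' \<noteq> V" by blast+
  have W': "{y, z'} \<union> A' \<subseteq> V" "{y, z'} \<union> B' \<subseteq> V" using V'(1) by blast+
  have one: "card (nbrs E p \<inter> B') \<le> 1" if "p \<in> {y, z'}" for p
  proof -
    have "k \<le> Suc (card (nbrs E p \<inter> A'))"
    proof (cases "p = y")
      case True
      then show ?thesis using forced_equal_degree[OF crit W'(1) W(1) z'(2) V'(2,4) eq] by simp
    next
      case False
      have "\<forall>c. colors E ({z', y} \<union> A') k c \<longrightarrow> c z' = c y"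
        using eq by (metis insert_commute)
      moreover have "{z', y} \<union> A' \<noteq> V" "{z', y} \<union> A' \<subseteq> V" using W W' by (simp_all add: insert_commute)
      ultimately show ?thesis
        using forced_equal_degree[OF crit _ _ z'(2)[symmetric] V'(4,2)] False that by auto
    qed
    moreover have fin: "finite (nbrs E p)" using simple_on_finite[OF simple] by blast
    have "card ((nbrs E p \<inter> A') \<union> (nbrs E p \<inter> B')) = card (nbrs E p \<inter> A') + card (nbrs E p \<inter> B')"
      using fin V' by (intro card_Un_disjoint) auto
    moreover have "card ((nbrs E p \<inter> A') \<union> (nbrs E p \<inter> B')) \<le> card (nbrs E p)"
      using fin by (intro card_mono) auto
    moreover have "card (nbrs E p) \<le> k" using deg that yz z' by auto
    ultimately show ?thesis by linarith
  qed
  obtain c where c: "colors E ({y, z'} \<union> B') k c" using crit_colors_subset[OF crit W'(2) W(2)] by blast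
  define S where "S = c ` ((nbrs E y \<inter> B') \<union> (nbrs E z' \<inter> B'))"
  have fin: "finite (nbrs E y \<inter> B')" "finite (nbrs E z' \<inter> B')"
    using simple_on_finite[OF simple] by blast+
  have "card S \<le> card ((nbrs E y \<inter> B') \<union> (nbrs E z' \<inter> B'))"
    unfolding S_def using fin by (intro card_image_le) auto
  also have "\<dots> \<le> card (nbrs E y \<inter> B') + card (nbrs E z' \<inter> B')" by (rule card_Un_le)
  also have "\<dots> \<le> 2" using one[of y] one[of z'] by simp
  finally have "card S < k" using k by simp
  moreover have "finite S" unfolding S_def using fin by blast
  ultimately have "\<not> {..<k} \<subseteq> S" by (metis card_lessThan card_mono leD)
  then obtain j where j: "j < k" "j \<notin> S" by blast
  have "colors E ({y, z'} \<union> B') k (c(y := j, z' := j))"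
    unfolding colors_def
  proof (intro conjI ballI impI)
    fix s t assume st: "s \<in> {y, z'} \<union> B'" "t \<in> {y, z'} \<union> B'" "{s, t} \<in> E"
    have ne: "s \<noteq> t" using simple_onD(3)[OF simple st(3)] .
    have ts: "{t, s} \<in> E" using st(3) by (simp add: insert_commute)
    have "{s, t} \<noteq> {y, z'}" using st(3) z' by auto
    consider "s \<in> B'" "t \<in> B'" | "s \<in> B'" "t \<in> {y, z'}" | "t \<in> B'" "s \<in> {y, z'}"
      using st ne \<open>{s, t} \<noteq> {y, z'}\<close> by blast
    then show "(c(y := j, z' := j)) s \<noteq> (c(y := j, z' := j)) t"
    proof cases
      case 1
      then have "s \<noteq> y" "s \<noteq> z'" "t \<noteq> y" "t \<noteq> z'" using V' by auto
      then show ?thesis using c st by (auto simp: colors_def)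
    next
      case 2
      then have "c s \<in> S" using ts by (auto simp: S_def nbrs_def)
      moreover have "s \<noteq> y" "s \<noteq> z'" using 2 V' by auto
      ultimately show ?thesis using 2 j by auto
    next
      case 3
      then have "c t \<in> S" using st by (auto simp: S_def nbrs_def)
      moreover have "t \<noteq> y" "t \<noteq> z'" using 3 V' by auto
      ultimately show ?thesis using 3 j by auto
    qed
  qed (use c j in \<open>auto simp: colors_def\<close>)
  then have "(c(y := j, z' := j)) y \<noteq> (c(y := j, z' := j)) z'" using neq by blast
  then show False using z'(2) by simp
qed

text \<open>In a colouring with \<open>k + 1\<close> colours the universal vertex \<open>v\<close>
  has a colour of its own, which may be taken to be \<open>k\<close>; the other vertices then use
  only colours below \<open>k\<close>.\<close>

lemma crit_delete_universal:
  assumes crit: "crit (Suc k) V E" and k: "1 \<le> k" and v: "v \<in> V" "\<And>x. x \<in> V - {v} \<Longrightarrow> {v, x} \<in> E"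
  shows "crit k (V - {v}) {e \<in> E. v \<notin> e}"
proof (rule critI)
  note simple = crit_simple[OF crit]
  let ?F = "{e \<in> E. v \<notin> e}"
  show "simple_on (V - {v}) ?F" using simple by (auto simp: simple_on_def)
  show "\<not> colors ?F (V - {v}) k c" for c
  proof
    assume c: "colors ?F (V - {v}) k c"
    have "colors E (V - {v}) k c" by (rule colors_mono[OF c]) auto
    then have "colors E V (Suc k) (c(v := k))" by (rule colors_new_color[OF simple])
    then show False using crit_not_colors[OF crit] by blast
  qed
  fix e assume e: "e \<in> ?F"
  obtain c0 where "colors (E - {e}) V (Suc k) c0" using crit_colors_del[OF crit] e by blast
  then obtain c where c: "colors (E - {e}) V (Suc k) c" "c v = k"
    using colors_recolor1[OF _ v(1), of "E - {e}" "Suc k" c0 k] by auto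
  have "c x < k" if "x \<in> V - {v}" for x
  proof -
    have "{v, x} \<in> E - {e}" using v(2)[OF that] e by auto
    then have "c v \<noteq> c x" using colorsD(2)[OF c(1) v(1)] that by blast
    then have "c x \<noteq> k" using c(2) by simp
    moreover have "c x < Suc k" using c that by (auto simp: colors_def)
    ultimately show ?thesis by simp
  qed
  moreover have "c x \<noteq> c y" if "x \<in> V" "y \<in> V" "{x, y} \<in> ?F - {e}" for x y
    using c that by (auto simp: colors_def)
  ultimately have "colors (?F - {e}) (V - {v}) k c" unfolding colors_def by blast
  then show "\<exists>c. colors (?F - {e}) (V - {v}) k c" by blast
next
  note simple = crit_simple[OF crit]
  fix x assume x: "x \<in> V - {v}"
  have "Suc k \<le> card (nbrs E x)" using crit_min_degree[OF crit] x by blast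
  moreover have fin: "finite (nbrs E x)" using simple_on_finite[OF simple] by blast
  ultimately have "card (nbrs E x - {v}) \<ge> 1" using k diff_card_le_card_Diff[of "{v}" "nbrs E x"] by simp
  then obtain y where "y \<in> nbrs E x - {v}" by (metis all_not_in_conv card.empty not_one_le_zero)
  then have "{x, y} \<in> {e \<in> E. v \<notin> e}" using x by (auto simp: nbrs_def)
  then show "\<exists>y. {x, y} \<in> {e \<in> E. v \<notin> e}" by blast
qed

text \<open>A non-neighbour of \<open>v\<close> at distance two would form a separating pair with
  \<open>v\<close>, and its low degree would turn this into a Hajos separation; so \<open>v\<close>
  is universal. The graph without \<open>v\<close> is then critical for \<open>k - 1\<close> with
  degrees at most \<open>k - 1\<close>, and Brooks' theorem applies unless
  \<open>k = 3\<close>.\<close>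

lemma crit_one_high_vertex:
  assumes crit: "crit k V E" and k: "3 \<le> k" and v: "v \<in> V"
    and deg: "\<And>x. x \<in> V - {v} \<Longrightarrow> card (nbrs E x) \<le> k"
    and nosep: "\<And>v A B u w. \<not> hajos_sep V E v A B u w"
  shows "(card V = k + 1 \<and> (\<forall>x\<in>V. \<forall>y\<in>V. x \<noteq> y \<longrightarrow> {x, y} \<in> E)) \<or>
    (k = 3 \<and> (\<forall>x\<in>V - {v}. {v, x} \<in> E) \<and> crit 2 (V - {v}) {e \<in> E. v \<notin> e})"
proof -
  note simple = crit_simple[OF crit]
  have univ: "{v, z} \<in> E" if z: "z \<in> V - {v}" for z
  proof (rule ccontr)
    assume nvz: "{v, z} \<notin> E"
    obtain x z' where x: "{x, v} \<in> E" "{x, z'} \<in> E" and z': "z' \<in> V" "z' \<noteq> v" "{z', v} \<notin> E"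
    proof (rule crit_nonneighbour_at_distance_two[OF crit _ v _ _ nvz])
      show "1 \<le> k" "z \<in> V" "v \<noteq> z" using k z by auto
    qed (auto simp: insert_commute)
    obtain A B where AB: "V = {z', v} \<union> A \<union> B" "z' \<notin> A \<union> B" "v \<notin> A \<union> B" "A \<inter> B = {}"
      "A \<noteq> {}" "B \<noteq> {}" "\<forall>a\<in>A. \<forall>b\<in>B. {a, b} \<notin> E"
      using crit_no_greedy[OF crit _ z'(1) v z'(2,3) x(2,1)] deg k by auto
    have "card (nbrs E z') \<le> k" using deg z' by auto
    then show False
      using separating_pair_hajos_sep[OF crit _ _ AB(1) z'(2) AB(2-6)] AB(7) k nosep by auto
  qed
  obtain r where r: "k = Suc r" "2 \<le> r" using k by (cases k) auto
  let ?F = "{e \<in> E. v \<notin> e}"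
  have H: "crit r (V - {v}) ?F"
    by (rule crit_delete_universal) (use crit v univ r in auto)
  show ?thesis
  proof (cases "k = 3")
    case True
    then show ?thesis using H univ r by auto
  next
    case False
    then have "3 \<le> r" using k r by simp
    have degF: "card (nbrs ?F x) \<le> r" if x: "x \<in> V - {v}" for x
    proof -
      have "v \<in> nbrs E x" using univ[OF x] by (simp add: nbrs_def insert_commute)
      moreover have "nbrs ?F x \<subseteq> nbrs E x - {v}" by (auto simp: nbrs_def)
      ultimately have "card (nbrs ?F x) \<le> card (nbrs E x - {v})" "card (nbrs E x - {v}) < card (nbrs E x)"
        using simple_on_finite(4)[OF simple] by (simp_all add: card_mono card_Diff1_less del: card_Diff_insert)
      then show ?thesis using deg[OF x] r by simp
    qed
    have comp: "{x, y} \<in> ?F" if "x \<in> V - {v}" "y \<in> V - {v}" "x \<noteq> y" for x y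
      using regular_crit_complete[OF H \<open>3 \<le> r\<close> degF that] .
    have all: "{x, y} \<in> E" if "x \<in> V" "y \<in> V" "x \<noteq> y" for x y
      using comp[of x y] univ[of x] univ[of y] that by (cases "x = v"; cases "y = v") (auto simp: insert_commute)
    have "nbrs E v \<noteq> {}" using crit_min_degree[OF crit v] k by auto
    then obtain x where "x \<in> V" "x \<noteq> v" by (auto simp: nbrs_def dest: simple_onD[OF simple])
    have "nbrs E x = V - {x}" using all \<open>x \<in> V\<close>
      by (auto simp: nbrs_def dest: simple_onD[OF simple])
    then have "card (nbrs E x) = card V - 1" using \<open>x \<in> V\<close> simple_on_finite(1)[OF simple] by simp
    moreover have "card (nbrs E x) = k"
      using deg[of x] crit_min_degree[OF crit, of x] \<open>x \<in> V\<close> \<open>x \<noteq> v\<close> by auto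
    ultimately have "card V = k + 1" using k by simp
    then show ?thesis using all by blast
  qed
qed

section \<open>Hajos joins as amalgams\<close>

lemma cut_bounded_iff:
  assumes "simple_on V E"
  shows "cut_bounded k V E \<longleftrightarrow>
    (\<forall>p\<in>V. \<forall>q\<in>V. p \<noteq> q \<longrightarrow> (\<exists>Z\<subseteq>V. (p \<in> Z \<longleftrightarrow> q \<notin> Z) \<and> card (cut E Z) \<le> k))" (is "_ \<longleftrightarrow> ?R")
proof
  assume "cut_bounded k V E"
  then show ?R unfolding cut_bounded_def by metis
next
  assume R: ?R
  show "cut_bounded k V E"
    unfolding cut_bounded_def
  proof (intro ballI impI)
    fix p q assume pq: "p \<in> V" "q \<in> V" "p \<noteq> q"
    then obtain Z where Z: "Z \<subseteq> V" "p \<in> Z \<longleftrightarrow> q \<notin> Z" "card (cut E Z) \<le> k" using R by metis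
    show "\<exists>Z\<subseteq>V. p \<in> Z \<and> q \<notin> Z \<and> card (cut E Z) \<le> k"
    proof (cases "p \<in> Z")
      case False
      then show ?thesis
        using Z pq card_cut_compl[OF assms Z(1)] by (intro exI[of _ "V - Z"]) auto
    qed (use Z in blast)
  qed
qed

text \<open>The two parts of a join meet only in \<open>v\<close>, so a side that avoids
  \<open>v\<close> has no vertex in common with the other part. Passing to the complement provides
  such a side.\<close>

lemma cut_bounded_avoiding:
  assumes "simple_on V E" "cut_bounded k V E" "p \<in> V" "q \<in> V" "p \<noteq> q"
  obtains Z where "Z \<subseteq> V" "v \<notin> Z" "p \<in> Z \<longleftrightarrow> q \<notin> Z" "card (cut E Z) \<le> k"
proof -
  obtain Z where Z: "Z \<subseteq> V" "p \<in> Z" "q \<notin> Z" "card (cut E Z) \<le> k"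
    using assms(2-5) unfolding cut_bounded_def by metis
  show ?thesis
  proof (cases "v \<in> Z")
    case True
    then show ?thesis
      using Z assms card_cut_compl[OF assms(1) Z(1)] by (intro that[of "V - Z"]) auto
  qed (use Z that in blast)
qed

definition hajos_edges :: "'a \<Rightarrow> 'a \<Rightarrow> 'a \<Rightarrow> 'a set set \<Rightarrow> 'a set set \<Rightarrow> 'a set set" where
  "hajos_edges v u w E1 E2 = (E1 - {{v, u}}) \<union> (E2 - {{v, w}}) \<union> {{u, w}}"

lemma hajos_edges_sym: "hajos_edges v u w E1 E2 = hajos_edges v w u E2 E1"
  by (auto simp: hajos_edges_def insert_commute)

text \<open>The parts already share the vertex \<open>v\<close>, so the identification needs no
  renaming here; the link to \<open>hajos_join\<close> is made later.\<close>

definition amalgam ::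
  "'a \<Rightarrow> 'a \<Rightarrow> 'a \<Rightarrow> 'a set \<Rightarrow> 'a set set \<Rightarrow> 'a set \<Rightarrow> 'a set set \<Rightarrow> bool" where
  "amalgam v u w V1 E1 V2 E2 \<longleftrightarrow> simple_on V1 E1 \<and> simple_on V2 E2 \<and> V1 \<inter> V2 = {v} \<and>
     {v, u} \<in> E1 \<and> {v, w} \<in> E2"

lemma amalgam_sym: "amalgam v u w V1 E1 V2 E2 \<Longrightarrow> amalgam v w u V2 E2 V1 E1"
  by (auto simp: amalgam_def)

lemma amalgamD:
  assumes "amalgam v u w V1 E1 V2 E2"
  shows "simple_on V1 E1" "simple_on V2 E2" "V1 \<inter> V2 = {v}" "{v, u} \<in> E1" "{v, w} \<in> E2"
    "v \<in> V1" "v \<in> V2" "u \<in> V1" "u \<notin> V2" "w \<in> V2" "w \<notin> V1" "u \<noteq> v" "w \<noteq> v" "u \<noteq> w"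
proof -
  show *: "simple_on V1 E1" "simple_on V2 E2" "V1 \<inter> V2 = {v}" "{v, u} \<in> E1" "{v, w} \<in> E2"
    using assms by (auto simp: amalgam_def)
  show "v \<in> V1" "u \<in> V1" "u \<noteq> v" "v \<in> V2" "w \<in> V2" "w \<noteq> v"
    using simple_onD[OF *(1,4)] simple_onD[OF *(2,5)] by auto
  then show "u \<notin> V2" "w \<notin> V1" using *(3) by auto
  then show "u \<noteq> w" using \<open>u \<in> V1\<close> by auto
qed

lemma amalgam_simple:
  assumes "amalgam v u w V1 E1 V2 E2"
  shows "simple_on (V1 \<union> V2) (hajos_edges v u w E1 E2)"
  using amalgamD[OF assms] unfolding simple_on_def hajos_edges_def by auto

lemma amalgam_edges_apart:
  assumes am: "amalgam v u w V1 E1 V2 E2" and e: "e \<in> E2"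
  shows "\<not> e \<subseteq> V1"
proof
  assume "e \<subseteq> V1"
  note D = amalgamD[OF am]
  obtain x y where xy: "e = {x, y}" "x \<noteq> y" "x \<in> V2" "y \<in> V2"
    using simple_on_edgeE[OF D(2) e] by metis
  then have "x \<in> V1 \<inter> V2" "y \<in> V1 \<inter> V2" using \<open>e \<subseteq> V1\<close> by auto
  then show False using D(3) xy(2) by simp
qed

lemma amalgam_forces:
  assumes am: "amalgam v u w V1 E1 V2 E2" and crit: "crit k V1 E1"
    and c: "colors (E1 - {{v, u}}) V1 k c"
  shows "c v = c u"
proof (rule ccontr)
  assume ne: "c v \<noteq> c u"
  have "colors E1 V1 k c"
    unfolding colors_def
  proof (intro conjI ballI impI)
    fix x y assume xy: "x \<in> V1" "y \<in> V1" "{x, y} \<in> E1"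
    show "c x \<noteq> c y"
    proof (cases "{x, y} = {v, u}")
      case True
      then show ?thesis using ne by (auto simp: doubleton_eq_iff)
    next
      case False
      then show ?thesis using c xy by (auto simp: colors_def)
    qed
  qed (use c in \<open>auto simp: colors_def\<close>)
  then show False using crit_not_colors[OF crit] by blast
qed

text \<open>The deleted edge \<open>e\<close> is carried along so that one statement serves all
  edges of the join; for \<open>e = {u, w}\<close> the colours of \<open>u\<close> and
  \<open>w\<close> need not differ.\<close>

lemma amalgam_glue:
  assumes am: "amalgam v u w V1 E1 V2 E2"
    and c: "colors (E1 - {{v, u}} - {e}) V1 k c" and d: "colors (E2 - {{v, w}} - {e}) V2 k d"
    and v: "c v = d v" and uw: "{u, w} \<noteq> e \<Longrightarrow> c u \<noteq> d w"
  shows "\<exists>c. colors (hajos_edges v u w E1 E2 - {e}) (V1 \<union> V2) k c"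
proof -
  note D = amalgamD[OF am]
  let ?F = "hajos_edges v u w E1 E2 - {e}"
  have 1: "colors ?F V1 k c"
    using amalgam_edges_apart[OF am] D(11)
    by (intro colors_mono[OF c]) (auto simp: hajos_edges_def)
  have 2: "colors ?F V2 k d"
    using amalgam_edges_apart[OF amalgam_sym[OF am]] D(9)
    by (intro colors_mono[OF d]) (auto simp: hajos_edges_def)
  have "colors ?F (V1 \<union> V2) k (\<lambda>x. if x \<in> V1 then c x else d x)"
  proof (rule colors_glue[OF 1 2])
    fix x assume "x \<in> V1" "x \<in> V2"
    then have "x = v" using D(3) by blast
    then show "c x = d x" using v by simp
  next
    fix x y assume xy: "x \<in> V1 - V2" "y \<in> V2 - V1" "{x, y} \<in> ?F"
    then have "{x, y} \<notin> E1" "{x, y} \<notin> E2"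
      using simple_onD[OF D(1), of x y] simple_onD[OF D(2), of x y] by blast+
    then have "{x, y} = {u, w}" "{u, w} \<noteq> e" using xy(3) by (auto simp: hajos_edges_def)
    moreover from this have "x = u" "y = w" using xy D by (auto simp: doubleton_eq_iff)
    ultimately show "c x \<noteq> d y" using uw by simp
  qed
  then show ?thesis by blast
qed

text \<open>The first part still contains the edge \<open>{v, u}\<close>, so \<open>u\<close> and
  \<open>v\<close> differ in \<open>c\<close>; the second part without \<open>{v, w}\<close> gives
  \<open>w\<close> the colour of \<open>v\<close>. Agreement at \<open>v\<close> then separates
  \<open>u\<close> from \<open>w\<close>.\<close>

lemma amalgam_del_edge:
  assumes am: "amalgam v u w V1 E1 V2 E2" and crit: "crit k V1 E1" "crit k V2 E2"
    and e: "e \<in> E1" "e \<noteq> {v, u}"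
  shows "\<exists>c. colors (hajos_edges v u w E1 E2 - {e}) (V1 \<union> V2) k c"
proof -
  note D = amalgamD[OF am]
  obtain c where c: "colors (E1 - {e}) V1 k c" using crit_colors_del[OF crit(1) e(1)] by blast
  have "c v < k" using c D(6) by (auto simp: colors_def)
  have "c v \<noteq> c u" using colorsD(2)[OF c D(6,8)] D(4) e by auto
  obtain d0 where "colors (E2 - {{v, w}}) V2 k d0" using crit_colors_del[OF crit(2) D(5)] by blast
  then obtain d where d: "colors (E2 - {{v, w}}) V2 k d" "d v = c v"
    using colors_recolor1[OF _ D(7) \<open>c v < k\<close>] by metis
  have "d v = d w" by (rule amalgam_forces[OF amalgam_sym[OF am] crit(2) d(1)])
  show ?thesis
  proof (rule amalgam_glue[OF am])
    show "colors (E1 - {{v, u}} - {e}) V1 k c" by (rule colors_mono[OF c]) auto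
    show "colors (E2 - {{v, w}} - {e}) V2 k d" by (rule colors_mono[OF d(1)]) auto
    show "c u \<noteq> d w" using \<open>d v = d w\<close> d(2) \<open>c v \<noteq> c u\<close> by simp
  qed (use d in simp)
qed

lemma amalgam_nonisolated:
  assumes am: "amalgam v u w V1 E1 V2 E2" and crit: "crit k V1 E1" and k: "2 \<le> k" and x: "x \<in> V1"
  shows "\<exists>y. {x, y} \<in> hajos_edges v u w E1 E2"
proof -
  note D = amalgamD[OF am]
  let ?t = "if x = v then u else v"
  have "2 \<le> card (nbrs E1 x)" using crit_min_degree[OF crit x] k by simp
  have "\<not> nbrs E1 x \<subseteq> {?t}"
  proof
    assume "nbrs E1 x \<subseteq> {?t}"
    then have "card (nbrs E1 x) \<le> card {?t}" by (intro card_mono) auto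
    then show False using \<open>2 \<le> card (nbrs E1 x)\<close> by simp
  qed
  then obtain y where y: "y \<in> nbrs E1 x" "y \<noteq> ?t" by blast
  then have "{x, y} \<noteq> {v, u}" using D(12) by (auto simp: doubleton_eq_iff split: if_splits)
  then show ?thesis using y by (auto simp: nbrs_def hajos_edges_def)
qed

text \<open>Without \<open>{v, u}\<close> and \<open>{v, w}\<close> the parts force \<open>u\<close>
  and \<open>w\<close> to the colour of \<open>v\<close>, against the edge
  \<open>{u, w}\<close>.\<close>

theorem amalgam_crit:
  assumes am: "amalgam v u w V1 E1 V2 E2" and crit: "crit k V1 E1" "crit k V2 E2" and k: "2 \<le> k"
  shows "crit k (V1 \<union> V2) (hajos_edges v u w E1 E2)"
proof (rule critI)
  note D = amalgamD[OF am]
  let ?J = "hajos_edges v u w E1 E2"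
  show "simple_on (V1 \<union> V2) ?J" by (rule amalgam_simple[OF am])
  show "\<not> colors ?J (V1 \<union> V2) k c" for c
  proof
    assume c: "colors ?J (V1 \<union> V2) k c"
    have "colors (E1 - {{v, u}}) V1 k c"
      by (rule colors_mono[OF c]) (auto simp: hajos_edges_def)
    then have "c v = c u" by (rule amalgam_forces[OF am crit(1)])
    moreover have "colors (E2 - {{v, w}}) V2 k c"
      by (rule colors_mono[OF c]) (auto simp: hajos_edges_def)
    then have "c v = c w" by (rule amalgam_forces[OF amalgam_sym[OF am] crit(2)])
    moreover have "c u \<noteq> c w"
      using colorsD(2)[OF c, of u w] D by (auto simp: hajos_edges_def)
    ultimately show False by simp
  qed
  show "\<exists>c. colors (?J - {e}) (V1 \<union> V2) k c" if e: "e \<in> ?J" for e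
  proof -
    consider "e \<in> E1" "e \<noteq> {v, u}" | "e \<in> E2" "e \<noteq> {v, w}" | "e = {u, w}"
      using e unfolding hajos_edges_def by blast
    then show ?thesis
    proof cases
      case 1
      then show ?thesis using amalgam_del_edge[OF am crit] by blast
    next
      case 2
      then show ?thesis
        using amalgam_del_edge[OF amalgam_sym[OF am] crit(2,1), of e]
        by (simp add: Un_commute hajos_edges_sym)
    next
      case 3
      obtain c where c: "colors (E1 - {{v, u}}) V1 k c" using crit_colors_del[OF crit(1) D(4)] by blast
      have "c v < k" using c D(6) by (auto simp: colors_def)
      obtain d0 where "colors (E2 - {{v, w}}) V2 k d0"
        using crit_colors_del[OF crit(2) D(5)] by blast
      then obtain d where d: "colors (E2 - {{v, w}}) V2 k d" "d v = c v"
        using colors_recolor1[OF _ D(7) \<open>c v < k\<close>] by metis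
      show ?thesis
      proof (rule amalgam_glue[OF am])
        show "colors (E1 - {{v, u}} - {e}) V1 k c" by (rule colors_mono[OF c]) auto
        show "colors (E2 - {{v, w}} - {e}) V2 k d" by (rule colors_mono[OF d(1)]) auto
      qed (use 3 d in auto)
    qed
  qed
  show "\<exists>y. {x, y} \<in> ?J" if "x \<in> V1 \<union> V2" for x
    using that amalgam_nonisolated[OF am crit(1) k, of x]
      amalgam_nonisolated[OF amalgam_sym[OF am] crit(2) k, of x] hajos_edges_sym[of v u w E1 E2]
    by auto
qed

text \<open>\<open>g\<close> replaces the deleted edge from \<open>u\<close> to \<open>v\<close> by
  the new one from \<open>u\<close> to \<open>w\<close>: both leave \<open>Z\<close> exactly if
  \<open>u\<close> lies in \<open>Z\<close>.\<close>

lemma amalgam_cut_le: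
  assumes am: "amalgam v u w V1 E1 V2 E2" and Z: "Z \<subseteq> V1" "v \<notin> Z"
  shows "card (cut (hajos_edges v u w E1 E2) Z) \<le> card (cut E1 Z)"
proof -
  note D = amalgamD[OF am]
  define g where "g = (\<lambda>(x, y). if x = u \<and> y = v then (u, w) else (x, y))"
  have "cut (hajos_edges v u w E1 E2) Z \<subseteq> g ` cut E1 Z"
  proof
    fix p assume "p \<in> cut (hajos_edges v u w E1 E2) Z"
    then obtain x y where p: "p = (x, y)" and xy: "x \<in> Z" "y \<notin> Z" "{x, y} \<in> hajos_edges v u w E1 E2"
      by (auto simp: cut_def)
    have xv: "x \<in> V1" "x \<noteq> v" "x \<notin> V2" using xy Z D(3) by auto
    then have "{x, y} \<notin> E2" using simple_onD[OF D(2)] by blast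
    then consider "{x, y} \<in> E1" "{x, y} \<noteq> {v, u}" | "{x, y} = {u, w}"
      using xy(3) unfolding hajos_edges_def by blast
    then show "p \<in> g ` cut E1 Z"
    proof cases
      case 1
      then have "(x, y) \<in> cut E1 Z" "g (x, y) = (x, y)" using xy by (auto simp: cut_def g_def insert_commute)
      then show ?thesis unfolding p by (metis imageI)
    next
      case 2
      then have "x = u" "y = w" using xv D by (auto simp: doubleton_eq_iff)
      then have "(u, v) \<in> cut E1 Z" "g (u, v) = (x, y)"
        using xy Z D(4) by (auto simp: cut_def g_def insert_commute)
      then show ?thesis unfolding p by (metis imageI)
    qed
  qed
  moreover have fin: "finite (cut E1 Z)" using simple_on_finite[OF D(1)] by blast
  ultimately have "card (cut (hajos_edges v u w E1 E2) Z) \<le> card (g ` cut E1 Z)"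
    by (intro card_mono) auto
  also have "\<dots> \<le> card (cut E1 Z)" using fin by (rule card_image_le)
  finally show ?thesis .
qed

lemma amalgam_separate:
  assumes am: "amalgam v u w V1 E1 V2 E2" and bounded: "cut_bounded k V1 E1"
    and pq: "p \<in> V1" "p \<noteq> v" "q \<in> V1 \<union> V2" "p \<noteq> q"
  shows "\<exists>Z\<subseteq>V1. (p \<in> Z \<longleftrightarrow> q \<notin> Z) \<and> card (cut (hajos_edges v u w E1 E2) Z) \<le> k"
proof -
  note D = amalgamD[OF am]
  show ?thesis
  proof (cases "q \<in> V1")
    case True
    obtain Z where "Z \<subseteq> V1" "v \<notin> Z" "p \<in> Z \<longleftrightarrow> q \<notin> Z" "card (cut E1 Z) \<le> k"
      using cut_bounded_avoiding[OF D(1) bounded pq(1) True pq(4), of v] by metis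
    then show ?thesis using amalgam_cut_le[OF am, of Z] by (meson le_trans)
  next
    case False
    \<comment> \<open>Separating \<open>p\<close> from \<open>v\<close> suffices: \<open>Z\<close>
      lies in \<open>V1\<close> and therefore avoids \<open>q\<close>.\<close>
    obtain Z where "Z \<subseteq> V1" "v \<notin> Z" "p \<in> Z \<longleftrightarrow> v \<notin> Z" "card (cut E1 Z) \<le> k"
      using cut_bounded_avoiding[OF D(1) bounded pq(1) D(6) pq(2), of v] by metis
    then show ?thesis using amalgam_cut_le[OF am, of Z] False by (meson le_trans subsetD)
  qed
qed

theorem amalgam_cut_bounded:
  assumes am: "amalgam v u w V1 E1 V2 E2" and bounded: "cut_bounded k V1 E1" "cut_bounded k V2 E2"
  shows "cut_bounded k (V1 \<union> V2) (hajos_edges v u w E1 E2)"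
proof -
  let ?J = "hajos_edges v u w E1 E2"
  have *: "\<exists>Z\<subseteq>V1 \<union> V2. (p \<in> Z \<longleftrightarrow> q \<notin> Z) \<and> card (cut ?J Z) \<le> k"
    if "p \<in> V1 \<union> V2" "p \<noteq> v" "q \<in> V1 \<union> V2" "p \<noteq> q" for p q
  proof (cases "p \<in> V1")
    case True
    then show ?thesis using amalgam_separate[OF am bounded(1) _ that(2-4)] by blast
  next
    case False
    then have "p \<in> V2" "q \<in> V2 \<union> V1" using that by auto
    then have "\<exists>Z\<subseteq>V2. (p \<in> Z \<longleftrightarrow> q \<notin> Z) \<and> card (cut ?J Z) \<le> k"
      using amalgam_separate[OF amalgam_sym[OF am] bounded(2) _ that(2) _ that(4)]
        hajos_edges_sym[of v u w E1 E2] by simp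
    then show ?thesis by blast
  qed
  show ?thesis
    unfolding cut_bounded_iff[OF amalgam_simple[OF am]]
  proof (intro ballI impI)
    fix p q assume pq: "p \<in> V1 \<union> V2" "q \<in> V1 \<union> V2" "p \<noteq> q"
    show "\<exists>Z\<subseteq>V1 \<union> V2. (p \<in> Z \<longleftrightarrow> q \<notin> Z) \<and> card (cut ?J Z) \<le> k"
    proof (cases "p = v")
      case True
      then obtain Z where "Z \<subseteq> V1 \<union> V2" "q \<in> Z \<longleftrightarrow> p \<notin> Z" "card (cut ?J Z) \<le> k"
        using *[of q p] pq by auto
      then show ?thesis by blast
    qed (use * pq in blast)
  qed
qed

section \<open>Splitting a critical graph along a Hajos separation\<close>

lemma hajos_sepD:
  assumes "hajos_sep V E v A B u w"
  shows "V = insert v (A \<union> B)" "v \<notin> A" "v \<notin> B" "A \<inter> B = {}" "u \<in> A" "w \<in> B" "{u, w} \<in> E"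
    "\<And>a b. a \<in> A \<Longrightarrow> b \<in> B \<Longrightarrow> {a, b} \<in> E \<Longrightarrow> a = u \<and> b = w"
    "insert v A \<subseteq> V" "insert v A \<noteq> V" "insert v B \<subseteq> V" "insert v B \<noteq> V"
    "u \<in> V" "w \<in> V" "v \<in> V" "u \<notin> insert v B" "w \<notin> insert v A"
proof -
  note S = assms[unfolded hajos_sep_def]
  show "V = insert v (A \<union> B)" "v \<notin> A" "v \<notin> B" "A \<inter> B = {}" "u \<in> A" "w \<in> B" "{u, w} \<in> E"
    "\<And>a b. a \<in> A \<Longrightarrow> b \<in> B \<Longrightarrow> {a, b} \<in> E \<Longrightarrow> a = u \<and> b = w"
    "insert v A \<subseteq> V" "insert v B \<subseteq> V" "u \<in> V" "w \<in> V" "v \<in> V"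
    using S by blast+
  show u: "u \<notin> insert v B" and w: "w \<notin> insert v A" using S by blast+
  show "insert v A \<noteq> V" "insert v B \<noteq> V" using u w \<open>u \<in> V\<close> \<open>w \<in> V\<close> by blast+
qed

text \<open>If \<open>u\<close> and \<open>v\<close> differed, a colouring of the other side could
  be aligned at \<open>v\<close>, with a third colour keeping \<open>w\<close> away from the colour
  of \<open>u\<close> if necessary; the two colourings would combine.\<close>

lemma hajos_sep_forces:
  assumes crit: "crit k V E" and k: "3 \<le> k" and sep: "hajos_sep V E v A B u w"
    and c: "colors E (insert v A) k c"
  shows "c u = c v"
proof (rule ccontr)
  assume ne: "c u \<noteq> c v"
  note S = hajos_sepD[OF sep]
  have uv: "c u < k" "c v < k" using c S(5) by (auto simp: colors_def)
  obtain d0 where "colors E (insert v B) k d0" using crit_colors_subset[OF crit S(11,12)] by blast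
  then obtain d where d: "colors E (insert v B) k d" "d v = c v"
    using colors_recolor1[OF _ insertI1 uv(2)] by metis
  have "\<exists>d. colors E (insert v B) k d \<and> d v = c v \<and> d w \<noteq> c u"
  proof (cases "d w = c u")
    case True
    have "\<not> {..<k} \<subseteq> {c u, c v}"
    proof
      assume "{..<k} \<subseteq> {c u, c v}"
      then have "card {..<k} \<le> card {c u, c v}" by (intro card_mono) auto
      also have "\<dots> \<le> 2" by (simp add: card_insert_if)
      finally show False using k by simp
    qed
    then obtain j where j: "j < k" "j \<noteq> c u" "j \<noteq> c v" by blast
    have "d v \<noteq> d w" using True d(2) ne by simp
    then obtain d' where "colors E (insert v B) k d'" "d' v = c v" "d' w = j"
      using colors_recolor2[OF d(1) insertI1 insertI2[OF S(6)] _ uv(2) j(1) j(3)[symmetric]] d(2) by metis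
    then show ?thesis using j by auto
  qed (use d in blast)
  then obtain d where d: "colors E (insert v B) k d" "d v = c v" "d w \<noteq> c u" by blast
  have "colors E (insert v A \<union> insert v B) k (\<lambda>x. if x \<in> insert v A then c x else d x)"
  proof (rule colors_glue[OF c d(1)])
    fix x y assume "x \<in> insert v A - insert v B" "y \<in> insert v B - insert v A" "{x, y} \<in> E"
    then have "x = u" "y = w" using S(8)[of x y] by blast+
    then show "c x \<noteq> d y" using d(3) by simp
  qed (use S(4) d(2) in auto)
  moreover have "insert v A \<union> insert v B = V" using S(1) by blast
  ultimately show False using crit_not_colors[OF crit] by auto
qed

lemma hajos_sep_crit:
  assumes crit: "crit k V E" and k: "3 \<le> k" and sep: "hajos_sep V E v A B u w"
  defines "F \<equiv> {e \<in> E. e \<subseteq> insert v A}"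
  shows "{v, u} \<notin> E" "crit k (insert v A) (insert {v, u} F)"
proof -
  note simple = crit_simple[OF crit]
  note S = hajos_sepD[OF sep]
  obtain c where c: "colors E (insert v A) k c" using crit_colors_subset[OF crit S(9,10)] by blast
  have "c u = c v" by (rule hajos_sep_forces[OF crit k sep c])
  then show vu: "{v, u} \<notin> E" using colorsD(2)[OF c insertI1 insertI2[OF S(5)]] by metis
  show "crit k (insert v A) (insert {v, u} F)"
  proof (rule critI)
    show "simple_on (insert v A) (insert {v, u} F)"
    proof -
      have "finite (insert v A)" by (rule finite_subset[OF S(9) simple_on_finite(1)[OF simple]])
      moreover have "card {v, u} = 2" "{v, u} \<subseteq> insert v A" using S(2,5) by (auto simp: card_insert_if)
      moreover have "card e = 2" if "e \<in> F" for e using simple that by (auto simp: simple_on_def F_def)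
      ultimately show ?thesis unfolding simple_on_def F_def by blast
    qed
    show "\<not> colors (insert {v, u} F) (insert v A) k d" for d
    proof
      assume d: "colors (insert {v, u} F) (insert v A) k d"
      have "colors E (insert v A) k d" by (rule colors_mono[OF d]) (auto simp: F_def)
      then have "d u = d v" by (rule hajos_sep_forces[OF crit k sep])
      moreover have "d v \<noteq> d u" using colorsD(2)[OF d insertI1 insertI2[OF S(5)]] by blast
      ultimately show False by simp
    qed
    show "\<exists>d. colors (insert {v, u} F - {e}) (insert v A) k d" if "e \<in> insert {v, u} F" for e
    proof (cases "e = {v, u}")
      case True
      have "colors (insert {v, u} F - {e}) (insert v A) k c"
        by (rule colors_mono[OF c]) (auto simp: F_def True)
      then show ?thesis by blast
    next
      case False
      then have e: "e \<in> E" "e \<subseteq> insert v A" using that by (auto simp: F_def)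
      obtain d where d: "colors (E - {e}) V k d" using crit_colors_del[OF crit e(1)] by blast
      \<comment> \<open>\<open>e\<close> lies on the \<open>A\<close> side, so the other side stays
        intact and still forces \<open>w\<close> to the colour of \<open>v\<close>; the edge
        \<open>{u, w}\<close> then separates \<open>u\<close> from \<open>v\<close>.\<close>
      have "\<not> e \<subseteq> insert v B"
      proof
        assume "e \<subseteq> insert v B"
        moreover obtain x y where "e = {x, y}" "x \<noteq> y" using simple_on_edgeE[OF simple e(1)] by metis
        ultimately show False using e(2) S(2,3,4) by blast
      qed
      then have "colors E (insert v B) k d"
        using S(11) by (intro colors_mono[OF d]) auto
      then have "d w = d v" by (rule hajos_sep_forces[OF crit k hajos_sep_sym[OF sep]])
      moreover have "{u, w} \<in> E - {e}" using S(7,17) e(2) by auto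
      then have "d u \<noteq> d w" using colorsD(2)[OF d S(13,14)] by blast
      ultimately have "d v \<noteq> d u" by simp
      have "colors (F - {e}) (insert v A) k d"
        using S(9) by (intro colors_mono[OF d]) (auto simp: F_def)
      then have "colors (insert {v, u} F - {e}) (insert v A) k d"
        using \<open>d v \<noteq> d u\<close> unfolding colors_def by (metis (no_types, lifting) Diff_iff doubleton_eq_iff insert_iff)
      then show ?thesis by blast
    qed
    fix x assume x: "x \<in> insert v A"
    show "\<exists>y. {x, y} \<in> insert {v, u} F"
    proof (cases "x = v \<or> x = u")
      case True
      then show ?thesis by (auto simp: insert_commute)
    next
      case False
      then have "x \<in> A" using x by blast
      then have "k \<le> card (nbrs E x)" using crit_min_degree[OF crit] S(9) by blast
      then have "nbrs E x \<noteq> {}" using k by auto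
      then obtain y where y: "{x, y} \<in> E" by (auto simp: nbrs_def)
      then have "y \<in> V" using simple_onD[OF simple] by blast
      then have "y \<in> insert v A" using S(1) S(8)[OF \<open>x \<in> A\<close> _ y] False by blast
      then have "{x, y} \<in> F" using y \<open>x \<in> A\<close> by (auto simp: F_def)
      then show ?thesis by blast
    qed
  qed
qed

text \<open>The new edge \<open>{v, u}\<close> is paid for by a cut edge of \<open>E\<close> outside \<open>A\<close>: if there were none, the
  colours on one side of the cut could be permuted, separating \<open>w\<close> from \<open>v\<close>.\<close>

lemma hajos_sep_cut_bounded:
  assumes crit: "crit k V E" and k: "3 \<le> k" and sep: "hajos_sep V E v A B u w"
    and bounded: "cut_bounded k V E"
  defines "F \<equiv> {e \<in> E. e \<subseteq> insert v A}"
  shows "cut_bounded k (insert v A) (insert {v, u} F)"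
proof -
  note simple = crit_simple[OF crit]
  note S = hajos_sepD[OF sep]
  have simple1: "simple_on (insert v A) (insert {v, u} F)"
    using crit_simple[OF hajos_sep_crit(2)[OF crit k sep]] unfolding F_def .
  show ?thesis
    unfolding cut_bounded_iff[OF simple1]
  proof (intro ballI impI)
    fix p q assume pq: "p \<in> insert v A" "q \<in> insert v A" "p \<noteq> q"
    then have "p \<in> V" "q \<in> V" using S(9) by blast+
    then obtain Z where Z: "Z \<subseteq> V" "v \<notin> Z" "p \<in> Z \<longleftrightarrow> q \<notin> Z" "card (cut E Z) \<le> k"
      using cut_bounded_avoiding[OF simple bounded _ _ pq(3)] by metis
    have fin: "finite (cut E Z)" using simple_on_finite[OF simple] by blast
    let ?C = "cut (insert {v, u} F) (Z \<inter> insert v A)"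
    \<comment> \<open>Restricting \<open>Z\<close> to the \<open>A\<close> side adds at most the new
      edge, and only as the pair \<open>(u, v)\<close>, since \<open>v\<close> is not in
      \<open>Z\<close>.\<close>
    have sub: "?C \<subseteq> (cut E Z \<inter> insert v A \<times> insert v A) \<union> ({(u, v)} \<inter> Z \<times> UNIV)"
      using Z(2) by (auto simp: cut_def F_def doubleton_eq_iff)
    have "card ?C \<le> card (cut E Z)"
    proof (cases "u \<in> Z")
      case False
      then have "?C \<subseteq> cut E Z" using sub by auto
      then show ?thesis using fin by (rule card_mono[rotated])
    next
      case True
      have "\<exists>s \<in> cut E Z. s \<notin> insert v A \<times> insert v A"
      proof (rule ccontr)
        assume "\<not> ?thesis"
        then have no: "x \<in> insert v A \<and> y \<in> insert v A" if "x \<in> Z" "y \<notin> Z" "{x, y} \<in> E" for x y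
          using that by (auto simp: cut_def)
        have w: "w \<in> Z" using no[of u w] True S(7,17) by blast
        obtain d where d: "colors E (insert v B) k d" using crit_colors_subset[OF crit S(11,12)] by blast
        have dw: "d w = d v" by (rule hajos_sep_forces[OF crit k hajos_sep_sym[OF sep] d])
        have "d v < k" using d by (auto simp: colors_def)
        define j where "j = (if d v = 0 then 1 else 0 :: nat)"
        have j: "j < k" "j \<noteq> d v" using k by (auto simp: j_def)
        define d' where "d' x = (if x \<in> Z then transpose (d v) j (d x) else d x)" for x
        have "colors E (insert v B) k d'"
          unfolding colors_def
        proof (intro conjI ballI impI)
          fix x assume "x \<in> insert v B"
          then have "d x < k" using d by (auto simp: colors_def)
          then show "d' x < k" using j \<open>d v < k\<close> by (auto simp: d'_def transpose_def)
        next
          fix x y assume xy: "x \<in> insert v B" "y \<in> insert v B" "{x, y} \<in> E"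
          then have yx: "{y, x} \<in> E" by (simp add: insert_commute)
          have "d x \<noteq> d y" using d xy by (auto simp: colors_def)
          moreover have "x \<in> Z \<longleftrightarrow> y \<in> Z" using no[OF _ _ xy(3)] no[OF _ _ yx] xy(1,2) S(4) Z(2) by blast
          ultimately show "d' x \<noteq> d' y" by (auto simp: d'_def dest: transpose_eq_imp_eq)
        qed
        then have "d' w = d' v" by (rule hajos_sep_forces[OF crit k hajos_sep_sym[OF sep]])
        then show False using w Z(2) dw j by (simp add: d'_def)
      qed
      then obtain s where s: "s \<in> cut E Z" "s \<notin> insert v A \<times> insert v A" by blast
      have "?C \<subseteq> insert (u, v) (cut E Z - {s})" using sub s by auto
      then have "card ?C \<le> card (insert (u, v) (cut E Z - {s}))" using fin by (intro card_mono) auto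
      also have "\<dots> \<le> Suc (card (cut E Z - {s}))" by (rule card_insert_le_m1) auto
      also have "\<dots> = card (cut E Z)" using fin s(1) by (rule card.remove[symmetric])
      finally show ?thesis .
    qed
    then have "card ?C \<le> k" using Z(4) by simp
    moreover have "p \<in> Z \<inter> insert v A \<longleftrightarrow> q \<notin> Z \<inter> insert v A" using Z(3) pq by blast
    ultimately show "\<exists>Z\<subseteq>insert v A. (p \<in> Z \<longleftrightarrow> q \<notin> Z) \<and> card (cut (insert {v, u} F) Z) \<le> k"
      by (intro exI[of _ "Z \<inter> insert v A"] conjI) simp_all
  qed
qed

lemma hajos_sep_amalgam:
  assumes crit: "crit k V E" and k: "3 \<le> k" and sep: "hajos_sep V E v A B u w"
  defines "E1 \<equiv> insert {v, u} {e \<in> E. e \<subseteq> insert v A}"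
    and "E2 \<equiv> insert {v, w} {e \<in> E. e \<subseteq> insert v B}"
  shows "amalgam v u w (insert v A) E1 (insert v B) E2" "E = hajos_edges v u w E1 E2"
    "V = insert v A \<union> insert v B"
proof -
  note S = hajos_sepD[OF sep] and sep' = hajos_sep_sym[OF sep]
  note simple = crit_simple[OF crit]
  show "V = insert v A \<union> insert v B" using S(1) by blast
  show "amalgam v u w (insert v A) E1 (insert v B) E2"
    using crit_simple[OF hajos_sep_crit(2)[OF crit k sep]]
      crit_simple[OF hajos_sep_crit(2)[OF crit k sep']] S(4)
    unfolding amalgam_def E1_def E2_def by auto
  have "e \<subseteq> insert v A \<or> e \<subseteq> insert v B \<or> e = {u, w}" if e: "e \<in> E" for e
  proof -
    obtain x y where xy: "e = {x, y}" "x \<in> V" "y \<in> V"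
      using simple_on_edgeE[OF simple e] by metis
    moreover have "{y, x} \<in> E" using e xy by (simp add: insert_commute)
    moreover have "x = v \<or> x \<in> A \<or> x \<in> B" "y = v \<or> y \<in> A \<or> y \<in> B" using xy S(1) by blast+
    ultimately show ?thesis using S(8)[of x y] S(8)[of y x] e by (elim disjE) auto
  qed
  moreover have "{v, u} \<notin> E" "{v, w} \<notin> E" "{u, w} \<in> E"
    using hajos_sep_crit(1)[OF crit k sep] hajos_sep_crit(1)[OF crit k sep'] S(7) by blast+
  ultimately show "E = hajos_edges v u w E1 E2"
    unfolding hajos_edges_def E1_def E2_def by blast
qed

section \<open>Graphs without a Hajos decomposition\<close>

definition clique :: "'a set \<Rightarrow> 'a set set" where
  "clique Y = {{x, y} | x y. x \<in> Y \<and> y \<in> Y \<and> x \<noteq> y}"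

lemma clique_iff: "{x, y} \<in> clique Y \<longleftrightarrow> x \<in> Y \<and> y \<in> Y \<and> x \<noteq> y"
  by (auto simp: clique_def doubleton_eq_iff)

text \<open>In a cut with exactly \<open>k\<close> edges whose ends on the side \<open>X\<close> are always monochromatic, the ends
  \<open>Y\<close> on the other side are distinct and always rainbow. Hence the whole other side may be replaced
  by a clique on \<open>Y\<close>.\<close>

locale rainbow_cut =
  fixes k :: nat and V :: "'a set" and E :: "'a set set" and X :: "'a set"
  assumes crit: "crit k V E" and k3: "3 \<le> k" and bounded: "cut_bounded k V E"
    and XV: "X \<subseteq> V" and card_cut: "card (cut E X) = k" and mono: "mono_cut k V E X"
begin

definition "Y = snd ` cut E X"
definition "W = X \<union> Y"
definition "F = {e \<in> E. e \<inter> X \<noteq> {}} \<union> clique Y"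

lemma simple: "simple_on V E"
  by (rule crit_simple[OF crit])

lemma cut_mem: "(x, y) \<in> cut E X \<longleftrightarrow> x \<in> X \<and> y \<in> Y \<and> {x, y} \<in> E"
  by (force simp: cut_def Y_def)

lemma Y_sub: "Y \<subseteq> V - X"
  unfolding Y_def by (auto simp: cut_def dest: simple_onD[OF simple])

lemma ex_cut: "\<exists>x y. (x, y) \<in> cut E X"
proof -
  have "cut E X \<noteq> {}" using card_cut k3 by auto
  then show ?thesis by auto
qed

lemma X_nontriv: "X \<noteq> {}" "X \<noteq> V"
proof -
  obtain x y where "(x, y) \<in> cut E X" using ex_cut by blast
  then have "x \<in> X" "y \<in> V - X" using Y_sub by (auto simp: cut_mem)
  then show "X \<noteq> {}" "X \<noteq> V" by blast+
qed

lemma rainbow: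
  assumes "colors E (V - X) k d"
  shows "inj_on d Y" "inj_on snd (cut E X)"
proof -
  have "inj_on (d \<circ> snd) (cut E X)"
    using mono assms by (auto simp: mono_cut_def comp_def case_prod_unfold)
  then show "inj_on d Y" "inj_on snd (cut E X)"
    unfolding Y_def by (auto dest: inj_on_imageI inj_on_imageI2)
qed

lemma inj_snd: "inj_on snd (cut E X)"
proof -
  have "V - X \<noteq> V" "V - X \<subseteq> V" using X_nontriv XV by auto
  then obtain d where "colors E (V - X) k d" using crit_colors_subset[OF crit] by metis
  then show ?thesis by (rule rainbow)
qed

lemma finite_XY: "finite X" "finite Y"
  using simple_on_finite(1)[OF simple] XV Y_sub by (meson finite_Diff finite_subset)+

lemma card_Y: "card Y = k"
  using card_image[OF inj_snd] card_cut by (simp add: Y_def)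

lemma unique_end: "y \<in> Y \<Longrightarrow> \<exists>x. \<forall>x'. x' \<in> X \<and> {x', y} \<in> E \<longrightarrow> x' = x"
proof -
  assume "y \<in> Y"
  then obtain x where "(x, y) \<in> cut E X" unfolding Y_def by auto
  moreover have "x' = x" if "x' \<in> X" "{x', y} \<in> E" for x'
    using inj_onD[OF inj_snd, of "(x', y)" "(x, y)"] calculation that \<open>y \<in> Y\<close> by (auto simp: cut_mem)
  ultimately show ?thesis by blast
qed

text \<open>A vertex of \<open>Y\<close> has \<open>k - 1\<close> possible neighbours in
  \<open>Y\<close> and one in \<open>X\<close>. The set \<open>N\<close> stands for neighbourhoods
  in \<open>F\<close>, and for those in \<open>E\<close> when \<open>Y\<close> is the whole other
  side.\<close>

lemma degree_le:
  assumes y: "y \<in> Y" and N: "N \<subseteq> Y \<union> (X \<inter> nbrs E y)" "y \<notin> N"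
  shows "card N \<le> k"
proof -
  obtain x where x: "\<forall>x'. x' \<in> X \<and> {x', y} \<in> E \<longrightarrow> x' = x" using unique_end[OF y] by blast
  have "N \<subseteq> insert x (Y - {y})" using N x by (auto simp: nbrs_def insert_commute)
  then have "card N \<le> card (insert x (Y - {y}))" using finite_XY by (intro card_mono) auto
  also have "\<dots> \<le> Suc (card (Y - {y}))" by (rule card_insert_le_m1) auto
  also have "\<dots> = k" using card.remove[OF finite_XY(2) y] card_Y by simp
  finally show ?thesis .
qed

lemma F_iff: "{x, y} \<in> F \<longleftrightarrow> {x, y} \<in> E \<and> (x \<in> X \<or> y \<in> X) \<or> x \<in> Y \<and> y \<in> Y \<and> x \<noteq> y"
  by (auto simp: F_def clique_iff)

lemma F_degree: "y \<in> Y \<Longrightarrow> card (nbrs F y) \<le> k"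
  using Y_sub by (intro degree_le) (auto simp: nbrs_def F_iff dest: simple_onD[OF simple])

lemma simple_F: "simple_on W F"
  unfolding simple_on_def
proof (intro conjI ballI)
  show "finite W" using finite_XY by (simp add: W_def)
  fix e assume e: "e \<in> F"
  consider "e \<in> E" "e \<inter> X \<noteq> {}" | x y where "e = {x, y}" "x \<in> Y" "y \<in> Y" "x \<noteq> y"
    using e by (auto simp: F_def clique_def)
  then have "e \<subseteq> W \<and> card e = 2"
  proof cases
    case 1
    obtain x y where xy: "e = {x, y}" "x \<noteq> y" "x \<in> V" "y \<in> V"
      using simple_on_edgeE[OF simple 1(1)] by metis
    then have "(x, y) \<in> cut E X \<or> (y, x) \<in> cut E X \<or> x \<in> X \<and> y \<in> X"
      using 1 by (auto simp: cut_def insert_commute)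
    then show ?thesis using xy by (auto simp: cut_mem W_def)
  qed (auto simp: W_def)
  then show "e \<subseteq> W" "card e = 2" by auto
qed

text \<open>The clique would use all \<open>k\<close> colours on \<open>Y\<close>, hence also the
  common colour of the ends in \<open>X\<close>; the vertex of \<open>Y\<close> with this colour
  would then agree with its neighbour in \<open>X\<close>.\<close>

lemma crit_F: "crit k W F"
proof (rule critI[OF simple_F])
  have monoX: "\<exists>a. \<forall>x y. (x, y) \<in> cut E X \<longrightarrow> c x = a" if "colors E X k c" for c
    using mono that by (auto simp: mono_cut_def)
  have XW: "X \<subseteq> W" "Y \<subseteq> W" by (auto simp: W_def)
  show "\<not> colors F W k c" for c
  proof
    assume c: "colors F W k c"
    have "colors E X k c"
      using c XW unfolding colors_def by (meson F_iff subsetD)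
    then obtain a where a: "\<And>x y. (x, y) \<in> cut E X \<Longrightarrow> c x = a" using monoX by blast
    obtain x y where xy: "(x, y) \<in> cut E X" using ex_cut by blast
    then have "c x < k" using c XW by (auto simp: cut_mem colors_def)
    then have "a < k" using a[OF xy] by simp
    have "inj_on c Y"
      using c XW by (auto simp: inj_on_def colors_def F_iff) blast
    then have "card (c ` Y) = k" by (simp add: card_image card_Y)
    moreover have "c ` Y \<subseteq> {..<k}" using c XW by (auto simp: colors_def)
    ultimately have "c ` Y = {..<k}" by (intro card_subset_eq) auto
    then obtain y where y: "y \<in> Y" "c y = a" using \<open>a < k\<close> by (metis imageE lessThan_iff)
    then obtain x where x: "(x, y) \<in> cut E X" unfolding Y_def by auto
    then have "c x \<noteq> c y" using colorsD(2)[OF c, of x y] XW by (auto simp: cut_mem F_iff)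
    then show False using a[OF x] y(2) by simp
  qed
  show "\<exists>c. colors (F - {e}) W k c" if e: "e \<in> F" for e
  proof (cases "e \<in> E \<and> e \<inter> X \<noteq> {}")
    case True
    then obtain c where c: "colors (E - {e}) V k c" using crit_colors_del[OF crit] by blast
    \<comment> \<open>The edge \<open>e\<close> meets \<open>X\<close>, so the other side is
      properly coloured and \<open>Y\<close> is still rainbow: the clique edges cost
      nothing.\<close>
    have "colors E (V - X) k c" by (rule colors_mono[OF c]) (use True in auto)
    then have inj: "inj_on c Y" by (rule rainbow)
    have "colors (F - {e}) W k c"
      unfolding colors_def
    proof (intro conjI ballI impI)
      fix x assume "x \<in> W" then show "c x < k" using c XV Y_sub by (auto simp: W_def colors_def)
    next
      fix x y assume xy: "x \<in> W" "y \<in> W" "{x, y} \<in> F - {e}"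
      then have V: "x \<in> V" "y \<in> V" using XV Y_sub by (auto simp: W_def)
      consider "{x, y} \<in> E - {e}" | "x \<in> Y" "y \<in> Y" "x \<noteq> y" using xy(3) by (auto simp: F_iff)
      then show "c x \<noteq> c y"
      proof cases
        case 1
        then show ?thesis using colorsD(2)[OF c V] by blast
      next
        case 2
        then show ?thesis using inj by (auto dest: inj_onD)
      qed
    qed
    then show ?thesis by blast
  next
    case False
    then obtain s t where st: "e = {s, t}" "s \<in> Y" "t \<in> Y" "s \<noteq> t" using e by (auto simp: F_def clique_def)
    obtain c where c: "colors E X k c" using crit_colors_subset[OF crit XV] X_nontriv by blast
    then obtain a where a: "\<And>x y. (x, y) \<in> cut E X \<Longrightarrow> c x = a" using monoX by blast
    obtain x0 y0 where xy0: "(x0, y0) \<in> cut E X" using ex_cut by blast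
    then have "c x0 < k" using c by (auto simp: cut_mem colors_def)
    then have "a < k" using a[OF xy0] by simp
    \<comment> \<open>Since \<open>s\<close> and \<open>t\<close> may share a colour, the
      \<open>k - 1\<close> colours other than \<open>a\<close> suffice for \<open>Y\<close>, and no
      cut edge is in conflict.\<close>
    have "card (Y - {t}) = card ({..<k} - {a})" using st finite_XY card_Y \<open>a < k\<close> by simp
    then obtain h where h: "bij_betw h (Y - {t}) ({..<k} - {a})"
      using finite_same_card_bij finite_XY by (metis finite_Diff finite_lessThan)
    define g where "g = h(t := h s)"
    have g: "g y < k" "g y \<noteq> a" if "y \<in> Y" for y
    proof -
      have "g y \<in> h ` (Y - {t})" using that st by (auto simp: g_def)
      then show "g y < k" "g y \<noteq> a" using h by (auto simp: bij_betw_def)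
    qed
    have g': "g x \<noteq> g y" if xy: "x \<in> Y" "y \<in> Y" "x \<noteq> y" "{x, y} \<noteq> {s, t}" for x y
    proof -
      have "inj_on h (Y - {t})" using h by (simp add: bij_betw_def)
      moreover have "x = t \<Longrightarrow> y \<noteq> s" "y = t \<Longrightarrow> x \<noteq> s" using xy(4) by auto
      ultimately show ?thesis using xy st by (auto simp: g_def inj_on_eq_iff)
    qed
    have "colors (F - {e}) W k (\<lambda>x. if x \<in> X then c x else g x)"
      unfolding colors_def
    proof (intro conjI ballI impI)
      fix x assume "x \<in> W"
      then show "(if x \<in> X then c x else g x) < k" using c g by (auto simp: W_def colors_def)
    next
      fix x y assume xy: "x \<in> W" "y \<in> W" "{x, y} \<in> F - {e}"
      have mixed: "c x \<noteq> g y" if "x \<in> X" "y \<in> Y" "{x, y} \<in> E" for x y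
        using a[of x y] g(2)[of y] that by (auto simp: cut_mem)
      consider "x \<in> X" "y \<in> X" | "x \<in> X" "y \<in> Y" "y \<notin> X" | "y \<in> X" "x \<in> Y" "x \<notin> X"
        | "x \<in> Y" "y \<in> Y" "x \<notin> X" "y \<notin> X"
        using xy(1,2) Y_sub by (auto simp: W_def)
      then show "(if x \<in> X then c x else g x) \<noteq> (if y \<in> X then c y else g y)"
      proof cases
        case 1
        then have "{x, y} \<in> E" using xy(3) Y_sub by (auto simp: F_iff)
        then show ?thesis using 1 colorsD(2)[OF c] by auto
      next
        case 2
        then have "{x, y} \<in> E" using xy(3) Y_sub by (auto simp: F_iff)
        then show ?thesis using 2 mixed by auto
      next
        case 3
        then have "{y, x} \<in> E" using xy(3) Y_sub by (auto simp: F_iff insert_commute)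
        then show ?thesis using 3 mixed[of y x] by auto
      next
        case 4
        then have "x \<noteq> y" "{x, y} \<noteq> {s, t}" using xy(3) st(1) by (auto simp: F_iff)
        then show ?thesis using 4 g' by auto
      qed
    qed
    then show ?thesis by blast
  qed
  fix x assume x: "x \<in> W"
  show "\<exists>y. {x, y} \<in> F"
  proof (cases "x \<in> X")
    case True
    then have "k \<le> card (nbrs E x)" using crit_min_degree[OF crit] XV by blast
    then have "nbrs E x \<noteq> {}" using k3 by auto
    then show ?thesis using True by (auto simp: nbrs_def F_iff)
  next
    case False
    then have "x \<in> Y" using x by (simp add: W_def)
    then obtain z where "(z, x) \<in> cut E X" unfolding Y_def by auto
    then show ?thesis by (auto simp: cut_mem F_iff insert_commute)
  qed
qed

text \<open>A vertex of \<open>Y\<close> is cut off by its own edges. For two vertices of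
  \<open>X\<close>, a small cut \<open>Z\<close> of \<open>E\<close> is uncrossed with
  \<open>X\<close>: the union has at least \<open>k\<close> cut edges, so by submodularity the
  intersection has at most \<open>k\<close>. If \<open>Z\<close> contains all of
  \<open>V - X\<close> the union is \<open>V\<close>, but then the complement of \<open>Z\<close>
  already lies in \<open>X\<close>.\<close>

lemma cut_bounded_F: "cut_bounded k W F"
proof -
  have inside: "\<exists>Z\<subseteq>X. (p \<in> Z \<longleftrightarrow> q \<notin> Z) \<and> card (cut E Z) \<le> k" if pq: "p \<in> X" "q \<in> X" "p \<noteq> q" for p q
  proof -
    have "p \<in> V" "q \<in> V" using pq XV by auto
    then obtain Z where Z: "Z \<subseteq> V" "p \<in> Z" "q \<notin> Z" "card (cut E Z) \<le> k"
      using bounded pq(3) unfolding cut_bounded_def by metis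
    show ?thesis
    proof (cases "V - X \<subseteq> Z")
      case True
      then have "V - Z \<subseteq> X" "card (cut E (V - Z)) \<le> k"
        using card_cut_compl[OF simple Z(1)] Z(4) by auto
      then show ?thesis using Z \<open>p \<in> V\<close> \<open>q \<in> V\<close> by (intro exI[of _ "V - Z"]) auto
    next
      case False
      then have "Z \<union> X \<noteq> V" "Z \<union> X \<subseteq> V" "Z \<union> X \<noteq> {}" using XV Z by auto
      then have "k \<le> card (cut E (Z \<union> X))" using crit_cut_ge[OF crit] by metis
      then have "card (cut E (Z \<inter> X)) \<le> k"
        using cut_submodular[OF simple, of Z X] Z(4) card_cut by linarith
      then show ?thesis using Z pq by (intro exI[of _ "Z \<inter> X"]) auto
    qed
  qed
  show ?thesis
    unfolding cut_bounded_iff[OF simple_F]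
  proof (intro ballI impI)
    fix p q assume pq: "p \<in> W" "q \<in> W" "p \<noteq> q"
    have single: "{y} \<subseteq> W" "card (cut F {y}) \<le> k" if "y \<in> Y" for y
      using that F_degree card_cut_singleton[OF simple_F] by (auto simp: W_def)
    consider "p \<in> Y" | "q \<in> Y" | "p \<in> X" "q \<in> X" using pq by (auto simp: W_def)
    then show "\<exists>Z\<subseteq>W. (p \<in> Z \<longleftrightarrow> q \<notin> Z) \<and> card (cut F Z) \<le> k"
    proof cases
      case 1
      then show ?thesis using single pq(3) by (intro exI[of _ "{p}"]) auto
    next
      case 2
      then show ?thesis using single pq(3) by (intro exI[of _ "{q}"]) auto
    next
      case 3
      then obtain Z where Z: "Z \<subseteq> X" "p \<in> Z \<longleftrightarrow> q \<notin> Z" "card (cut E Z) \<le> k"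
        using inside pq(3) by metis
      have "cut F Z \<subseteq> cut E Z" using Z(1) Y_sub by (auto simp: cut_def F_iff)
      then have "card (cut F Z) \<le> card (cut E Z)"
        by (rule card_mono[OF simple_on_finite(3)[OF simple]])
      then show ?thesis using Z by (intro exI[of _ Z]) (auto simp: W_def)
    qed
  qed
qed

text \<open>Rules out both outcomes of the induction for the smaller graph. A vertex of
  \<open>Y\<close> has degree at most \<open>k\<close>, too little among \<open>k + card X\<close>
  vertices; a universal vertex in \<open>X\<close> would be the only neighbour in \<open>X\<close>
  of every vertex of \<open>Y\<close>, hence a cut vertex.\<close>

lemma no_universal:
  assumes X2: "2 \<le> card X" and h: "h \<in> W" "\<And>x. x \<in> W - {h} \<Longrightarrow> {h, x} \<in> F"
  shows False
proof (cases "h \<in> Y")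
  case True
  have "W - {h} \<subseteq> nbrs F h" using h by (auto simp: nbrs_def)
  then have "card (W - {h}) \<le> k"
    using F_degree[OF True] simple_on_finite(4)[OF simple_F] by (meson card_mono le_trans)
  moreover have "card W = card X + k"
    unfolding W_def using finite_XY Y_sub by (subst card_Un_disjoint) (auto simp: card_Y)
  moreover have "card (W - {h}) = card W - 1" using h(1) by simp
  ultimately show False using X2 k3 by linarith
next
  case False
  then have hX: "h \<in> X" using h(1) by (simp add: W_def)
  have hY: "{h, y} \<in> E" if "y \<in> Y" for y
    using h(2)[of y] that False by (auto simp: W_def F_iff)
  have "\<exists>a\<in>X - {h}. \<exists>b\<in>Y. {a, b} \<in> F"
  proof (rule crit_no_cut_vertex[OF crit_F])
    show "W = insert h (X - {h} \<union> Y)" using hX by (auto simp: W_def)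
    show "X - {h} \<noteq> {}"
    proof
      assume "X - {h} = {}"
      then have "X \<subseteq> {h}" by blast
      then have "card X \<le> card {h}" by (intro card_mono) auto
      then show False using X2 by simp
    qed
    show "Y \<noteq> {}" using card_Y k3 by auto
  qed (use k3 False Y_sub in auto)
  then obtain a b where ab: "a \<in> X" "a \<noteq> h" "b \<in> Y" "{a, b} \<in> F" by blast
  then have "{a, b} \<in> E" using Y_sub by (auto simp: F_iff)
  moreover have "{h, b} \<in> E" using hY ab by blast
  ultimately show False using unique_end[OF ab(3)] ab hX by blast
qed

text \<open>The removed vertices of \<open>V - X\<close> are put back on the side that contains
  \<open>Y\<close>, since all edges between \<open>X\<close> and \<open>V - X\<close> end in
  \<open>Y\<close>.\<close>

lemma hajos_sep_lift_aux:
  assumes sep: "hajos_sep W F v A B u w" and v: "v \<in> X" and YA: "Y \<subseteq> A"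
  shows "hajos_sep V E v (A \<inter> X \<union> (V - X)) B u w"
proof -
  note S = hajos_sepD[OF sep]
  have BX: "B \<subseteq> X" using S(1,4) YA by (auto simp: W_def)
  have AW: "A \<subseteq> X \<union> Y" using S(1) by (auto simp: W_def)
  have uw: "{u, w} \<in> E" using S(6,7) BX Y_sub by (auto simp: F_iff)
  have only: "a = u \<and> b = w" if ab: "a \<in> A \<inter> X \<union> (V - X)" "b \<in> B" "{a, b} \<in> E" for a b
  proof -
    have F: "{a, b} \<in> F" using ab BX by (auto simp: F_iff)
    have "a \<in> A"
    proof (cases "a \<in> X")
      case False
      then have "(b, a) \<in> cut E X" using ab BX by (auto simp: cut_def insert_commute)
      then show ?thesis using YA by (auto simp: cut_mem)
    qed (use ab in simp)
    then show ?thesis using S(8)[OF _ ab(2) F] by blast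
  qed
  have "V = insert v (A \<inter> X \<union> (V - X) \<union> B)"
    using S(1) XV Y_sub v by (auto simp: W_def)
  moreover have "v \<notin> A \<inter> X \<union> (V - X) \<union> B" using S(2,3) v by blast
  moreover have "(A \<inter> X \<union> (V - X)) \<inter> B = {}" using S(4) BX by blast
  moreover have "u \<in> A \<inter> X \<union> (V - X)" using S(5) AW Y_sub by blast
  ultimately show ?thesis unfolding hajos_sep_def using S(6) uw only by blast
qed

text \<open>Each side of the separation has at least \<open>k\<close> cut edges, so \<open>v\<close>
  has at least \<open>k - 1\<close> neighbours on each side, too many for a vertex of
  \<open>Y\<close>. A clique of at least three vertices cannot be spread over two sides joined by a
  single edge, so \<open>Y\<close> lies on one of them.\<close>

lemma hajos_sep_lift:
  assumes sep: "hajos_sep W F v A B u w"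
  shows "\<exists>v A B u w. hajos_sep V E v A B u w"
proof -
  note S = hajos_sepD[OF sep] and sep' = hajos_sep_sym[OF sep]
  have fin: "finite (nbrs F v)" using simple_on_finite(4)[OF simple_F] by blast
  have side: "k \<le> Suc (card (nbrs F v \<inter> A))" if sep: "hajos_sep W F v A B u w" for A B u w
  proof -
    note S = hajos_sepD[OF sep]
    have "A \<noteq> {}" "A \<noteq> W" "A \<subseteq> W" using S(2,5,9,15) by auto
    then have "k \<le> card (cut F A)" using crit_cut_ge[OF crit_F] by blast
    also have "cut F A \<subseteq> insert (u, w) ((\<lambda>x. (x, v)) ` (nbrs F v \<inter> A))"
    proof
      fix p assume "p \<in> cut F A"
      then obtain x y where p: "p = (x, y)" "x \<in> A" "y \<notin> A" "{x, y} \<in> F" by (auto simp: cut_def)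
      then have "y \<in> W" using simple_onD[OF simple_F] by blast
      then have "y = v \<or> y \<in> B" using S(1) p(3) by blast
      then show "p \<in> insert (u, w) ((\<lambda>x. (x, v)) ` (nbrs F v \<inter> A))"
        using S(8)[OF p(2) _ p(4)] p by (auto simp: nbrs_def insert_commute)
    qed
    then have "card (cut F A) \<le> card (insert (u, w) ((\<lambda>x. (x, v)) ` (nbrs F v \<inter> A)))"
      using fin by (intro card_mono) auto
    also have "\<dots> \<le> Suc (card ((\<lambda>x. (x, v)) ` (nbrs F v \<inter> A)))" by (rule card_insert_le_m1) auto
    also have "\<dots> \<le> Suc (card (nbrs F v \<inter> A))" using fin by (simp add: card_image_le)
    finally show ?thesis .
  qed
  have "v \<notin> Y"
  proof
    assume "v \<in> Y"
    then have "card (nbrs F v) \<le> k" by (rule F_degree)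
    moreover have "card (nbrs F v \<inter> A) + card (nbrs F v \<inter> B) \<le> card (nbrs F v)"
    proof -
      have "card (nbrs F v \<inter> A \<union> nbrs F v \<inter> B) = card (nbrs F v \<inter> A) + card (nbrs F v \<inter> B)"
        using fin S(4) by (intro card_Un_disjoint) auto
      moreover have "card (nbrs F v \<inter> A \<union> nbrs F v \<inter> B) \<le> card (nbrs F v)"
        using fin by (intro card_mono) auto
      ultimately show ?thesis by simp
    qed
    ultimately show False using side[OF sep] side[OF sep'] k3 by linarith
  qed
  then have vX: "v \<in> X" using S(15) by (simp add: W_def)
  have "Y \<subseteq> A \<or> Y \<subseteq> B"
  proof (rule ccontr)
    assume "\<not> ?thesis"
    moreover have YAB: "Y \<subseteq> A \<union> B" using S(1) \<open>v \<notin> Y\<close> by (auto simp: W_def)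
    ultimately obtain y y' where y: "y \<in> Y" "y \<in> A" "y' \<in> Y" "y' \<in> B" by blast
    have "\<not> Y \<subseteq> {y, y'}"
    proof
      assume "Y \<subseteq> {y, y'}"
      then have "card Y \<le> card {y, y'}" by (intro card_mono) auto
      also have "\<dots> \<le> 2" by (simp add: card_insert_if)
      finally show False using card_Y k3 by simp
    qed
    then obtain t where t: "t \<in> Y" "t \<noteq> y" "t \<noteq> y'" by blast
    have "y \<noteq> y'" using y S(4) by blast
    then have 1: "y = u" "y' = w" using S(8)[of y y'] y by (auto simp: F_iff)
    have "t \<in> A \<or> t \<in> B" using YAB t by blast
    then show False
    proof
      assume "t \<in> A"
      then have "t = u" using S(8)[of t y'] t y by (auto simp: F_iff)
      then show False using 1 t by simp
    next
      assume "t \<in> B"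
      then have "t = w" using S(8)[of y t] t y by (auto simp: F_iff)
      then show False using 1 t by simp
    qed
  qed
  then show ?thesis
    using hajos_sep_lift_aux[OF sep vX] hajos_sep_lift_aux[OF sep' vX] by blast
qed

end

theorem hajos_indecomposable:
  assumes "crit k V E" "3 \<le> k" "cut_bounded k V E" "\<And>v A B u w. \<not> hajos_sep V E v A B u w"
  shows "(card V = k + 1 \<and> (\<forall>x\<in>V. \<forall>y\<in>V. x \<noteq> y \<longrightarrow> {x, y} \<in> E)) \<or>
    (k = 3 \<and> (\<exists>v\<in>V. (\<forall>x\<in>V - {v}. {v, x} \<in> E) \<and> crit 2 (V - {v}) {e \<in> E. v \<notin> e}))"
  using assms
proof (induction "card V" arbitrary: V E rule: less_induct)
  case less
  note crit = less.prems(1) and k = less.prems(2)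
  note simple = crit_simple[OF crit]
  have "V \<noteq> {}" using crit_not_colors[OF crit] by (auto simp: colors_def)
  \<comment> \<open>For a single vertex \<open>X\<close> the exchanged graph would just be the
    complete graph on \<open>k + 1\<close> vertices, which has universal vertices; hence the bound
    on \<open>card X\<close>.\<close>
  have low: "card (nbrs E y) \<le> k"
    if X: "X \<subseteq> V" "2 \<le> card X" "card (cut E X) = k" "mono_cut k V E X" and y: "y \<in> V - X" for X y
  proof -
    interpret rainbow_cut k V E X by unfold_locales (use less.prems X in auto)
    show ?thesis
    proof (cases "Y = V - X")
      case True
      have "nbrs E y \<subseteq> V" by (auto simp: nbrs_def dest: simple_onD[OF simple])
      moreover have "y \<notin> nbrs E y" using simple_onD(3)[OF simple, of y y] by (auto simp only: nbrs_def mem_Collect_eq)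
      ultimately have "nbrs E y \<subseteq> V" "y \<notin> nbrs E y" by auto
      then show ?thesis using y True by (intro degree_le[of y]) auto
    next
      case False
      then have "W \<subset> V" using Y_sub XV by (auto simp: W_def)
      then have "card W < card V" using simple_on_finite(1)[OF simple] by (rule psubset_card_mono[rotated])
      moreover have "\<not> hajos_sep W F v A B u w" for v A B u w
        using hajos_sep_lift less.prems(4) by blast
      ultimately have *: "(card W = k + 1 \<and> (\<forall>x\<in>W. \<forall>y\<in>W. x \<noteq> y \<longrightarrow> {x, y} \<in> F)) \<or>
        (k = 3 \<and> (\<exists>v\<in>W. (\<forall>x\<in>W - {v}. {v, x} \<in> F) \<and> crit 2 (W - {v}) {e \<in> F. v \<notin> e}))"
        using less.hyps[OF _ crit_F k cut_bounded_F] by blast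
      obtain x where x: "x \<in> W" using X_nontriv by (auto simp: W_def)
      from * have "\<exists>h\<in>W. \<forall>x\<in>W - {h}. {h, x} \<in> F"
      proof (elim disjE conjE)
        assume "\<forall>x\<in>W. \<forall>y\<in>W. x \<noteq> y \<longrightarrow> {x, y} \<in> F"
        then show ?thesis using x by (intro bexI[of _ x]) auto
      qed blast
      then show ?thesis using no_universal[OF X(2)] by blast
    qed
  qed
  have "\<exists>v\<in>V. \<forall>x\<in>V - {v}. card (nbrs E x) \<le> k"
  proof (rule ccontr)
    assume "\<not> ?thesis"
    then have high: "\<exists>x\<in>V - {v}. k < card (nbrs E x)" if "v \<in> V" for v using that by (meson not_le)
    obtain p where p: "p \<in> V" "k < card (nbrs E p)" using high \<open>V \<noteq> {}\<close> by blast
    obtain q where q: "q \<in> V" "q \<noteq> p" "k < card (nbrs E q)" using high[OF p(1)] by blast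
    obtain Z where Z: "Z \<subseteq> V" "p \<in> Z" "q \<notin> Z" "card (cut E Z) \<le> k"
      using less.prems(3) p(1) q(1,2) unfolding cut_bounded_def by metis
    have nontriv: "Z \<noteq> {}" "Z \<noteq> V" using Z(2,3) q(1) by auto
    have cZ: "card (cut E Z) = k" "card (cut E (V - Z)) = k"
      using crit_cut_ge[OF crit Z(1) nontriv] Z(4) card_cut_compl[OF simple Z(1)] by auto
    \<comment> \<open>A side with a single vertex has the degree of this vertex as its cut size, so
      a degree above \<open>k\<close> excludes it.\<close>
    have two: "2 \<le> card S" if S: "S \<subseteq> V" "x \<in> S" "k < card (nbrs E x)" "card (cut E S) = k" for S x
    proof (rule ccontr)
      assume "\<not> 2 \<le> card S"
      moreover have "finite S" using S(1) simple_on_finite(1)[OF simple] finite_subset by blast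
      ultimately have "S = {x}" using S(2) by (intro card_seteq[symmetric]) auto
      then show False using S(3,4) card_cut_singleton[OF simple] by simp
    qed
    have VZ: "V - (V - Z) = Z" using Z(1) by blast
    \<comment> \<open>Whichever side is the rainbow one, it contains \<open>p\<close> or
      \<open>q\<close> and bounds the degree of that vertex by \<open>k\<close>.\<close>
    from crit_cut_eq[OF crit Z(1) nontriv _ Z(4)] k
    consider "mono_cut k V E Z" | "mono_cut k V E (V - Z)" by auto
    then show False
    proof cases
      case 1
      have "card (nbrs E q) \<le> k"
        using low[OF Z(1) two[OF Z(1,2) p(2) cZ(1)] cZ(1) 1] q Z by blast
      then show False using q by simp
    next
      case 2
      have "card (nbrs E p) \<le> k"
        using low[OF _ two[OF _ _ q(3) cZ(2)] cZ(2) 2, of p] p q Z VZ by auto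
      then show False using p by simp
    qed
  qed
  then obtain v where v: "v \<in> V" "\<forall>x\<in>V - {v}. card (nbrs E x) \<le> k" by blast
  then show ?case
    using crit_one_high_vertex[OF crit k v(1) _ less.prems(4)] by blast
qed

section \<open>Menger's theorem for edge-disjoint paths\<close>

definition unit_flow :: "'a set set \<Rightarrow> ('a \<Rightarrow> 'a \<Rightarrow> int) \<Rightarrow> bool" where
  "unit_flow E f \<longleftrightarrow> (\<forall>x y. f y x = - f x y \<and> f x y \<le> 1 \<and> ({x, y} \<notin> E \<longrightarrow> f x y = 0))"

definition flow_support :: "('a \<Rightarrow> 'a \<Rightarrow> int) \<Rightarrow> 'a set set" where
  "flow_support f = {{x, y} | x y. f x y \<noteq> 0}"

definition net_out :: "'a set \<Rightarrow> ('a \<Rightarrow> 'a \<Rightarrow> int) \<Rightarrow> 'a \<Rightarrow> int" where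
  "net_out V f x = (\<Sum>y\<in>V. f x y)"

lemma unit_flowD:
  assumes "unit_flow E f"
  shows "f y x = - f x y" "f x y \<le> 1" "- 1 \<le> f x y" "{x, y} \<notin> E \<Longrightarrow> f x y = 0"
proof -
  show "f y x = - f x y" "f x y \<le> 1" "{x, y} \<notin> E \<Longrightarrow> f x y = 0"
    using assms unfolding unit_flow_def by blast+
  have "f x y = - f y x" "f y x \<le> 1" using assms unfolding unit_flow_def by blast+
  then show "- 1 \<le> f x y" by linarith
qed

lemma unit_flow_transpose: "unit_flow E f \<Longrightarrow> unit_flow E (\<lambda>x y. f y x)"
  unfolding unit_flow_def by (metis insert_commute)

lemma net_out_transpose:
  assumes "unit_flow E f"
  shows "net_out V (\<lambda>x y. f y x) x = - net_out V f x"
proof -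
  have "(\<Sum>y\<in>V. f y x) = (\<Sum>y\<in>V. - f x y)"
    by (rule sum.cong) (use unit_flowD(1)[OF assms] in blast)+
  then show ?thesis by (simp add: net_out_def sum_negf)
qed

text \<open>By antisymmetry the flow inside \<open>X\<close> cancels.\<close>

lemma sum_net_out:
  assumes f: "unit_flow E f" and V: "finite V" "X \<subseteq> V"
  shows "(\<Sum>x\<in>X. net_out V f x) = (\<Sum>x\<in>X. \<Sum>y\<in>V - X. f x y)"
proof -
  have fin: "finite X" using V finite_subset by blast
  have "(\<Sum>x\<in>X. \<Sum>y\<in>X. f x y) = (\<Sum>y\<in>X. \<Sum>x\<in>X. f x y)" by (rule sum.swap)
  also have "\<dots> = (\<Sum>y\<in>X. \<Sum>x\<in>X. - f y x)"
    by (intro sum.cong refl) (rule unit_flowD(1)[OF f])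
  also have "\<dots> = - (\<Sum>x\<in>X. \<Sum>y\<in>X. f x y)" by (simp add: sum_negf)
  finally have 0: "(\<Sum>x\<in>X. \<Sum>y\<in>X. f x y) = 0" by simp
  have "net_out V f x = (\<Sum>y\<in>V - X. f x y) + (\<Sum>y\<in>X. f x y)" for x
    unfolding net_out_def using V by (rule sum.subset_diff[rotated])
  then show ?thesis by (simp add: sum.distrib 0)
qed

section \<open>Paths as vertex lists and reachability\<close>

lemma path_edges_simps:
  "path_edges [] = {}" "path_edges [x] = {}"
  "path_edges (x # y # p) = insert {x, y} (path_edges (y # p))"
proof -
  show "path_edges (x # y # p) = insert {x, y} (path_edges (y # p))"
    unfolding path_edges_def
  proof (intro set_eqI iffI)
    fix e assume "e \<in> {{(x # y # p) ! i, (x # y # p) ! Suc i} | i. Suc i < length (x # y # p)}"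
    then obtain i where "e = {(x # y # p) ! i, (x # y # p) ! Suc i}" "Suc i < length (x # y # p)"
      by blast
    then show "e \<in> insert {x, y} {{(y # p) ! i, (y # p) ! Suc i} | i. Suc i < length (y # p)}"
      by (cases i) auto
  next
    fix e assume e: "e \<in> insert {x, y} {{(y # p) ! i, (y # p) ! Suc i} | i. Suc i < length (y # p)}"
    show "e \<in> {{(x # y # p) ! i, (x # y # p) ! Suc i} | i. Suc i < length (x # y # p)}"
    proof (cases "e = {x, y}")
      case True
      then show ?thesis by (intro CollectI exI[of _ 0]) auto
    next
      case False
      then obtain i where "e = {(y # p) ! i, (y # p) ! Suc i}" "Suc i < length (y # p)"
        using e by blast
      then show ?thesis by (intro CollectI exI[of _ "Suc i"]) auto
    qed
  qed
qed (auto simp: path_edges_def)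

lemma path_edges_subset_iff: "path_edges p \<subseteq> E \<longleftrightarrow> successively (\<lambda>x y. {x, y} \<in> E) p"
  by (induction p rule: induct_list012) (auto simp: path_edges_simps)

lemma path_edges_sub_set: "e \<in> path_edges p \<Longrightarrow> e \<subseteq> set p"
  by (induction p rule: induct_list012) (auto simp: path_edges_simps)

lemma walk_in_verts:
  assumes "simple_on V E" "p \<noteq> []" "hd p \<in> V" "successively (\<lambda>x y. {x, y} \<in> E) p"
  shows "set p \<subseteq> V"
  using assms(2-)
  by (induction p rule: induct_list012) (auto dest: simple_onD[OF assms(1)])

lemma reachable_in_verts:
  assumes "simple_on V E" "v \<in> V" "\<And>x y. (x, y) \<in> R \<Longrightarrow> {x, y} \<in> E"
  shows "{x. (v, x) \<in> R\<^sup>*} \<subseteq> V"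
proof
  fix x assume "x \<in> {x. (v, x) \<in> R\<^sup>*}"
  then have "(v, x) \<in> R\<^sup>*" by simp
  then show "x \<in> V"
    by (induction rule: rtrancl_induct) (use assms in \<open>auto dest: simple_onD\<close>)
qed

lemma rtrancl_distinct_path:
  assumes "(v, w) \<in> R\<^sup>*"
  obtains p where "p \<noteq> []" "hd p = v" "last p = w" "distinct p" "successively (\<lambda>x y. (x, y) \<in> R) p"
proof -
  have "\<exists>p. p \<noteq> [] \<and> hd p = v \<and> last p = w \<and> distinct p \<and> successively (\<lambda>x y. (x, y) \<in> R) p"
    using assms
  proof (induction rule: rtrancl_induct)
    case base
    then show ?case by (intro exI[of _ "[v]"]) auto
  next
    case (step y z)
    then obtain p where p: "p \<noteq> []" "hd p = v" "last p = y" "distinct p"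
      "successively (\<lambda>x y. (x, y) \<in> R) p" by blast
    show ?case
    proof (cases "z \<in> set p")
      case True
      then obtain p1 p2 where "p = p1 @ z # p2" by (meson split_list)
      then show ?thesis using p
        by (intro exI[of _ "p1 @ [z]"]) (auto simp: successively_append_iff hd_append)
    next
      case False
      then show ?thesis using p step(2)
        by (intro exI[of _ "p @ [z]"]) (auto simp: successively_append_iff)
    qed
  qed
  then show ?thesis using that by blast
qed

text \<open>Serves twice: it raises a flow along an augmenting path, and on the transposed flow it
  cancels a path all of whose edges carry one unit. The last two conclusions are what the cancelling
  needs.\<close>

lemma push_path:
  assumes "finite V" "unit_flow E f" "p \<noteq> []" "distinct p" "set p \<subseteq> V"
    and "successively (\<lambda>x y. {x, y} \<in> E \<and> f x y < 1) p"
  shows "\<exists>g. unit_flow E g \<and>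
    (\<forall>x. net_out V g x = net_out V f x + of_bool (x = hd p) - of_bool (x = last p)) \<and>
    (\<forall>x y. {x, y} \<notin> path_edges p \<longrightarrow> g x y = f x y) \<and> successively (\<lambda>x y. g x y = f x y + 1) p"
  using assms(3-)
proof (induction p rule: induct_list012)
  case (2 x)
  then show ?case using assms(2) by (intro exI[of _ f]) auto
next
  case (3 x y p)
  then obtain g where g: "unit_flow E g"
    "\<And>z. net_out V g z = net_out V f z + of_bool (z = y) - of_bool (z = last (y # p))"
    "\<And>a b. {a, b} \<notin> path_edges (y # p) \<Longrightarrow> g a b = f a b"
    "successively (\<lambda>x y. g x y = f x y + 1) (y # p)" by auto
  \<comment> \<open>Distinctness keeps the first edge off the rest of the path, so the two changes
    of the flow do not interfere.\<close>
  have new: "{x, y} \<notin> path_edges (y # p)" "x \<noteq> y"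
    using path_edges_sub_set[of "{x, y}" "y # p"] 3 by auto
  then have gxy: "g x y = f x y" "g y x = f y x" using g(3) by (auto simp: insert_commute)
  have fxy: "f x y < 1" "{x, y} \<in> E" "x \<in> V" "y \<in> V" using 3 by auto
  define h where "h a b = g a b + of_bool (a = x \<and> b = y) - of_bool (a = y \<and> b = x)" for a b
  have other: "h a b = g a b" if "{a, b} \<noteq> {x, y}" for a b
    using that by (auto simp: h_def)
  have hxy: "h x y = f x y + 1" "h y x = f y x - 1" using gxy new(2) by (auto simp: h_def)
  have "unit_flow E h"
    unfolding unit_flow_def
  proof (intro allI conjI impI)
    fix a b
    show "h b a = - h a b" using unit_flowD(1)[OF g(1), of b a] unfolding h_def by (simp only: conj_commute[of "b = x"] conj_commute[of "b = y"])
    show "h a b \<le> 1"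
    proof (cases "{a, b} = {x, y}")
      case True
      then show ?thesis using hxy fxy unit_flowD(2)[OF assms(2), of y x] by (auto simp: doubleton_eq_iff)
    next
      case False
      then show ?thesis using other unit_flowD(2)[OF g(1)] by simp
    qed
    assume "{a, b} \<notin> E"
    then show "h a b = 0" using other[of a b] fxy unit_flowD(4)[OF g(1)] by metis
  qed
  moreover have "net_out V h z = net_out V f z + of_bool (z = hd (x # y # p)) - of_bool (z = last (x # y # p))" for z
  proof -
    have "net_out V h z = net_out V g z + (\<Sum>b\<in>V. of_bool (z = x \<and> b = y)) - (\<Sum>b\<in>V. of_bool (z = y \<and> b = x))"
      by (simp add: net_out_def h_def sum.distrib sum_subtractf)
    moreover have "(\<Sum>b\<in>V. of_bool (z = x \<and> b = y)) = (of_bool (z = x) :: int)"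
      using fxy(4) assms(1) by (cases "z = x") (auto simp: of_bool_def sum.delta)
    moreover have "(\<Sum>b\<in>V. of_bool (z = y \<and> b = x)) = (of_bool (z = y) :: int)"
      using fxy(3) assms(1) by (cases "z = y") (auto simp: of_bool_def sum.delta)
    ultimately show ?thesis using g(2)[of z] by simp
  qed
  moreover have "h a b = f a b" if "{a, b} \<notin> path_edges (x # y # p)" for a b
    using that other[of a b] g(3)[of a b] by (auto simp: path_edges_simps)
  moreover have "successively (\<lambda>x y. h x y = f x y + 1) (y # p)"
  proof (rule successively_mono[OF g(4)])
    fix a b assume ab: "a \<in> set (y # p)" "b \<in> set (y # p)" "g a b = f a b + 1"
    then have "{a, b} \<noteq> {x, y}" using 3(4) by (auto simp: doubleton_eq_iff)
    then show "h a b = f a b + 1" using other ab by simp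
  qed
  then have "successively (\<lambda>x y. h x y = f x y + 1) (x # y # p)" using hxy by simp
  ultimately show ?case by blast
qed simp

text \<open>Augmenting paths. If \<open>w\<close> is not reachable in the residual graph, all edges
  leaving the reachable set are saturated; their number is then the current value of the flow, which
  is still below \<open>n\<close>.\<close>

lemma max_flow:
  assumes simple: "simple_on V E" and vw: "v \<in> V" "w \<in> V" "v \<noteq> w"
    and cuts: "\<And>Z. Z \<subseteq> V \<Longrightarrow> v \<in> Z \<Longrightarrow> w \<notin> Z \<Longrightarrow> n \<le> card (cut E Z)"
    and m: "m \<le> n"
  shows "\<exists>f. unit_flow E f \<and> net_out V f v = int m \<and> (\<forall>x. x \<noteq> v \<longrightarrow> x \<noteq> w \<longrightarrow> net_out V f x = 0)"
  using m
proof (induction m)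
  case 0
  have "unit_flow E (\<lambda>_ _. 0)" by (simp add: unit_flow_def)
  then show ?case by (intro exI[of _ "\<lambda>_ _. 0"]) (simp add: net_out_def)
next
  case (Suc m)
  note fin = simple_on_finite[OF simple]
  from Suc obtain f where f: "unit_flow E f" "net_out V f v = int m"
    "\<And>x. x \<noteq> v \<Longrightarrow> x \<noteq> w \<Longrightarrow> net_out V f x = 0" by auto
  define R where "R = {(x, y). {x, y} \<in> E \<and> f x y < 1}"
  define X where "X = {x. (v, x) \<in> R\<^sup>*}"
  have XV: "X \<subseteq> V"
    unfolding X_def by (rule reachable_in_verts[OF simple vw(1)]) (auto simp: R_def)
  have vX: "v \<in> X" by (simp add: X_def)
  have "w \<in> X"
  proof (rule ccontr)
    assume w: "w \<notin> X"
    have full: "f x y = of_bool ((x, y) \<in> cut E X)" if "x \<in> X" "y \<in> V - X" for x y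
    proof (cases "{x, y} \<in> E")
      case True
      have "(x, y) \<notin> R" using that unfolding X_def by (auto intro: rtrancl_into_rtrancl)
      then have "f x y = 1" using True unit_flowD(2)[OF f(1), of x y] by (auto simp: R_def)
      then show ?thesis using that True by (auto simp: cut_def)
    next
      case False
      then show ?thesis using unit_flowD(4)[OF f(1)] by (auto simp: cut_def)
    qed
    have zero: "net_out V f x = 0" if "x \<in> X - {v}" for x using f(3) w that by auto
    have "(\<Sum>x\<in>X. net_out V f x) = net_out V f v"
    proof -
      have "(\<Sum>x\<in>X. net_out V f x) = (\<Sum>x\<in>{v}. net_out V f x)"
        by (rule sum.mono_neutral_right) (use finite_subset[OF XV fin(1)] vX zero in auto)
      then show ?thesis by simp
    qed
    then have "int m = (\<Sum>x\<in>X. \<Sum>y\<in>V - X. f x y)"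
      using sum_net_out[OF f(1) fin(1) XV] f(2) by simp
    also have "\<dots> = (\<Sum>x\<in>X. \<Sum>y\<in>V - X. of_bool ((x, y) \<in> cut E X))"
      by (intro sum.cong refl full)
    also have "\<dots> = (\<Sum>p\<in>X \<times> (V - X). of_bool (p \<in> cut E X))"
      by (simp add: sum.cartesian_product)
    also have "\<dots> = int (card (cut E X))"
    proof -
      have "cut E X \<subseteq> X \<times> (V - X)" by (auto simp: cut_def dest: simple_onD[OF simple])
      then have "X \<times> (V - X) \<inter> cut E X = cut E X" by blast
      moreover have "finite (X \<times> (V - X))" using fin XV finite_subset by blast
      ultimately show ?thesis by (simp add: of_bool_def sum.If_cases)
    qed
    finally have "card (cut E X) = m" by simp
    then show False using cuts[OF XV vX w] Suc.prems by simp
  qed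
  then obtain p where p: "p \<noteq> []" "hd p = v" "last p = w" "distinct p" "successively (\<lambda>x y. (x, y) \<in> R) p"
    using rtrancl_distinct_path[of v w R] by (auto simp: X_def)
  have "successively (\<lambda>x y. {x, y} \<in> E) p"
    by (rule successively_mono[OF p(5)]) (simp add: R_def)
  then have "set p \<subseteq> V" using walk_in_verts[OF simple p(1)] p(2) vw by simp
  moreover have "successively (\<lambda>x y. {x, y} \<in> E \<and> f x y < 1) p" using p(5) by (simp add: R_def)
  ultimately obtain g where "unit_flow E g"
    "\<And>x. net_out V g x = net_out V f x + of_bool (x = hd p) - of_bool (x = last p)"
    using push_path[OF fin(1) f(1) p(1,4)] by blast
  then show ?case using f p(2,3) vw(3) by (intro exI[of _ g]) auto
qed

text \<open>A path along edges of value 1 is cancelled, which removes its edges from the support of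
  the remaining flow. As all paths are required to run inside the support, those found later are
  edge-disjoint from it.\<close>

lemma flow_decomposition:
  assumes simple: "simple_on V E" and vw: "v \<in> V" "w \<in> V" "v \<noteq> w"
    and "unit_flow E f" "net_out V f v = int m" "\<And>x. x \<noteq> v \<Longrightarrow> x \<noteq> w \<Longrightarrow> net_out V f x = 0"
  shows "\<exists>P. finite P \<and> card P = m \<and> pairwise (\<lambda>p q. path_edges p \<inter> path_edges q = {}) P \<and>
    (\<forall>p\<in>P. is_path \<lparr>verts = V, edges = flow_support f\<rparr> v p w)"
  using assms(5-)
proof (induction m arbitrary: f)
  case 0
  then show ?case by (intro exI[of _ "{}"]) auto
next
  case (Suc m)
  note fin = simple_on_finite[OF simple] and f = Suc.prems
  define R where "R = {(x, y). {x, y} \<in> E \<and> f x y = 1}"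
  define X where "X = {x. (v, x) \<in> R\<^sup>*}"
  have XV: "X \<subseteq> V"
    unfolding X_def by (rule reachable_in_verts[OF simple vw(1)]) (auto simp: R_def)
  have vX: "v \<in> X" by (simp add: X_def)
  have "w \<in> X"
  proof (rule ccontr)
    assume w: "w \<notin> X"
    have none: "f x y \<le> 0" if "x \<in> X" "y \<in> V - X" for x y
    proof -
      have "(x, y) \<notin> R" using that unfolding X_def by (auto intro: rtrancl_into_rtrancl)
      then have "f x y \<noteq> 1" using unit_flowD(4)[OF f(1), of x y] by (auto simp: R_def)
      then show ?thesis using unit_flowD(2)[OF f(1), of x y] by simp
    qed
    have zero: "net_out V f x = 0" if "x \<in> X - {v}" for x using f(3) w that by auto
    have "(\<Sum>x\<in>X. net_out V f x) = (\<Sum>x\<in>{v}. net_out V f x)"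
      by (rule sum.mono_neutral_right) (use finite_subset[OF XV fin(1)] vX zero in auto)
    then have "int (Suc m) = (\<Sum>x\<in>X. \<Sum>y\<in>V - X. f x y)"
      using sum_net_out[OF f(1) fin(1) XV] f(2) by simp
    also have "\<dots> \<le> 0" by (intro sum_nonpos none)
    finally show False by simp
  qed
  then obtain p where p: "p \<noteq> []" "hd p = v" "last p = w" "distinct p" "successively (\<lambda>x y. (x, y) \<in> R) p"
    using rtrancl_distinct_path[of v w R] by (auto simp: X_def)
  have "successively (\<lambda>x y. {x, y} \<in> E) p"
    by (rule successively_mono[OF p(5)]) (simp add: R_def)
  then have pV: "set p \<subseteq> V" using walk_in_verts[OF simple p(1)] p(2) vw by simp
  \<comment> \<open>Cancelling along \<open>p\<close> is pushing along \<open>p\<close> in the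
    transposed flow, where the edges of \<open>p\<close> go from value -1 to 0.\<close>
  let ?f' = "\<lambda>x y. f y x"
  have neg: "successively (\<lambda>x y. {x, y} \<in> E \<and> ?f' x y < 1) p"
  proof (rule successively_mono[OF p(5)])
    fix x y assume "(x, y) \<in> R"
    then show "{x, y} \<in> E \<and> f y x < 1" using unit_flowD(1)[OF f(1), of y x] by (simp add: R_def)
  qed
  obtain g' where g': "unit_flow E g'"
    "\<And>x. net_out V g' x = net_out V ?f' x + of_bool (x = hd p) - of_bool (x = last p)"
    "\<And>x y. {x, y} \<notin> path_edges p \<Longrightarrow> g' x y = f y x" "successively (\<lambda>x y. g' x y = f y x + 1) p"
    using push_path[OF fin(1) unit_flow_transpose[OF f(1)] p(1,4) pV neg] by blast
  define g where "g = (\<lambda>x y. g' y x)"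
  have g: "unit_flow E g" unfolding g_def by (rule unit_flow_transpose[OF g'(1)])
  have "net_out V g x = net_out V f x - of_bool (x = v) + of_bool (x = w)" for x
    using g'(2)[of x] net_out_transpose[OF g'(1), of V x] net_out_transpose[OF f(1), of V x] p(2,3)
    by (simp add: g_def)
  then have "net_out V g v = int m" "\<And>x. x \<noteq> v \<Longrightarrow> x \<noteq> w \<Longrightarrow> net_out V g x = 0"
    using f vw(3) by auto
  then obtain P where P: "finite P" "card P = m" "pairwise (\<lambda>p q. path_edges p \<inter> path_edges q = {}) P"
    "\<And>p. p \<in> P \<Longrightarrow> is_path \<lparr>verts = V, edges = flow_support g\<rparr> v p w"
    using Suc.IH[OF g] by metis
  have "successively (\<lambda>x y. {x, y} \<in> {{x, y} | x y. g' x y = 0}) p"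
  proof -
    have "successively (\<lambda>x y. g' x y = f y x + 1 \<and> (x, y) \<in> R) p"
      using g'(4) p(5) by (simp add: successively_conv_nth)
    then show ?thesis
    proof (rule successively_mono)
      fix x y assume "g' x y = f y x + 1 \<and> (x, y) \<in> R"
      then have "g' x y = 0" using unit_flowD(1)[OF f(1), of y x] by (simp add: R_def)
      then show "{x, y} \<in> {{x, y} | x y. g' x y = 0}" by blast
    qed
  qed
  then have zero: "path_edges p \<subseteq> {{x, y} | x y. g' x y = 0}" unfolding path_edges_subset_iff .
  have supp: "e \<in> flow_support f" "e \<notin> path_edges p" if "e \<in> flow_support g" for e
  proof -
    obtain x y where e: "e = {x, y}" "g' y x \<noteq> 0" using \<open>e \<in> _\<close> by (auto simp: g_def flow_support_def)
    have "g' x y \<noteq> 0" using e(2) unit_flowD(1)[OF g'(1), of x y] by simp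
    show "e \<notin> path_edges p"
    proof
      assume "e \<in> path_edges p"
      then obtain a b where "{x, y} = {a, b}" "g' a b = 0" using zero e by blast
      then show False using e(2) \<open>g' x y \<noteq> 0\<close> by (auto simp: doubleton_eq_iff)
    qed
    then have "g' y x = f x y" using g'(3)[of y x] e(1) by (simp add: insert_commute)
    then show "e \<in> flow_support f" using e by (auto simp: flow_support_def)
  qed
  have "successively (\<lambda>x y. {x, y} \<in> flow_support f) p"
  proof (rule successively_mono[OF p(5)])
    fix x y assume "(x, y) \<in> R"
    then have "f x y \<noteq> 0" by (simp add: R_def)
    then show "{x, y} \<in> flow_support f" by (auto simp: flow_support_def)
  qed
  then have psupp: "path_edges p \<subseteq> flow_support f" unfolding path_edges_subset_iff .
  \<comment> \<open>An edgeless path would be disjoint from itself and might already belong to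
    \<open>P\<close>.\<close>
  have "path_edges p \<noteq> {}"
    using p vw(3) by (cases p; cases "tl p") (auto simp: path_edges_simps)
  moreover have disj: "path_edges p \<inter> path_edges q = {}" if "q \<in> P" for q
    using P(4)[OF that] supp(2) by (auto simp: is_path_def)
  ultimately have "p \<notin> P" by blast
  show ?case
  proof (intro exI[of _ "insert p P"] conjI ballI)
    show "finite (insert p P)" "card (insert p P) = Suc m" using P \<open>p \<notin> P\<close> by auto
    show "pairwise (\<lambda>p q. path_edges p \<inter> path_edges q = {}) (insert p P)"
      using P(3) disj by (auto simp: pairwise_insert)
    fix q assume q: "q \<in> insert p P"
    show "is_path \<lparr>verts = V, edges = flow_support f\<rparr> v q w"
    proof (cases "q = p")
      case True
      then show ?thesis using p pV psupp by (simp add: is_path_def)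
    next
      case False
      then have "is_path \<lparr>verts = V, edges = flow_support g\<rparr> v q w" using q P(4) by blast
      then show ?thesis using supp(1) by (auto simp: is_path_def)
    qed
  qed
qed

lemma path_crosses_cut:
  assumes "p \<noteq> []" "hd p \<in> Z" "last p \<notin> Z"
  shows "\<exists>x y. x \<in> Z \<and> y \<notin> Z \<and> {x, y} \<in> path_edges p"
  using assms
proof (induction p rule: induct_list012)
  case (3 x y p)
  show ?case
  proof (cases "y \<in> Z")
    case True
    then show ?thesis using 3 by (auto simp: path_edges_simps)
  next
    case False
    then show ?thesis using 3 by (auto simp: path_edges_simps)
  qed
qed auto

text \<open>Menger's theorem, with upper bounds in place of \<open>Max\<close>: if all cuts have
  more than \<open>k\<close> edges, a flow of value \<open>k + 1\<close> decomposes into as many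
  paths; conversely edge-disjoint paths cross a cut in different edges.\<close>

theorem local_edge_conn_le_iff:
  assumes simple: "simple_graph G" and vw: "v \<in> verts G" "w \<in> verts G" "v \<noteq> w"
  shows "local_edge_conn G v w \<le> k \<longleftrightarrow>
    (\<exists>Z\<subseteq>verts G. v \<in> Z \<and> w \<notin> Z \<and> card (cut (edges G) Z) \<le> k)"
proof -
  let ?V = "verts G" and ?E = "edges G"
  have s: "simple_on ?V ?E" using simple by (simp add: simple_graph_def simple_on_def)
  note fin = simple_on_finite[OF s]
  define S where "S = {card P | P. (\<forall>p\<in>P. is_path G v p w) \<and>
    pairwise (\<lambda>p q. path_edges p \<inter> path_edges q = {}) P}"
  \<comment> \<open>\<open>Max\<close> is meaningful only on a finite nonempty set: there are
    finitely many distinct lists over the vertices, and the empty family contributes 0.\<close>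
  have "finite {p. set p \<subseteq> ?V \<and> length p \<le> card ?V}" by (rule finite_lists_length_le[OF fin(1)])
  moreover have paths: "{p. is_path G v p w} \<subseteq> {p. set p \<subseteq> ?V \<and> length p \<le> card ?V}"
    using fin(1) by (auto simp: is_path_def distinct_card[symmetric] intro: card_mono)
  ultimately have finp: "finite {p. is_path G v p w}" by (rule finite_subset[rotated])
  have "S \<subseteq> {..card {p. is_path G v p w}}"
    using card_mono[OF finp] by (auto simp: S_def)
  then have finS: "finite S" using finite_subset by blast
  have "0 \<in> S" unfolding S_def by (intro CollectI exI[of _ "{}"]) auto
  then have "local_edge_conn G v w \<le> k \<longleftrightarrow> (\<forall>n\<in>S. n \<le> k)"
    unfolding local_edge_conn_def S_def[symmetric] using Max_le_iff[OF finS] by blast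
  also have "\<dots> \<longleftrightarrow> (\<exists>Z\<subseteq>?V. v \<in> Z \<and> w \<notin> Z \<and> card (cut ?E Z) \<le> k)"
  proof
    assume small: "\<forall>n\<in>S. n \<le> k"
    show "\<exists>Z\<subseteq>?V. v \<in> Z \<and> w \<notin> Z \<and> card (cut ?E Z) \<le> k"
    proof (rule ccontr)
      assume "\<not> ?thesis"
      then have cuts: "Suc k \<le> card (cut ?E Z)" if "Z \<subseteq> ?V" "v \<in> Z" "w \<notin> Z" for Z
        using that by (meson not_less_eq_eq)
      obtain f where f: "unit_flow ?E f" "net_out ?V f v = int (Suc k)"
        "\<And>x. x \<noteq> v \<Longrightarrow> x \<noteq> w \<Longrightarrow> net_out ?V f x = 0"
        using max_flow[OF s vw cuts order_refl] by blast
      obtain P where P: "card P = Suc k" "pairwise (\<lambda>p q. path_edges p \<inter> path_edges q = {}) P"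
        "\<And>p. p \<in> P \<Longrightarrow> is_path \<lparr>verts = ?V, edges = flow_support f\<rparr> v p w"
        using flow_decomposition[OF s vw f] by metis
      have "flow_support f \<subseteq> ?E" using unit_flowD(4)[OF f(1)] by (auto simp: flow_support_def)
      then have "\<forall>p\<in>P. is_path G v p w" using P(3) by (auto simp: is_path_def)
      then have "Suc k \<in> S" using P(1,2) unfolding S_def by (intro CollectI exI[of _ P]) simp
      then show False using small by auto
    qed
  next
    assume "\<exists>Z\<subseteq>?V. v \<in> Z \<and> w \<notin> Z \<and> card (cut ?E Z) \<le> k"
    then obtain Z where Z: "v \<in> Z" "w \<notin> Z" "card (cut ?E Z) \<le> k" by blast
    show "\<forall>n\<in>S. n \<le> k"
    proof
      fix n assume "n \<in> S"
      then obtain P where P: "n = card P" "\<forall>p\<in>P. is_path G v p w"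
        "pairwise (\<lambda>p q. path_edges p \<inter> path_edges q = {}) P"
        by (auto simp: S_def)
      have "\<exists>s. s \<in> cut ?E Z \<and> {fst s, snd s} \<in> path_edges p" if "p \<in> P" for p
      proof -
        have p: "p \<noteq> []" "hd p = v" "last p = w" "path_edges p \<subseteq> ?E"
          using P(2) that by (auto simp: is_path_def)
        then obtain x y where "x \<in> Z" "y \<notin> Z" "{x, y} \<in> path_edges p"
          using path_crosses_cut[of p Z] Z by auto
        then show ?thesis using p(4) by (intro exI[of _ "(x, y)"]) (auto simp: cut_def)
      qed
      then obtain h where h: "\<And>p. p \<in> P \<Longrightarrow> h p \<in> cut ?E Z"
        "\<And>p. p \<in> P \<Longrightarrow> {fst (h p), snd (h p)} \<in> path_edges p" by metis
      have "inj_on h P"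
      proof (rule inj_onI, rule ccontr)
        fix p q assume pq: "p \<in> P" "q \<in> P" "h p = h q" "p \<noteq> q"
        then have "path_edges p \<inter> path_edges q = {}" using P(3) by (auto simp: pairwise_def)
        then show False using h(2)[OF pq(1)] h(2)[OF pq(2)] pq(3) by auto
      qed
      then have "card P \<le> card (cut ?E Z)" using h(1) fin(3) by (intro card_inj_on_le) auto
      then show "n \<le> k" using P(1) Z(3) by simp
    qed
  qed
  finally show ?thesis .
qed

theorem max_local_edge_conn_le_iff:
  assumes simple: "simple_graph G"
  shows "max_local_edge_conn G \<le> k \<longleftrightarrow> cut_bounded k (verts G) (edges G)"
proof -
  have fin: "finite (verts G)" using simple by (simp add: simple_graph_def)
  show ?thesis
  proof (cases "card (verts G) \<ge> 2")
    case True
    let ?S = "{local_edge_conn G v w | v w. v \<in> verts G \<and> w \<in> verts G \<and> v \<noteq> w}"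
    have "?S \<subseteq> (\<lambda>(v, w). local_edge_conn G v w) ` (verts G \<times> verts G)" by auto
    then have finS: "finite ?S" using fin by (meson finite_SigmaI finite_imageI finite_subset)
    obtain v w where "v \<in> verts G" "w \<in> verts G" "v \<noteq> w"
      using True fin by (metis card_le_Suc0_iff_eq not_less_eq_eq numeral_2_eq_2)
    then have "?S \<noteq> {}" by blast
    then have "max_local_edge_conn G \<le> k \<longleftrightarrow> (\<forall>n\<in>?S. n \<le> k)"
      using True finS by (simp add: max_local_edge_conn_def)
    also have "\<dots> \<longleftrightarrow> (\<forall>v\<in>verts G. \<forall>w\<in>verts G. v \<noteq> w \<longrightarrow> local_edge_conn G v w \<le> k)" by blast
    also have "\<dots> \<longleftrightarrow> cut_bounded k (verts G) (edges G)"
      unfolding cut_bounded_def by (intro ball_cong refl) (use local_edge_conn_le_iff[OF simple] in metis)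
    finally show ?thesis .
  next
    case False
    then have "card (verts G) \<le> Suc 0" by simp
    then have "cut_bounded k (verts G) (edges G)"
      unfolding cut_bounded_def using card_le_Suc0_iff_eq[OF fin] by blast
    then show ?thesis using False by (simp add: max_local_edge_conn_def)
  qed
qed

section \<open>The class C and the basic graphs\<close>

lemma simple_graph_iff: "simple_graph G \<longleftrightarrow> simple_on (verts G) (edges G)"
  by (simp add: simple_graph_def simple_on_def)

lemma proper_coloring_iff:
  assumes "simple_graph G"
  shows "proper_coloring G n c \<longleftrightarrow> colors (edges G) (verts G) n c"
  using simple_onD(1,2)[OF assms[unfolded simple_graph_iff]]
  unfolding proper_coloring_def colors_def by blast

lemma chromatic_number_le_iff:
  assumes "simple_graph G"
  shows "chromatic_number G \<le> n \<longleftrightarrow> (\<exists>c. colors (edges G) (verts G) n c)"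
proof
  \<comment> \<open>An injective colouring shows that the set under \<open>LEAST\<close> is not
    empty.\<close>
  have "finite (verts G)" using assms by (simp add: simple_graph_def)
  then obtain h :: "'a \<Rightarrow> nat" where h: "bij_betw h (verts G) {0..<card (verts G)}"
    using ex_bij_betw_finite_nat by blast
  have "h x < card (verts G)" if "x \<in> verts G" for x
    using h that by (auto simp: bij_betw_def)
  moreover have "h x \<noteq> h y" if "x \<in> verts G" "y \<in> verts G" "{x, y} \<in> edges G" for x y
    using h that simple_onD(3)[OF assms[unfolded simple_graph_iff] that(3)]
    by (meson bij_betw_imp_inj_on inj_onD)
  ultimately have "colors (edges G) (verts G) (card (verts G)) h"
    unfolding colors_def by blast
  then have "\<exists>n c. proper_coloring G n c" using proper_coloring_iff[OF assms] by blast
  then have least: "\<exists>c. proper_coloring G (chromatic_number G) c"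
    unfolding chromatic_number_def by (rule LeastI_ex)
  assume "chromatic_number G \<le> n"
  then show "\<exists>c. colors (edges G) (verts G) n c"
    using least proper_coloring_iff[OF assms] colors_mono by (metis Int_lower1 order_refl)
next
  assume "\<exists>c. colors (edges G) (verts G) n c"
  then show "chromatic_number G \<le> n"
    unfolding chromatic_number_def using proper_coloring_iff[OF assms] by (metis Least_le)
qed

lemma crit_verts_nonempty: "crit k V E \<Longrightarrow> V \<noteq> {}"
  using crit_not_colors by (fastforce simp: colors_def)

text \<open>A proper subgraph misses a vertex or an edge, and these are the two deletions in
  \<open>crit\<close>. Adding back one vertex with the new colour \<open>k\<close> gives the upper
  bound \<open>k + 1\<close>.\<close>

lemma crit_iff: "crit k (verts G) (edges G) \<longleftrightarrow> critical G \<and> chromatic_number G = k + 1"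
proof
  assume crit: "crit k (verts G) (edges G)"
  then have simple: "simple_graph G" by (simp add: crit_simple simple_graph_iff)
  have low: "chromatic_number H \<le> k" if H: "subgraph H G" "H \<noteq> G" for H
  proof -
    have sub: "simple_graph H" "verts H \<subseteq> verts G" "edges H \<subseteq> edges G"
      using H(1) by (auto simp: subgraph_def)
    have "\<exists>c. colors (edges H) (verts H) k c"
    proof (cases "verts H = verts G")
      case False
      then obtain c where "colors (edges G) (verts H) k c"
        using crit_colors_subset[OF crit sub(2)] by blast
      then show ?thesis using sub(3) colors_mono by (metis inf.coboundedI1 order_refl)
    next
      case True
      then have "edges H \<noteq> edges G" using H(2) by (metis (full_types) old.unit.exhaust ugraph.equality)
      then obtain e where e: "e \<in> edges G" "e \<notin> edges H" using sub(3) by blast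
      then obtain c where c: "colors (edges G - {e}) (verts G) k c"
        using crit_colors_del[OF crit] by blast
      have "colors (edges H) (verts H) k c"
        by (rule colors_mono[OF c]) (use e sub True in auto)
      then show ?thesis by blast
    qed
    then show ?thesis using chromatic_number_le_iff[OF sub(1)] by blast
  qed
  have high: "\<not> chromatic_number G \<le> k"
    using chromatic_number_le_iff[OF simple] crit_not_colors[OF crit] by blast
  obtain x where x: "x \<in> verts G" using crit_verts_nonempty[OF crit] by blast
  obtain c where c: "colors (edges G) (verts G - {x}) k c"
    using crit_colors_subset[OF crit, of "verts G - {x}"] x by blast
  have "colors (edges G) (verts G) (k + 1) (c(x := k))"
    using colors_new_color[OF crit_simple[OF crit] c] by simp
  then have "chromatic_number G \<le> k + 1" using chromatic_number_le_iff[OF simple] by blast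
  then have "chromatic_number G = k + 1" using high by simp
  then show "critical G \<and> chromatic_number G = k + 1"
    using low simple by (auto simp: critical_def less_Suc_eq_le)
next
  assume G: "critical G \<and> chromatic_number G = k + 1"
  then have simple: "simple_graph G" by (simp add: critical_def)
  have sub: "\<exists>c. colors (edges H) (verts H) k c" if "subgraph H G" "H \<noteq> G" for H
  proof -
    have "chromatic_number H \<le> k" using G that by (auto simp: critical_def)
    moreover have "simple_graph H" using that by (simp add: subgraph_def)
    ultimately show ?thesis using chromatic_number_le_iff by blast
  qed
  show "crit k (verts G) (edges G)"
    unfolding crit_def
  proof (intro conjI ballI allI impI)
    show "simple_on (verts G) (edges G)" using simple by (simp add: simple_graph_iff)
    have "\<not> chromatic_number G \<le> k" using G by simp
    then show "\<nexists>c. colors (edges G) (verts G) k c" using chromatic_number_le_iff[OF simple] by blast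
    show "\<exists>c. colors (edges G - {e}) (verts G) k c" if "e \<in> edges G" for e
    proof -
      let ?H = "\<lparr>verts = verts G, edges = edges G - {e}\<rparr>"
      have "subgraph ?H G" using simple by (auto simp: subgraph_def simple_graph_def)
      moreover have "?H \<noteq> G" using that by (metis Diff_iff singletonI ugraph.select_convs(2))
      ultimately show ?thesis using sub[of ?H] by simp
    qed
    show "\<exists>c. colors (edges G) X k c" if "X \<subset> verts G" for X
    proof -
      let ?H = "\<lparr>verts = X, edges = {e \<in> edges G. e \<subseteq> X}\<rparr>"
      have "finite X" using that simple by (meson finite_subset psubset_imp_subset simple_graph_def)
      then have "subgraph ?H G" using simple that by (auto simp: subgraph_def simple_graph_def)
      moreover have "?H \<noteq> G" using that by (metis psubset_imp_subset less_irrefl ugraph.select_convs(1))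
      ultimately obtain c where c: "colors {e \<in> edges G. e \<subseteq> X} X k c" using sub[of ?H] by auto
      have "colors (edges G) X k c" by (rule colors_mono[OF c]) auto
      then show ?thesis by blast
    qed
  qed
qed

theorem class_C_iff:
  "G \<in> class_C k \<longleftrightarrow> crit k (verts G) (edges G) \<and> cut_bounded k (verts G) (edges G)"
  using max_local_edge_conn_le_iff[of G k] crit_iff[of k G] crit_simple[of k "verts G" "edges G"]
  by (auto simp: class_C_def simple_graph_iff)

text \<open>One vertex \<open>h\<close> of large degree is allowed, with the hub of a wheel in view:
  of any two vertices at least one is not \<open>h\<close>, and it forms a side by itself.\<close>

lemma cut_bounded_degree:
  assumes simple: "simple_on V E" and deg: "\<And>p. p \<in> V \<Longrightarrow> p \<noteq> h \<Longrightarrow> card (nbrs E p) \<le> k"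
  shows "cut_bounded k V E"
  unfolding cut_bounded_iff[OF simple]
proof (intro ballI impI)
  fix p q assume pq: "p \<in> V" "q \<in> V" "p \<noteq> q"
  then obtain r where r: "r \<in> {p, q}" "r \<noteq> h" by blast
  then have "card (cut E {r}) \<le> k" using deg pq card_cut_singleton[OF simple] by auto
  then show "\<exists>Z\<subseteq>V. (p \<in> Z \<longleftrightarrow> q \<notin> Z) \<and> card (cut E Z) \<le> k"
    using r pq by (intro exI[of _ "{r}"]) auto
qed

lemma complete_graph_iff:
  "complete_graph n G \<longleftrightarrow> finite (verts G) \<and> card (verts G) = n \<and> edges G = clique (verts G)"
  by (simp add: complete_graph_def clique_def)

lemma clique_simple: "finite V \<Longrightarrow> simple_on V (clique V)"
  by (auto simp: simple_on_def clique_def)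

lemma clique_crit:
  assumes V: "finite V" "card V = k + 1" and k: "1 \<le> k"
  shows "crit k V (clique V)"
proof (rule critI)
  show "simple_on V (clique V)" using V(1) by (rule clique_simple)
  show "\<not> colors (clique V) V k c" for c
  proof
    assume c: "colors (clique V) V k c"
    then have "inj_on c V" unfolding inj_on_def colors_def clique_iff by blast
    moreover have "c ` V \<subseteq> {..<k}" using c by (auto simp: colors_def)
    ultimately have "card V \<le> card {..<k}" by (intro card_inj_on_le) auto
    then show False using V by simp
  qed
  show "\<exists>c. colors (clique V - {e}) V k c" if "e \<in> clique V" for e
  proof -
    obtain s t where st: "e = {s, t}" "s \<in> V" "t \<in> V" "s \<noteq> t" using \<open>e \<in> _\<close> by (auto simp: clique_def)
    have "card (V - {t}) = card {..<k}" using V st by simp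
    then obtain h where h: "bij_betw h (V - {t}) {..<k}"
      using finite_same_card_bij V by (metis finite_Diff finite_lessThan)
    define g where "g = h(t := h s)"
    have "g x < k" if "x \<in> V" for x
    proof -
      have "g x \<in> h ` (V - {t})" using that st by (auto simp: g_def)
      then show ?thesis using h by (auto simp: bij_betw_def)
    qed
    moreover have "g x \<noteq> g y" if xy: "x \<in> V" "y \<in> V" "{x, y} \<in> clique V - {e}" for x y
    proof -
      have "x \<noteq> y" "{x, y} \<noteq> {s, t}" using xy(3) st(1) by (auto simp: clique_iff)
      moreover have "inj_on h (V - {t})" using h by (simp add: bij_betw_def)
      moreover have "x = t \<Longrightarrow> y \<noteq> s" "y = t \<Longrightarrow> x \<noteq> s" using \<open>{x, y} \<noteq> {s, t}\<close> by auto
      ultimately show ?thesis using xy(1,2) st by (auto simp: g_def inj_on_eq_iff)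
    qed
    ultimately have "colors (clique V - {e}) V k g" unfolding colors_def by blast
    then show ?thesis by blast
  qed
  fix x assume x: "x \<in> V"
  have "V - {x} \<noteq> {}"
  proof
    assume "V - {x} = {}"
    then have "V = {x}" using x by blast
    then show False using V k by simp
  qed
  then obtain y where "y \<in> V" "y \<noteq> x" by blast
  then show "\<exists>y. {x, y} \<in> clique V" using x by (auto simp: clique_iff)
qed

lemma clique_cut_bounded:
  assumes "finite V" "card V = k + 1"
  shows "cut_bounded k V (clique V)"
proof (rule cut_bounded_degree[OF clique_simple[OF assms(1)]])
  fix p assume "p \<in> V"
  then have "nbrs (clique V) p = V - {p}" by (auto simp: nbrs_def clique_iff)
  then show "card (nbrs (clique V) p) \<le> k" using assms \<open>p \<in> V\<close> by simp
qed

section \<open>Odd cycles and odd wheels\<close>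

definition cycle_edges :: "'a list \<Rightarrow> 'a set set" where
  "cycle_edges vs = {{vs ! i, vs ! (Suc i mod length vs)} | i. i < length vs}"

lemma odd_cycle_iff:
  "odd_cycle G \<longleftrightarrow> (\<exists>vs. distinct vs \<and> 3 \<le> length vs \<and> odd (length vs) \<and> verts G = set vs \<and>
     edges G = cycle_edges vs)"
  by (auto simp: odd_cycle_def cycle_edges_def)

lemma alternating_colors:
  assumes "\<And>i. Suc i < n \<Longrightarrow> c (Suc i) \<noteq> c i" "\<And>i. i < n \<Longrightarrow> c i < (2::nat)" "i < n"
  shows "c i = (c 0 + i) mod 2"
  using assms(3)
proof (induction i)
  case 0
  then show ?case using assms(2)[of 0] by simp
next
  case (Suc i)
  then have "c i = (c 0 + i) mod 2" "c (Suc i) \<noteq> c i" "c (Suc i) < 2"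
    using assms(1)[of i] assms(2)[of "Suc i"] by auto
  then show ?case by presburger
qed

lemma Suc_mod_less: "i < n \<Longrightarrow> Suc i mod n < n"
  by (rule mod_less_divisor) simp

lemma add_mod_2_eq_iff: "c < 2 \<Longrightarrow> (c + m) mod 2 = c \<longleftrightarrow> even (m :: nat)"
  by presburger

text \<open>Colours alternate along the list, so the first and the last of an odd number of vertices
  agree although the closing edge joins them.\<close>

lemma odd_cycle_not_2_colorable:
  assumes "odd (length vs)" "3 \<le> length vs"
  shows "\<not> colors (cycle_edges vs) (set vs) 2 c"
proof
  assume c: "colors (cycle_edges vs) (set vs) 2 c"
  let ?n = "length vs"
  have edge: "c (vs ! i) \<noteq> c (vs ! (Suc i mod ?n))" if "i < ?n" for i
  proof -
    have "{vs ! i, vs ! (Suc i mod ?n)} \<in> cycle_edges vs" using that by (auto simp: cycle_edges_def)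
    moreover have "Suc i mod ?n < ?n" using that by (rule Suc_mod_less)
    ultimately show ?thesis using colorsD(2)[OF c] that by simp
  qed
  have "c (vs ! Suc i) \<noteq> c (vs ! i)" if "Suc i < ?n" for i
    using edge[of i] that by simp
  then have "c (vs ! (?n - 1)) = (c (vs ! 0) + (?n - 1)) mod 2"
    using c assms(2) by (intro alternating_colors[of ?n "\<lambda>i. c (vs ! i)"]) (auto simp: colors_def)
  moreover have "vs ! 0 \<in> set vs" using assms(2) by (intro nth_mem) auto
  then have "c (vs ! 0) < 2" using c by (auto simp: colors_def)
  moreover have "even (?n - 1)" using assms by simp
  ultimately have "c (vs ! (?n - 1)) = c (vs ! 0)" using add_mod_2_eq_iff by simp
  moreover have "Suc (?n - 1) = ?n" "?n - 1 < ?n" using assms(2) by auto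
  ultimately show False using edge[of "?n - 1"] by (metis mod_self)
qed

lemma cycle_simple:
  assumes "distinct vs" "3 \<le> length vs"
  shows "simple_on (set vs) (cycle_edges vs)"
proof -
  have "vs ! i \<noteq> vs ! (Suc i mod length vs)" if "i < length vs" for i
  proof -
    have "i \<noteq> Suc i mod length vs" using that assms(2) by (cases "Suc i = length vs") auto
    moreover have "Suc i mod length vs < length vs" using that by (rule Suc_mod_less)
    ultimately show ?thesis using nth_eq_iff_index_eq[OF assms(1)] that by blast
  qed
  moreover have "vs ! (Suc i mod length vs) \<in> set vs" if "i < length vs" for i
    using Suc_mod_less[OF that] by simp
  ultimately show ?thesis by (auto simp: simple_on_def cycle_edges_def card_2_iff)
qed

lemma cycle_degree:
  assumes "distinct vs" "x \<in> set vs"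
  shows "card (nbrs (cycle_edges vs) x) \<le> 2"
proof -
  let ?n = "length vs"
  obtain i where i: "i < ?n" "x = vs ! i" using assms(2) by (metis in_set_conv_nth)
  have "nbrs (cycle_edges vs) x \<subseteq> {vs ! (Suc i mod ?n), vs ! ((i + ?n - 1) mod ?n)}"
  proof
    fix y assume "y \<in> nbrs (cycle_edges vs) x"
    then obtain j where j: "j < ?n" "{x, y} = {vs ! j, vs ! (Suc j mod ?n)}"
      by (auto simp: nbrs_def cycle_edges_def)
    then consider "x = vs ! j" "y = vs ! (Suc j mod ?n)" | "x = vs ! (Suc j mod ?n)" "y = vs ! j"
      by (auto simp: doubleton_eq_iff)
    then show "y \<in> {vs ! (Suc i mod ?n), vs ! ((i + ?n - 1) mod ?n)}"
    proof cases
      case 1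
      then have "i = j" using nth_eq_iff_index_eq[OF assms(1)] i j(1) by blast
      then show ?thesis using 1 by simp
    next
      case 2
      have "Suc j mod ?n < ?n" using j(1) by (rule Suc_mod_less)
      then have "i = Suc j mod ?n" using nth_eq_iff_index_eq[OF assms(1)] i 2(1) by blast
      then have "(i + ?n - 1) mod ?n = j" using j(1) by (cases "Suc j = ?n") auto
      then show ?thesis using 2 by simp
    qed
  qed
  then have "card (nbrs (cycle_edges vs) x) \<le> card {vs ! (Suc i mod ?n), vs ! ((i + ?n - 1) mod ?n)}"
    by (intro card_mono) auto
  also have "\<dots> \<le> 2" by (simp add: card_insert_if)
  finally show ?thesis .
qed

lemma odd_cycle_crit:
  assumes vs: "distinct vs" "3 \<le> length vs" "odd (length vs)"
  shows "crit 2 (set vs) (cycle_edges vs)"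
proof (rule critI)
  let ?n = "length vs"
  show "simple_on (set vs) (cycle_edges vs)" using vs by (intro cycle_simple)
  show "\<not> colors (cycle_edges vs) (set vs) 2 c" for c
    using odd_cycle_not_2_colorable vs by blast
  show "\<exists>c. colors (cycle_edges vs - {e}) (set vs) 2 c" if "e \<in> cycle_edges vs" for e
  proof -
    obtain j where j: "j < ?n" "e = {vs ! j, vs ! (Suc j mod ?n)}"
      using \<open>e \<in> _\<close> by (auto simp: cycle_edges_def)
    \<comment> \<open>\<open>r\<close> renumbers the cycle so that it starts behind the deleted
      edge: position \<open>j + 1\<close> (modulo the length) gets 0 and \<open>j\<close> the last
      number. Every other edge joins consecutive numbers, so parity is a colouring.\<close>
    define r where "r i = (i + ?n - Suc j) mod ?n" for i
    define c where "c x = r (inv_into {..<?n} ((!) vs) x) mod 2" for x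
    have inj: "inj_on ((!) vs) {..<?n}" using vs(1) by (auto simp: inj_on_def nth_eq_iff_index_eq)
    have c: "c (vs ! i) = r i mod 2" if "i < ?n" for i
      using inv_into_f_f[OF inj, of i] that by (simp add: c_def)
    have step: "r (Suc i mod ?n) = Suc (r i)" if "i < ?n" "i \<noteq> j" for i
    proof (cases "i < j")
      case True
      then have "r i = i + ?n - Suc j" "Suc i mod ?n = Suc i" using that j by (auto simp: r_def)
      moreover have "r (Suc i) = Suc i + ?n - Suc j" using True that j by (simp add: r_def)
      ultimately show ?thesis using j by simp
    next
      case False
      then have "i + ?n - Suc j = (i - Suc j) + ?n" "i - Suc j < ?n" using that by auto
      then have ri: "r i = i - Suc j" unfolding r_def by (metis mod_add_self2 mod_less)
      show ?thesis
      proof (cases "Suc i = ?n")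
        case True
        then have "r (Suc i mod ?n) = ?n - Suc j" using j by (simp add: r_def)
        then show ?thesis using ri True False that by simp
      next
        case F: False
        then have "Suc i mod ?n = Suc i" "Suc i + ?n - Suc j = (i - j) + ?n" "i - j < ?n"
          using that False by auto
        then have "r (Suc i mod ?n) = i - j" unfolding r_def by (metis mod_add_self2 mod_less)
        then show ?thesis using ri False that by simp
      qed
    qed
    have "colors (cycle_edges vs - {e}) (set vs) 2 c"
      unfolding colors_def
    proof (intro conjI ballI impI)
      fix x y assume "{x, y} \<in> cycle_edges vs - {e}"
      then obtain i where i: "i < ?n" "{x, y} = {vs ! i, vs ! (Suc i mod ?n)}" "i \<noteq> j"
        using j by (auto simp: cycle_edges_def)
      have lt: "Suc i mod ?n < ?n" using i(1) by (rule Suc_mod_less)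
      have "Suc (r i) mod 2 \<noteq> r i mod 2" by presburger
      then have "c (vs ! i) \<noteq> c (vs ! (Suc i mod ?n))"
        using c[OF i(1)] c[OF lt] step[OF i(1,3)] by simp
      then show "c x \<noteq> c y" using i(2) by (auto simp: doubleton_eq_iff)
    qed (simp add: c_def)
    then show ?thesis by blast
  qed
  fix x assume "x \<in> set vs"
  then obtain i where "i < ?n" "x = vs ! i" by (metis in_set_conv_nth)
  then show "\<exists>y. {x, y} \<in> cycle_edges vs" by (auto simp: cycle_edges_def)
qed

text \<open>Without an edge \<open>{a, b}\<close> all 2-colourings give \<open>a\<close> and
  \<open>b\<close> the same colour, so a path from \<open>a\<close> to \<open>b\<close> exists and
  has even length; with the edge it closes to an odd cycle. This is not 2-colourable, hence by
  criticality it is everything.\<close>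

theorem crit_2_odd_cycle:
  assumes crit: "crit 2 V E"
  shows "\<exists>vs. distinct vs \<and> 3 \<le> length vs \<and> odd (length vs) \<and> V = set vs \<and> E = cycle_edges vs"
proof -
  note simple = crit_simple[OF crit]
  have "E \<noteq> {}"
  proof
    assume "E = {}"
    then have "colors E V 2 (\<lambda>_. 0)" by (simp add: colors_def)
    then show False using crit_not_colors[OF crit] by blast
  qed
  then obtain a b where ab: "{a, b} \<in> E" "a \<noteq> b" "a \<in> V" "b \<in> V"
    using simple_on_edgeE[OF simple] by (metis ex_in_conv)
  obtain c where c: "colors (E - {{a, b}}) V 2 c" using crit_colors_del[OF crit ab(1)] by blast
  have same: "d a = d b" if d: "colors (E - {{a, b}}) V 2 d" for d
  proof (rule ccontr)
    assume ne: "d a \<noteq> d b"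
    have "colors E V 2 d"
      unfolding colors_def
    proof (intro conjI ballI impI)
      fix x y assume xy: "x \<in> V" "y \<in> V" "{x, y} \<in> E"
      show "d x \<noteq> d y"
      proof (cases "{x, y} = {a, b}")
        case True
        then show ?thesis using ne by (auto simp: doubleton_eq_iff)
      next
        case False
        then show ?thesis using d xy by (auto simp: colors_def)
      qed
    qed (use d in \<open>auto simp: colors_def\<close>)
    then show False using crit_not_colors[OF crit] by blast
  qed
  define R where "R = {(x, y). {x, y} \<in> E - {{a, b}}}"
  have "(a, b) \<in> R\<^sup>*"
  proof (rule ccontr)
    assume nab: "(a, b) \<notin> R\<^sup>*"
    \<comment> \<open>Exchanging the two colours on the component of \<open>a\<close> would make
      \<open>a\<close> and \<open>b\<close> differ.\<close>
    define d where "d x = (if (a, x) \<in> R\<^sup>* then 1 - c x else c x)" for x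
    have "colors (E - {{a, b}}) V 2 d"
      unfolding colors_def
    proof (intro conjI ballI impI)
      fix x assume "x \<in> V"
      then show "d x < 2" using c by (auto simp: colors_def d_def)
    next
      fix x y assume xy: "x \<in> V" "y \<in> V" "{x, y} \<in> E - {{a, b}}"
      then have "(x, y) \<in> R" "(y, x) \<in> R" by (auto simp: R_def insert_commute)
      then have "(a, x) \<in> R\<^sup>* \<longleftrightarrow> (a, y) \<in> R\<^sup>*" by (meson rtrancl_into_rtrancl)
      moreover have "c x \<noteq> c y" "c x < 2" "c y < 2" using c xy by (auto simp: colors_def)
      ultimately show "d x \<noteq> d y" by (auto simp: d_def)
    qed
    then have "d a = d b" by (rule same)
    moreover have "c a = c b" using same[OF c] .
    moreover have "c a < 2" using c ab by (auto simp: colors_def)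
    moreover have "d a = 1 - c a" "d b = c b" using nab by (simp_all add: d_def)
    ultimately show False by arith
  qed
  then obtain p where p: "p \<noteq> []" "hd p = a" "last p = b" "distinct p" "successively (\<lambda>x y. (x, y) \<in> R) p"
    by (rule rtrancl_distinct_path)
  let ?n = "length p"
  have adj: "{p ! i, p ! Suc i} \<in> E - {{a, b}}" if "Suc i < ?n" for i
    using successively_nth[OF p(5) that] by (simp add: R_def)
  have "successively (\<lambda>x y. {x, y} \<in> E) p"
    by (rule successively_mono[OF p(5)]) (simp add: R_def)
  then have pV: "set p \<subseteq> V" using walk_in_verts[OF simple p(1)] p(2) ab by simp
  have n0: "0 < ?n" using p(1) by simp
  have ends: "p ! 0 = a" "p ! (?n - 1) = b" using p by (simp_all add: hd_conv_nth last_conv_nth)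
  have "c (p ! (?n - 1)) = (c (p ! 0) + (?n - 1)) mod 2"
  proof (rule alternating_colors[of ?n "\<lambda>i. c (p ! i)"])
    show "c (p ! Suc i) \<noteq> c (p ! i)" if "Suc i < ?n" for i
      using colorsD(2)[OF c _ _ adj[OF that]] pV that by (metis Suc_lessD nth_mem subsetD)
    show "c (p ! i) < 2" if "i < ?n" for i
      using c pV that nth_mem by (auto simp: colors_def)
  qed (use n0 in simp)
  then have "c a = (c a + (?n - 1)) mod 2" using ends same[OF c] by simp
  moreover have "c a < 2" using c ab by (auto simp: colors_def)
  ultimately have "even (?n - 1)" using add_mod_2_eq_iff[of "c a" "?n - 1"] by simp
  then have odd: "odd ?n" using n0 by (metis Suc_pred' even_Suc)
  have "?n \<noteq> 1" using ends ab(2) by auto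
  then have n3: "3 \<le> ?n" using odd n0 by presburger
  have sub: "cycle_edges p \<subseteq> E"
  proof
    fix e assume "e \<in> cycle_edges p"
    then obtain i where i: "i < ?n" "e = {p ! i, p ! (Suc i mod ?n)}" by (auto simp: cycle_edges_def)
    show "e \<in> E"
    proof (cases "Suc i = ?n")
      case True
      then have "i = ?n - 1" by simp
      then have "e = {b, a}" using i True ends by simp
      then show ?thesis using ab(1) by (simp add: insert_commute)
    next
      case False
      then show ?thesis using adj[of i] i by simp
    qed
  qed
  note no = odd_cycle_not_2_colorable[OF odd n3]
  have "V = set p"
  proof (rule ccontr)
    assume "V \<noteq> set p"
    then obtain d where d: "colors E (set p) 2 d" using crit_colors_subset[OF crit pV] by blast
    have "colors (cycle_edges p) (set p) 2 d"
      by (rule colors_mono[OF d]) (use sub in auto)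
    then show False using no by blast
  qed
  moreover have "E = cycle_edges p"
  proof (rule ccontr)
    assume "E \<noteq> cycle_edges p"
    then obtain e where e: "e \<in> E" "e \<notin> cycle_edges p" using sub by blast
    then obtain d where d: "colors (E - {e}) V 2 d" using crit_colors_del[OF crit] by blast
    have "colors (cycle_edges p) (set p) 2 d"
      by (rule colors_mono[OF d]) (use sub e pV in auto)
    then show False using no by blast
  qed
  ultimately show ?thesis using p(4) n3 odd by blast
qed

lemma crit_add_universal:
  assumes crit: "crit k V E" and k: "1 \<le> k" and h: "h \<notin> V"
  shows "crit (Suc k) (insert h V) (E \<union> {{h, x} | x. x \<in> V})"
proof (rule critI)
  note simple = crit_simple[OF crit]
  let ?F = "E \<union> {{h, x} | x. x \<in> V}"
  have F_iff: "{x, y} \<in> ?F \<longleftrightarrow> {x, y} \<in> E \<or> (x = h \<and> y \<in> V) \<or> (y = h \<and> x \<in> V)" for x y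
    using h by (auto simp: doubleton_eq_iff)
  show "simple_on (insert h V) ?F" using simple h by (auto simp: simple_on_def card_insert_if)
  have hE: "x \<noteq> h" "y \<noteq> h" if "{x, y} \<in> E" for x y using simple_onD[OF simple that] h by auto
  show "\<not> colors ?F (insert h V) (Suc k) c" for c
  proof
    assume "colors ?F (insert h V) (Suc k) c"
    then obtain d where d: "colors ?F (insert h V) (Suc k) d" "d h = k"
      using colors_recolor1[OF _ insertI1, of ?F h V "Suc k" c k] by auto
    have "d x < k" if "x \<in> V" for x
    proof -
      have "d h \<noteq> d x" using colorsD(2)[OF d(1), of h x] that by auto
      moreover have "d x < Suc k" using d(1) that by (auto simp: colors_def)
      ultimately show ?thesis using d(2) by simp
    qed
    then have "colors E V k d" using d(1) by (auto simp: colors_def)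
    then show False using crit_not_colors[OF crit] by blast
  qed
  \<comment> \<open>\<open>D\<close> holds the vertices that share the colour \<open>k\<close> with
    the hub: none if an edge of \<open>E\<close> is deleted, the vertex \<open>x\<close> if the
    spoke \<open>{h, x}\<close> is.\<close>
  have ext: "colors (?F - {e}) (insert h V) (Suc k) (\<lambda>x. if x \<in> insert h D then k else c x)"
    if c: "colors (E - {e}) (V - D) k c" and D: "D = {} \<or> (\<exists>x. x \<in> V \<and> D = {x} \<and> e = {h, x})" for e c D
    unfolding colors_def
  proof (intro conjI ballI impI)
    fix x assume "x \<in> insert h V"
    then show "(if x \<in> insert h D then k else c x) < Suc k"
      using c by (auto simp: colors_def less_SucI)
  next
    fix x y assume xy: "x \<in> insert h V" "y \<in> insert h V" "{x, y} \<in> ?F - {e}"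
    have "{x, x} \<notin> ?F" unfolding F_iff using simple_onD(3)[OF simple, of x x] h by blast
    moreover have F: "{x, y} \<in> ?F" using xy(3) by (rule DiffD1)
    ultimately have "x \<noteq> y" by (cases "x = y") (simp_all only: not_False_eq_True)
    have lt: "c t < k" if "t \<in> V" "t \<notin> D" for t using c that by (auto simp: colors_def)
    have "\<not> (x \<in> insert h D \<and> y \<in> insert h D)"
      using D xy(3) \<open>x \<noteq> y\<close> by (auto simp: insert_commute)
    moreover have "c x \<noteq> c y" if "x \<notin> insert h D" "y \<notin> insert h D"
    proof -
      have "{x, y} \<in> E - {e}" using xy(3) that F_iff[of x y] by auto
      then show ?thesis using c xy that by (auto simp: colors_def)
    qed
    ultimately show "(if x \<in> insert h D then k else c x) \<noteq> (if y \<in> insert h D then k else c y)"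
      using lt[of x] lt[of y] xy by auto
  qed
  show "\<exists>c. colors (?F - {e}) (insert h V) (Suc k) c" if e: "e \<in> ?F" for e
  proof (cases "e \<in> E")
    case True
    then obtain c where "colors (E - {e}) V k c" using crit_colors_del[OF crit] by blast
    then show ?thesis using ext[of e "{}" c] by auto
  next
    case False
    then obtain x where x: "e = {h, x}" "x \<in> V" using e by blast
    obtain c where c: "colors E (V - {x}) k c"
      using crit_colors_subset[OF crit, of "V - {x}"] x by blast
    have "colors (E - {e}) (V - {x}) k c" by (rule colors_mono[OF c]) auto
    then show ?thesis using ext[of e "{x}" c] x by auto
  qed
  fix x assume "x \<in> insert h V"
  then show "\<exists>y. {x, y} \<in> ?F"
    using crit_verts_nonempty[OF crit] F_iff by blast
qed

lemma odd_wheel_class_C: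
  assumes "odd_wheel G"
  shows "crit 3 (verts G) (edges G)" "cut_bounded 3 (verts G) (edges G)"
proof -
  obtain C h where C: "odd_cycle C" "h \<notin> verts C" "verts G = insert h (verts C)"
    "edges G = edges C \<union> {{h, v} | v. v \<in> verts C}"
    using assms unfolding odd_wheel_def by blast
  obtain vs where vs: "distinct vs" "3 \<le> length vs" "odd (length vs)" "verts C = set vs"
    "edges C = cycle_edges vs"
    using C(1) unfolding odd_cycle_iff by blast
  have C2: "crit 2 (verts C) (edges C)" using odd_cycle_crit[OF vs(1-3)] vs by simp
  have "crit (Suc 2) (verts G) (edges G)"
    unfolding C(3,4) by (rule crit_add_universal[OF C2]) (use C in auto)
  then show crit: "crit 3 (verts G) (edges G)" by (simp add: eval_nat_numeral)
  show "cut_bounded 3 (verts G) (edges G)"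
  proof (rule cut_bounded_degree[OF crit_simple[OF crit]])
    fix p assume p: "p \<in> verts G" "p \<noteq> h"
    then have "card (nbrs (edges C) p) \<le> 2" using cycle_degree[OF vs(1)] vs C by auto
    moreover have fin: "finite (nbrs (edges C) p)" using simple_on_finite(4)[OF crit_simple[OF C2]] .
    have "nbrs (edges G) p \<subseteq> insert h (nbrs (edges C) p)"
      using p unfolding C(4) by (auto simp: nbrs_def doubleton_eq_iff)
    then have "card (nbrs (edges G) p) \<le> card (insert h (nbrs (edges C) p))"
      using fin by (intro card_mono) auto
    moreover have "card (insert h (nbrs (edges C) p)) \<le> Suc (card (nbrs (edges C) p))"
      by (rule card_insert_le_m1) auto
    ultimately show "card (nbrs (edges G) p) \<le> 3" by linarith
  qed
qed

lemma universal_odd_wheel: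
  assumes simple: "simple_on (verts G) (edges G)" and v: "v \<in> verts G" "\<forall>x\<in>verts G - {v}. {v, x} \<in> edges G"
    and crit: "crit 2 (verts G - {v}) {e \<in> edges G. v \<notin> e}"
  shows "odd_wheel G"
proof -
  let ?C = "\<lparr>verts = verts G - {v}, edges = {e \<in> edges G. v \<notin> e}\<rparr>"
  have "odd_cycle ?C" unfolding odd_cycle_iff using crit_2_odd_cycle[OF crit] by simp
  moreover have "edges G = edges ?C \<union> {{v, x} | x. x \<in> verts ?C}"
  proof (intro set_eqI iffI)
    fix e assume e: "e \<in> edges G"
    then obtain x y where "e = {x, y}" "x \<noteq> y" "x \<in> verts G" "y \<in> verts G"
      using simple_on_edgeE[OF simple] by metis
    then show "e \<in> edges ?C \<union> {{v, x} | x. x \<in> verts ?C}" using e by (auto simp: insert_commute)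
  qed (use v in auto)
  moreover have "verts G = insert v (verts ?C)" "v \<notin> verts ?C" using v by auto
  ultimately show ?thesis unfolding odd_wheel_def by blast
qed

section \<open>Renaming vertices and the Hajos closure\<close>

lemma image_edge_iff:
  assumes "inj_on f V" "E \<subseteq> Pow V" "x \<in> V" "y \<in> V"
  shows "{f x, f y} \<in> (`) f ` E \<longleftrightarrow> {x, y} \<in> E"
proof
  assume "{f x, f y} \<in> (`) f ` E"
  then obtain e where e: "e \<in> E" "f ` e = f ` {x, y}" by auto
  then have "e = {x, y}" using assms inj_on_image_eq_iff[of f V e "{x, y}"] by blast
  then show "{x, y} \<in> E" using e(1) by simp
next
  assume "{x, y} \<in> E"
  then have "f ` {x, y} \<in> (`) f ` E" by (rule imageI)
  then show "{f x, f y} \<in> (`) f ` E" by simp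
qed

lemma colors_image:
  assumes f: "inj_on f V" and EV: "E \<subseteq> Pow V"
  shows "colors ((`) f ` E) (f ` V) k c \<longleftrightarrow> colors E V k (c \<circ> f)"
  using image_edge_iff[OF f EV] by (auto simp: colors_def)

lemma simple_on_Pow: "simple_on V E \<Longrightarrow> E \<subseteq> Pow V"
  by (auto simp: simple_on_def)

lemma crit_image:
  assumes crit: "crit k V E" and k: "1 \<le> k" and f: "inj_on f V"
  shows "crit k (f ` V) ((`) f ` E)"
proof (rule critI)
  note simple = crit_simple[OF crit]
  note EV = simple_on_Pow[OF simple]
  show "simple_on (f ` V) ((`) f ` E)"
    unfolding simple_on_def
  proof (intro conjI ballI)
    show "finite (f ` V)" using simple_on_finite(1)[OF simple] by simp
    fix e assume "e \<in> (`) f ` E"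
    then obtain e' where e': "e' \<in> E" "e = f ` e'" by blast
    then have "e' \<subseteq> V" "card e' = 2" using simple by (auto simp: simple_on_def)
    then show "e \<subseteq> f ` V" "card e = 2"
      using e'(2) card_image[OF inj_on_subset[OF f]] by auto
  qed
  show "\<not> colors ((`) f ` E) (f ` V) k c" for c
    using colors_image[OF f EV] crit_not_colors[OF crit] by blast
  show "\<exists>c. colors ((`) f ` E - {e}) (f ` V) k c" if "e \<in> (`) f ` E" for e
  proof -
    obtain e' where e': "e' \<in> E" "e = f ` e'" using \<open>e \<in> _\<close> by blast
    obtain c where c: "colors (E - {e'}) V k c" using crit_colors_del[OF crit e'(1)] by blast
    have "inj_on ((`) f) E" using inj_on_image_Pow[OF f] EV inj_on_subset by blast
    then have "(`) f ` E - {e} = (`) f ` (E - {e'})"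
      using inj_on_image_set_diff[of "(`) f" E E "{e'}"] e' by auto
    moreover have "colors E' V k ((c \<circ> inv_into V f) \<circ> f)" if "colors E' V k c" for E'
      using that f by (subst colors_cong[of V _ c]) auto
    then have "colors (E - {e'}) V k ((c \<circ> inv_into V f) \<circ> f)" using c by blast
    then have "colors ((`) f ` (E - {e'})) (f ` V) k (c \<circ> inv_into V f)"
      using EV by (subst colors_image[OF f]) auto
    ultimately show ?thesis by auto
  qed
  fix x assume "x \<in> f ` V"
  then obtain x' where x': "x' \<in> V" "x = f x'" by blast
  have "nbrs E x' \<noteq> {}" using crit_min_degree[OF crit x'(1)] k by auto
  then obtain y where "{x', y} \<in> E" by (auto simp: nbrs_def)
  then have "f ` {x', y} \<in> (`) f ` E" by (rule imageI)
  then have "{x, f y} \<in> (`) f ` E" using x'(2) by simp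
  then show "\<exists>y. {x, y} \<in> (`) f ` E" by blast
qed

lemma cut_bounded_image:
  assumes simple: "simple_on V E" and f: "inj_on f V" and bounded: "cut_bounded k V E"
  shows "cut_bounded k (f ` V) ((`) f ` E)"
  unfolding cut_bounded_def
proof (intro ballI impI)
  fix p' q' assume "p' \<in> f ` V" "q' \<in> f ` V" "p' \<noteq> q'"
  then obtain p q where pq: "p \<in> V" "q \<in> V" "p \<noteq> q" "p' = f p" "q' = f q" by blast
  then obtain Z where Z: "Z \<subseteq> V" "p \<in> Z" "q \<notin> Z" "card (cut E Z) \<le> k"
    using bounded unfolding cut_bounded_def by metis
  have "cut ((`) f ` E) (f ` Z) \<subseteq> map_prod f f ` cut E Z"
  proof
    fix s assume "s \<in> cut ((`) f ` E) (f ` Z)"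
    then obtain x' y' where s: "s = (x', y')" "x' \<in> f ` Z" "y' \<notin> f ` Z" "{x', y'} \<in> (`) f ` E"
      by (auto simp: cut_def)
    then obtain e where e: "e \<in> E" "{x', y'} = f ` e" by blast
    moreover from this have "e \<subseteq> V" using simple by (auto simp: simple_on_def)
    ultimately have "y' \<in> f ` V" by (metis image_mono insertCI subsetD)
    then obtain x y where xy: "x \<in> Z" "x' = f x" "y \<in> V" "y' = f y" using s(2) by blast
    then have "{x, y} \<in> E"
      using image_edge_iff[OF f simple_on_Pow[OF simple], of x y] s(4) Z(1) by auto
    then have "(x, y) \<in> cut E Z" using xy s(3) by (auto simp: cut_def)
    then show "s \<in> map_prod f f ` cut E Z" using xy s(1) by force
  qed
  moreover have fin: "finite (cut E Z)" using simple_on_finite(3)[OF simple] .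
  ultimately have "card (cut ((`) f ` E) (f ` Z)) \<le> card (map_prod f f ` cut E Z)"
    by (intro card_mono) auto
  also have "\<dots> \<le> card (cut E Z)" using fin by (rule card_image_le)
  also have "\<dots> \<le> k" by (rule Z(4))
  finally have "card (cut ((`) f ` E) (f ` Z)) \<le> k" .
  moreover have "f q \<notin> f ` Z" using f pq Z by (auto simp: inj_on_def)
  ultimately show "\<exists>Z\<subseteq>f ` V. p' \<in> Z \<and> q' \<notin> Z \<and> card (cut ((`) f ` E) Z) \<le> k"
    using Z pq by (intro exI[of _ "f ` Z"]) auto
qed

text \<open>Renaming \<open>v2\<close> to \<open>v1\<close> is injective on the second graph because
  disjointness keeps \<open>v1\<close> out of it; afterwards the two graphs share just
  \<open>v1\<close>.\<close>

lemma hajos_join_amalgam: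
  assumes s1: "simple_on (verts G1) (edges G1)" and s2: "simple_on (verts G2) (edges G2)"
    and disj: "verts G1 \<inter> verts G2 = {}" and e: "{v1, w1} \<in> edges G1" "{v2, w2} \<in> edges G2"
  defines "f \<equiv> id(v2 := v1)"
  shows "inj_on f (verts G2)"
    "verts (hajos_join G1 v1 w1 G2 v2 w2) = verts G1 \<union> f ` verts G2"
    "edges (hajos_join G1 v1 w1 G2 v2 w2) = hajos_edges v1 w1 w2 (edges G1) ((`) f ` edges G2)"
    "simple_on (f ` verts G2) ((`) f ` edges G2) \<Longrightarrow>
      amalgam v1 w1 w2 (verts G1) (edges G1) (f ` verts G2) ((`) f ` edges G2)"
proof -
  have v: "v1 \<in> verts G1" "v2 \<in> verts G2" "w2 \<in> verts G2" "v2 \<noteq> w2"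
    using simple_onD[OF s1 e(1)] simple_onD[OF s2 e(2)] by auto
  then have v1: "v1 \<notin> verts G2" using disj by blast
  show inj: "inj_on f (verts G2)" using v1 by (auto simp: f_def inj_on_def)
  have fV: "f ` verts G2 = insert v1 (verts G2 - {v2})" using v(2) by (auto simp: f_def)
  show "verts (hajos_join G1 v1 w1 G2 v2 w2) = verts G1 \<union> f ` verts G2"
    using v(1) unfolding fV by (auto simp: hajos_join_def)
  have fe: "f ` {v2, w2} = {v1, w2}" using v(4) by (auto simp: f_def)
  have "inj_on ((`) f) (edges G2)"
    using inj_on_image_Pow[OF inj] simple_on_Pow[OF s2] inj_on_subset by blast
  then have "(`) f ` (edges G2 - {{v2, w2}}) = (`) f ` edges G2 - {{v1, w2}}"
    using inj_on_image_set_diff[of "(`) f" "edges G2" "edges G2" "{{v2, w2}}"] e(2) fe by auto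
  then show "edges (hajos_join G1 v1 w1 G2 v2 w2) = hajos_edges v1 w1 w2 (edges G1) ((`) f ` edges G2)"
    by (simp add: hajos_join_def hajos_edges_def f_def)
  assume "simple_on (f ` verts G2) ((`) f ` edges G2)"
  moreover have "verts G1 \<inter> f ` verts G2 = {v1}" using v(1) disj unfolding fV by auto
  moreover have "{v1, w2} \<in> (`) f ` edges G2" using e(2) fe by (metis imageI)
  ultimately show "amalgam v1 w1 w2 (verts G1) (edges G1) (f ` verts G2) ((`) f ` edges G2)"
    using s1 e(1) by (simp add: amalgam_def)
qed

lemma class_C_hajos_join:
  assumes G: "G1 \<in> class_C k" "G2 \<in> class_C k" and k: "2 \<le> k"
    and disj: "verts G1 \<inter> verts G2 = {}" and e: "{v1, w1} \<in> edges G1" "{v2, w2} \<in> edges G2"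
  shows "hajos_join G1 v1 w1 G2 v2 w2 \<in> class_C k"
proof -
  define f where "f = id(v2 := v1)"
  have crit: "crit k (verts G1) (edges G1)" "crit k (verts G2) (edges G2)"
    and bounded: "cut_bounded k (verts G1) (edges G1)" "cut_bounded k (verts G2) (edges G2)"
    using G by (auto simp: class_C_iff)
  note s = crit_simple[OF crit(1)] crit_simple[OF crit(2)]
  note J = hajos_join_amalgam[OF s disj e, folded f_def]
  have crit2: "crit k (f ` verts G2) ((`) f ` edges G2)"
    using crit(2) k J(1) by (intro crit_image) auto
  note am = J(4)[OF crit_simple[OF crit2]]
  have bounded2: "cut_bounded k (f ` verts G2) ((`) f ` edges G2)"
    by (rule cut_bounded_image[OF s(2) J(1) bounded(2)])
  show ?thesis
    unfolding class_C_iff J(2,3)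
    using amalgam_crit[OF am crit(1) crit2 k] amalgam_cut_bounded[OF am bounded(1) bounded2] by blast
qed

section \<open>Closing the base graphs under Hajos joins\<close>

definition hajos_base :: "nat \<Rightarrow> 'a ugraph set" where
  "hajos_base k = (if k = 3 then {G. odd_wheel G} else {G. complete_graph (k + 1) G})"

lemma class_H_eq: "3 \<le> k \<Longrightarrow> class_H k = hajos_closure (hajos_base k)"
  by (auto simp: class_H_def hajos_base_def)

lemma complete_class_C:
  assumes "complete_graph (k + 1) G" "1 \<le> k"
  shows "G \<in> class_C k"
  using assms clique_crit clique_cut_bounded by (auto simp: class_C_iff complete_graph_iff)

lemma hajos_closure_class_C:
  assumes "G \<in> hajos_closure (hajos_base k)" and k: "3 \<le> k"
  shows "G \<in> class_C k"
  using assms(1)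
proof (induction rule: hajos_closure.induct)
  case (base G)
  show ?case
  proof (cases "k = 3")
    case True
    then show ?thesis using base odd_wheel_class_C[of G] by (simp add: hajos_base_def class_C_iff)
  next
    case False
    then show ?thesis using base complete_class_C[of k G] k by (simp add: hajos_base_def)
  qed
next
  case (join G1 G2 v1 w1 v2 w2)
  then show ?case using class_C_hajos_join k by (metis Suc_leD numeral_2_eq_2 numeral_3_eq_3)
qed

text \<open>For \<open>k = 3\<close> the complete graph needs no base case of its own: on four
  vertices it is the wheel over a triangle.\<close>

lemma hajos_indecomposable_base:
  assumes G: "G \<in> class_C k" and k: "3 \<le> k"
    and nosep: "\<And>v A B u w. \<not> hajos_sep (verts G) (edges G) v A B u w"
  shows "G \<in> hajos_base k"
proof -
  have crit: "crit k (verts G) (edges G)" and bounded: "cut_bounded k (verts G) (edges G)"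
    using G by (auto simp: class_C_iff)
  note simple = crit_simple[OF crit]
  from hajos_indecomposable[OF crit k bounded nosep]
  consider "card (verts G) = k + 1" "\<forall>x\<in>verts G. \<forall>y\<in>verts G. x \<noteq> y \<longrightarrow> {x, y} \<in> edges G"
    | v where "k = 3" "v \<in> verts G" "\<forall>x\<in>verts G - {v}. {v, x} \<in> edges G"
      "crit 2 (verts G - {v}) {e \<in> edges G. v \<notin> e}" by blast
  then show ?thesis
  proof cases
    case 1
    show ?thesis
    proof (cases "k = 3")
      case True
      obtain v where v: "v \<in> verts G" using crit_verts_nonempty[OF crit] by blast
      have univ: "{v, x} \<in> edges G" if "x \<in> verts G - {v}" for x using 1(2) v that by auto
      have "crit (Suc 2) (verts G) (edges G)" using crit True by (simp add: eval_nat_numeral)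
      then have "crit 2 (verts G - {v}) {e \<in> edges G. v \<notin> e}"
        by (rule crit_delete_universal) (use v univ in auto)
      then have "odd_wheel G" using universal_odd_wheel[OF simple v] univ by blast
      then show ?thesis using True by (simp add: hajos_base_def)
    next
      case False
      have "edges G = clique (verts G)"
      proof (intro set_eqI iffI)
        fix e assume "e \<in> edges G"
        then obtain x y where "e = {x, y}" "x \<noteq> y" "x \<in> verts G" "y \<in> verts G"
          using simple_on_edgeE[OF simple] by metis
        then show "e \<in> clique (verts G)" by (simp add: clique_iff)
      qed (use 1 in \<open>auto simp: clique_def\<close>)
      then show ?thesis using False 1(1) simple_on_finite(1)[OF simple]
        by (simp add: hajos_base_def complete_graph_iff)
    qed
  next
    case 2
    then show ?thesis using universal_odd_wheel[OF simple] by (simp add: hajos_base_def)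
  qed
qed

text \<open>Both parts of a separation have fewer vertices than \<open>G\<close>, so induction
  applies to them. The rule for joins wants disjoint graphs, hence the shared vertex is renamed in
  the second part.\<close>

lemma class_C_hajos_closure:
  fixes G :: "'a::infinite ugraph"
  assumes "G \<in> class_C k" and k: "3 \<le> k"
  shows "G \<in> hajos_closure (hajos_base k)"
  using assms(1)
proof (induction "card (verts G)" arbitrary: G rule: less_induct)
  case less
  show ?case
  proof (cases "\<exists>v A B u w. hajos_sep (verts G) (edges G) v A B u w")
    case False
    then have "G \<in> hajos_base k" using hajos_indecomposable_base[OF less.prems k] by blast
    then show ?thesis by (rule hajos_closure.base)
  next
    case True
    then obtain v A B u w where sep: "hajos_sep (verts G) (edges G) v A B u w" by blast
    note S = hajos_sepD[OF sep] and sep' = hajos_sep_sym[OF sep]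
    have crit: "crit k (verts G) (edges G)" and bounded: "cut_bounded k (verts G) (edges G)"
      using less.prems by (auto simp: class_C_iff)
    note simple = crit_simple[OF crit]
    define E1 where "E1 = insert {v, u} {e \<in> edges G. e \<subseteq> insert v A}"
    define E2 where "E2 = insert {v, w} {e \<in> edges G. e \<subseteq> insert v B}"
    have am: "amalgam v u w (insert v A) E1 (insert v B) E2"
      and EG: "edges G = hajos_edges v u w E1 E2" and VG: "verts G = insert v A \<union> insert v B"
      using hajos_sep_amalgam[OF crit k sep] unfolding E1_def E2_def by blast+
    have crit1: "crit k (insert v A) E1" and crit2: "crit k (insert v B) E2"
      using hajos_sep_crit(2)[OF crit k sep] hajos_sep_crit(2)[OF crit k sep']
      unfolding E1_def E2_def by blast+
    have bounded1: "cut_bounded k (insert v A) E1" and bounded2: "cut_bounded k (insert v B) E2"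
      using hajos_sep_cut_bounded[OF crit k sep bounded] hajos_sep_cut_bounded[OF crit k sep' bounded]
      unfolding E1_def E2_def by blast+
    have fin: "finite (verts G)" using simple_on_finite(1)[OF simple] .
    obtain v2 where v2: "v2 \<notin> verts G" using arb_element[OF fin] by blast
    define f where "f = id(v := v2)"
    have inj: "inj_on f (insert v B)" using v2 VG by (auto simp: f_def inj_on_def)
    have fB: "f ` insert v B = insert v2 B" using S(3) by (auto simp: f_def)
    define G1 where "G1 = \<lparr>verts = insert v A, edges = E1\<rparr>"
    define G2 where "G2 = \<lparr>verts = insert v2 B, edges = (`) f ` E2\<rparr>"
    have G1: "G1 \<in> class_C k" using crit1 bounded1 by (simp add: class_C_iff G1_def)
    have "crit k (f ` insert v B) ((`) f ` E2)" using crit2 k inj by (intro crit_image) auto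
    moreover have "cut_bounded k (f ` insert v B) ((`) f ` E2)"
      by (rule cut_bounded_image[OF crit_simple[OF crit2] inj bounded2])
    ultimately have G2: "G2 \<in> class_C k" unfolding fB by (simp add: class_C_iff G2_def)
    have "card (insert v A) < card (verts G)" "card (insert v B) < card (verts G)"
      using S(9-12) fin by (meson psubsetI psubset_card_mono)+
    moreover have "card (insert v2 B) = card (insert v B)" using card_image[OF inj] fB by simp
    ultimately have closed: "G1 \<in> hajos_closure (hajos_base k)" "G2 \<in> hajos_closure (hajos_base k)"
      using less.hyps[OF _ G1] less.hyps[OF _ G2] by (simp_all add: G1_def G2_def)
    have disj: "verts G1 \<inter> verts G2 = {}" using S(3,4) v2 VG by (auto simp: G1_def G2_def)
    have e1: "{v, u} \<in> edges G1" by (simp add: G1_def E1_def)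
    have "w \<noteq> v" using S(3,6) by blast
    then have "f ` {v, w} = {v2, w}" by (auto simp: f_def)
    then have e2: "{v2, w} \<in> edges G2" using E2_def by (auto simp: G2_def)
    have "G = hajos_join G1 v u G2 v2 w"
    proof -
      define g where "g = id(v2 := v)"
      have gf: "g ` f ` e = e" if "e \<subseteq> insert v B" for e
      proof -
        have "g (f x) = x" if "x \<in> insert v B" for x
          using that v2 VG by (auto simp: f_def g_def)
        then show ?thesis using that by (force simp: image_image)
      qed
      have sG: "simple_on (verts G1) (edges G1)" "simple_on (verts G2) (edges G2)"
        using G1 G2 crit_simple by (auto simp: class_C_iff)
      note J = hajos_join_amalgam[OF sG disj e1 e2, folded g_def]
      have "verts G = verts (hajos_join G1 v u G2 v2 w)"
        unfolding J(2) VG using gf[of "insert v B"] by (simp add: G1_def G2_def flip: fB)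
      moreover have "(`) g ` (`) f ` E2 = E2"
      proof -
        have "E2 \<subseteq> Pow (insert v B)" using simple_on_Pow[OF crit_simple[OF crit2]] .
        then have "g ` f ` e = e" if "e \<in> E2" for e
          using that by (intro gf) blast
        then show ?thesis by (force simp: image_image)
      qed
      then have "edges G = edges (hajos_join G1 v u G2 v2 w)"
        unfolding J(3) EG by (simp add: G1_def G2_def)
      ultimately show ?thesis by simp
    qed
    then show ?thesis using hajos_closure.join[OF closed disj e1 e2] by simp
  qed
qed

section \<open>The cases k <= 2\<close>

lemma crit_0_iff: "crit 0 V E \<longleftrightarrow> (\<exists>x. V = {x}) \<and> E = {}"
proof
  assume crit: "crit 0 V E"
  note simple = crit_simple[OF crit]
  obtain x where x: "x \<in> V" using crit_verts_nonempty[OF crit] by blast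
  have "V = {x}"
  proof (rule ccontr)
    assume "V \<noteq> {x}"
    then obtain c where "colors E {x} 0 c" using crit_colors_subset[OF crit, of "{x}"] x by blast
    then show False by (simp add: colors_def)
  qed
  moreover have "E = {}"
  proof (rule ccontr)
    assume "E \<noteq> {}"
    then obtain e where "e \<in> E" by blast
    then obtain a b where "a \<noteq> b" "a \<in> V" "b \<in> V" using simple_on_edgeE[OF simple] by metis
    then show False using \<open>V = {x}\<close> by simp
  qed
  ultimately show "(\<exists>x. V = {x}) \<and> E = {}" by blast
next
  assume "(\<exists>x. V = {x}) \<and> E = {}"
  then obtain x where "V = {x}" "E = {}" by blast
  moreover have "X = {}" if "X \<subset> {x}" for X using that by blast
  ultimately show "crit 0 V E" by (auto simp: crit_def simple_on_def colors_def)
qed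

text \<open>Two adjacent vertices already refuse a single colour, so by criticality there are no
  others.\<close>

lemma crit_1_clique:
  assumes crit: "crit 1 V E"
  shows "card V = 2" "E = clique V"
proof -
  note simple = crit_simple[OF crit]
  have "E \<noteq> {}"
  proof
    assume "E = {}"
    then have "colors E V 1 (\<lambda>_. 0)" by (simp add: colors_def)
    then show False using crit_not_colors[OF crit] by blast
  qed
  then obtain a b where ab: "{a, b} \<in> E" "a \<noteq> b" "a \<in> V" "b \<in> V"
    using simple_on_edgeE[OF simple] by (metis ex_in_conv)
  have V: "V = {a, b}"
  proof (rule ccontr)
    assume "V \<noteq> {a, b}"
    then obtain c where c: "colors E {a, b} 1 c"
      using crit_colors_subset[OF crit, of "{a, b}"] ab by blast
    then have "c a \<noteq> c b" using colorsD(2)[OF c, of a b] ab(1) by simp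
    moreover have "c a < 1" "c b < 1" using c by (auto simp: colors_def)
    ultimately show False by simp
  qed
  then show "card V = 2" using ab(2) by simp
  show "E = clique V"
  proof (intro set_eqI iffI)
    fix e assume "e \<in> E"
    then obtain x y where "e = {x, y}" "x \<noteq> y" "x \<in> V" "y \<in> V"
      using simple_on_edgeE[OF simple] by metis
    then show "e \<in> clique V" by (simp add: clique_iff)
  next
    fix e assume "e \<in> clique V"
    then have "e = {a, b}" using V by (auto simp: clique_def)
    then show "e \<in> E" using ab(1) by simp
  qed
qed

lemma class_C_0_iff: "G \<in> class_C 0 \<longleftrightarrow> complete_graph 1 G"
proof -
  have "cut_bounded 0 {x} E" for x :: 'a and E by (auto simp: cut_bounded_def)
  moreover have "clique {x} = {}" for x :: 'a by (auto simp: clique_def)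
  ultimately show ?thesis
    unfolding class_C_iff complete_graph_iff crit_0_iff by (auto simp: card_1_singleton_iff)
qed

lemma class_C_1_iff: "G \<in> class_C 1 \<longleftrightarrow> complete_graph 2 G"
proof
  assume "G \<in> class_C 1"
  then have crit: "crit 1 (verts G) (edges G)" by (simp add: class_C_iff)
  show "complete_graph 2 G"
    using crit_1_clique[OF crit] simple_on_finite(1)[OF crit_simple[OF crit]]
    by (simp add: complete_graph_iff)
next
  assume "complete_graph 2 G"
  then show "G \<in> class_C 1" using complete_class_C[of 1 G] by (simp add: numeral_2_eq_2)
qed

lemma class_C_2_iff: "G \<in> class_C 2 \<longleftrightarrow> odd_cycle G"
proof
  assume "G \<in> class_C 2"
  then have "crit 2 (verts G) (edges G)" by (simp add: class_C_iff)
  then show "odd_cycle G" unfolding odd_cycle_iff by (rule crit_2_odd_cycle)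
next
  assume "odd_cycle G"
  then obtain vs where vs: "distinct vs" "3 \<le> length vs" "odd (length vs)" "verts G = set vs"
    "edges G = cycle_edges vs"
    unfolding odd_cycle_iff by blast
  have "cut_bounded 2 (set vs) (cycle_edges vs)"
    by (rule cut_bounded_degree[OF cycle_simple[OF vs(1,2)]]) (rule cycle_degree[OF vs(1)])
  then show "G \<in> class_C 2" using odd_cycle_crit[OF vs(1-3)] vs(4,5) by (simp add: class_C_iff)
qed

theorem theorem9:
  fixes k :: nat
  shows "(class_C k :: 'a::infinite ugraph set) = class_H k"
proof -
  consider "k = 0" | "k = 1" | "k = 2" | "3 \<le> k" by linarith
  then show ?thesis
  proof cases
    case 1
    then show ?thesis using class_C_0_iff by (auto simp: class_H_def)
  next
    case 2
    then show ?thesis using class_C_1_iff by (auto simp: class_H_def numeral_2_eq_2)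
  next
    case 3
    then show ?thesis using class_C_2_iff by (auto simp: class_H_def)
  next
    case 4
    then show ?thesis using class_C_hajos_closure hajos_closure_class_C class_H_eq by blast
  qed
qed

end
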